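(* Let $F$ be a field of characteristic $2$, let $n\ge2$ be an integer, and let $\phi$ be an anisotropic quasilinear quadratic form over $F$ of dimension $2^n$. Then $\mathfrak i_1(\phi)=2^{n-2}$ if and only if $\mathrm{lndeg}(\phi)=n+1$ and $\phi$ is divisible by an $(n-2)$-fold quasi-Pfister form over $F$.
   Context: A quasilinear quadratic form over a field $K$ of characteristic 2 is a quadratic form $\phi$ on a finite-dimensional space with $\phi(v+w)=\phi(v)+\phi(w)$. $D(\phi)$ is its set of values; the norm field $N(\phi)$ is the subfield of $K$ generated over $K^2$ by all products $xy$ with $x,y\in D(\phi)$, and $\mathrm{lndeg}(\phi)=\log_2[N(\phi):K^2]$. The $m$-fold quasi-Pfister form $\langle\langle a_1,\dots,a_m\rangle\rangle$ is $\sum_{S\subseteq\{1,\dots,m\}}(\prod_{j\in S}a_j)x_S^2$ (the $0$-fold one is $\langle1\rangle$); $\phi$ is divisible by $\pi$ if $\phi\simeq\pi\otimes\sigma$ for a quasilinear $\sigma$. $\mathfrak i_0(\phi)$ is the dimension of $\{v:\phi(v)=0\}$; for anisotropic $\phi$ of dimension $\ge2$, $K(\phi)$ is the function field of the affine hypersurface $\{\phi=0\}$ and $\mathfrak i_1(\phi)=\mathfrak i_0(\phi_{K(\phi)})-\mathfrak i_0(\phi)$. *)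

theory Defs
  imports "HOL-Analysis.Analysis" "HOL-Library.Poly_Mapping"
begin

text \<open>A quasilinear quadratic form on the F-vector space F^N (N = CARD('n)):
  a map q with q(c v) = c^2 q(v) (quadratic form) and q(v+w) = q(v) + q(w).
  Its polar bilinear form is then identically zero (hence bilinear).\<close>
definition quasilinear_form :: "('a::field ^ 'n \<Rightarrow> 'a) \<Rightarrow> bool" where
  "quasilinear_form q \<longleftrightarrow>
     (\<forall>c v. q (c *s v) = c^2 * q v) \<and> (\<forall>v w. q (v + w) = q v + q w)"

definition anisotropic :: "('a::field ^ 'n \<Rightarrow> 'a) \<Rightarrow> bool" where
  "anisotropic q \<longleftrightarrow> (\<forall>v. q v = 0 \<longrightarrow> v = 0)"

text \<open>Coefficient of q at the i-th standard basis vector; q(v) = sum_i q(e_i) v_i^2.\<close>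
definition qcoef :: "('a::field ^ 'n \<Rightarrow> 'a) \<Rightarrow> 'n \<Rightarrow> 'a" where
  "qcoef q i = q (axis i 1)"

definition qext :: "('a::field \<Rightarrow> 'b::field) \<Rightarrow> ('a ^ 'n \<Rightarrow> 'a) \<Rightarrow> 'b ^ 'n \<Rightarrow> 'b" where
  "qext emb q v = (\<Sum>i\<in>UNIV. emb (qcoef q i) * (v $ i)^2)"

definition i0 :: "('a::field ^ 'n \<Rightarrow> 'a) \<Rightarrow> nat" where
  "i0 q = vec.dim {v. q v = 0}"

definition field_hom :: "('a::field \<Rightarrow> 'b::field) \<Rightarrow> bool" where
  "field_hom f \<longleftrightarrow> f 0 = 0 \<and> f 1 = 1 \<and> (\<forall>x y. f (x + y) = f x + f y) \<and>
                   (\<forall>x y. f (x * y) = f x * f y)"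

definition mpeval :: "('a::field \<Rightarrow> 'b::field) \<Rightarrow> ('n \<Rightarrow> 'b) \<Rightarrow> (('n \<Rightarrow>\<^sub>0 nat) \<Rightarrow>\<^sub>0 'a) \<Rightarrow> 'b" where
  "mpeval emb t p = (\<Sum>mon\<in>Poly_Mapping.keys p. emb (Poly_Mapping.lookup p mon) * (\<Prod>i\<in>Poly_Mapping.keys (mon :: 'n \<Rightarrow>\<^sub>0 nat). t i ^ Poly_Mapping.lookup mon i))"

definition qpoly :: "('a::field ^ 'n \<Rightarrow> 'a) \<Rightarrow> ('n \<Rightarrow>\<^sub>0 nat) \<Rightarrow>\<^sub>0 'a" where
  "qpoly q = (\<Sum>i\<in>UNIV. Poly_Mapping.single (Poly_Mapping.single i 2) (qcoef q i))"

text \<open>(L, emb, t) is (a model of) the function field F(q) of the affine hypersurface {q = 0}: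
  L is generated as a field over emb(F) by t, and t is a generic point of the hypersurface,
  i.e. the kernel of evaluation F[X] -> L at t is the ideal generated by the polynomial q.
  Thus L is the fraction field of F[X]/(q).\<close>
definition is_function_field ::
    "('a::field ^ 'n \<Rightarrow> 'a) \<Rightarrow> ('a \<Rightarrow> 'b::field) \<Rightarrow> ('n \<Rightarrow> 'b) \<Rightarrow> bool" where
  "is_function_field q emb t \<longleftrightarrow>
     field_hom emb \<and>
     (\<forall>p. mpeval emb t p = 0 \<longleftrightarrow> qpoly q dvd p) \<and>
     (\<forall>y. \<exists>p r. mpeval emb t r \<noteq> 0 \<and> y = mpeval emb t p / mpeval emb t r)"

text \<open>i_1(q) = i_0(q over F(q)) - i_0(q), computed in a model (L, emb, t) of F(q).\<close>
definition i1 :: "('a::field ^ 'n \<Rightarrow> 'a) \<Rightarrow> ('a \<Rightarrow> 'b::field) \<Rightarrow> nat" where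
  "i1 q emb = i0 (qext emb q :: 'b ^ 'n \<Rightarrow> 'b) - i0 q"

definition value_set :: "('a::field ^ 'n \<Rightarrow> 'a) \<Rightarrow> 'a set" where
  "value_set q = range q"

definition is_subfield :: "'a::field set \<Rightarrow> bool" where
  "is_subfield K \<longleftrightarrow> 0 \<in> K \<and> 1 \<in> K \<and> (\<forall>x\<in>K. \<forall>y\<in>K. x + y \<in> K \<and> x * y \<in> K) \<and>
                     (\<forall>x\<in>K. - x \<in> K \<and> inverse x \<in> K)"

definition subfield_generated :: "'a::field set \<Rightarrow> 'a set" where
  "subfield_generated S = \<Inter>{K. is_subfield K \<and> S \<subseteq> K}"

definition norm_field :: "('a::field ^ 'n \<Rightarrow> 'a) \<Rightarrow> 'a set" where
  "norm_field q = subfield_generated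
     (range (\<lambda>x. x^2) \<union> {x * y | x y. x \<in> value_set q \<and> y \<in> value_set q})"

text \<open>[N(q) : F^2]: scalars from F^2 = {c^2} act by multiplication, so the F^2-span of a set
  is its span for the scaling (c, x) |-> c^2 * x, and the degree is the corresponding dimension.\<close>
definition norm_degree :: "('a::field ^ 'n \<Rightarrow> 'a) \<Rightarrow> nat" where
  "norm_degree q = vector_space.dim (\<lambda>c x. c^2 * x) (norm_field q)"

definition lndeg :: "('a::field ^ 'n \<Rightarrow> 'a) \<Rightarrow> real" where
  "lndeg q = log 2 (real (norm_degree q))"

text \<open>q is divisible by the m-fold quasi-Pfister form <<b_0,...,b_{m-1}>>, i.e.
  q is isometric to <<b_0,...,b_{m-1}>> (x) sigma for a quasilinear sigma = <c_0,...,c_{k-1}>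
  (every quasilinear form is diagonalizable). The isometry is given by a basis e of F^N
  indexed by I = P({0..m-1}) x {0..k-1} in which q has the tensor-product diagonal shape.\<close>
definition divisible_by_quasi_pfister :: "nat \<Rightarrow> ('a::field ^ 'n \<Rightarrow> 'a) \<Rightarrow> bool" where
  "divisible_by_quasi_pfister m q \<longleftrightarrow>
     (\<exists>(b :: nat \<Rightarrow> 'a) (k :: nat) (c :: nat \<Rightarrow> 'a) (e :: nat set \<times> nat \<Rightarrow> 'a ^ 'n).
        let I = Pow {..<m} \<times> {..<k} in
        inj_on e I \<and> vec.independent (e ` I) \<and> vec.span (e ` I) = UNIV \<and>
        (\<forall>x :: nat set \<times> nat \<Rightarrow> 'a.
           q (\<Sum>p\<in>I. x p *s e p) = (\<Sum>(S, j)\<in>I. (\<Prod>i\<in>S. b i) * c j * (x (S, j))^2)))"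

end

theory Submission
  imports Defs
begin

text \<open>
  Regard \<open>F\<close> as a vector space over \<open>F\<^sup>2\<close> and let \<open>V \<ni> 1\<close> be the space of values of \<open>\<phi>\<close>, scaled.
  The square of the function field is \<open>F\<^sup>2(x\<^sup>2)(g)\<close> with \<open>g\<close> a generic element of \<open>V\<close>, so
  \<open>2 (dim \<phi> - i\<^sub>1(\<phi>))\<close> is the maximum of \<open>dim (V + uV)\<close> over \<open>u \<in> V - F\<^sup>2\<close>, and
  \<open>i\<^sub>1(\<phi>) = 2\<^bsup>n-2\<^esup>\<close> says that this maximum is \<open>3 \<cdot> 2\<^bsup>n-1\<^esup>\<close>.

  Call \<open>u\<close> good if it attains the maximum.  Perturbing \<open>u\<close> to \<open>u + s\<^sup>2a\<close> keeps it good for almost all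
  \<open>s\<close>, which forces \<open>E u = V \<inter> uV\<close> to stabilise \<open>V + uV\<close>; comparing dimensions, \<open>E u\<close> is a field of
  degree \<open>2\<^bsup>n-1\<^esup>\<close> over \<open>F\<^sup>2\<close>.  For good \<open>v\<close> outside \<open>E u\<close> the field \<open>D = E u \<inter> E v\<close> has degree
  \<open>2\<^bsup>n-2\<^esup>\<close>, the same perturbation argument gives \<open>DV \<subseteq> V + v (E u)\<close>, and a third good element \<open>z\<close>
  yields \<open>V = D + uD + vD + zD\<close> with norm field \<open>D(u, v, z)\<close> of degree 8 over \<open>D\<close>.  Conversely, for
  such \<open>V\<close> the eight square-free products of \<open>u, v, z\<close> are independent over \<open>D\<close>, so every element of \<open>V - D\<close>
  is good.
\<close>

text \<open>Two principles drive the argument. The first is semicontinuity of rank: a family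
  independent at one parameter stays independent off the zero set of a nonzero polynomial. It turns
  the rank over the function field into a maximum over actual elements \<open>u\<close>. It also
  explains the perturbation step: if \<open>x\<close> and \<open>u * x\<close> lie in
  \<open>V\<close>, then \<open>s^2 * (a * x) = u * x + (u + s^2 * a) * x\<close> puts
  \<open>a * x\<close> into the perturbed sum for every nonzero \<open>s\<close>, so outside the
  original sum it would raise the dimension above the maximum. The second is that a field of finite
  degree over F^2 has degree a power of two, so bounds such as 6 times 2^(n-2) snap to exact
  degrees. Perturbation needs infinitely many \<open>s\<close>. Anisotropy in dimension at least 2
  provides them, because a finite field of characteristic 2 is perfect. The obstacle is the
  comparison with the function field, which has one coordinate that is a square root of the generic
  value \<open>g\<close>. Specialising it would leave F, so the squares of all values are
  specialised instead.\<close>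

section \<open>Finite-dimensional subspaces\<close>

text \<open>A separate locale is needed because the library interprets \<open>vector_space\<close> for real
  vector spaces without a mandatory name prefix, so constants added to \<open>vector_space\<close> itself
  would be shadowed.\<close>

locale vspace = vector_space
begin

text \<open>The ambient space may be infinite-dimensional, since F can have infinite degree over its
  squares; finiteness is therefore attached to single subspaces.\<close>

definition fin_dim :: "'b set \<Rightarrow> bool" where
  "fin_dim S \<longleftrightarrow> subspace S \<and> (\<exists>B. finite B \<and> S \<subseteq> span B)"

lemma fin_dim_subspace: "fin_dim S \<Longrightarrow> subspace S"
  by (simp add: fin_dim_def)

lemma fin_dim_basis:
  assumes "fin_dim S"
  obtains B where "finite B" "B \<subseteq> S" "independent B" "span B = S" "card B = dim S"
proof -
  obtain T where T: "finite T" "S \<subseteq> span T" and S: "subspace S"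
    using assms by (auto simp: fin_dim_def)
  obtain B where B: "B \<subseteq> S" "independent B" "S \<subseteq> span B" "card B = dim S"
    using basis_exists by blast
  have "finite B"
    using independent_span_bound[OF T(1) B(2)] B(1) T(2) by blast
  moreover have "span B = S"
    using span_subspace B S by blast
  ultimately show ?thesis
    using that B by blast
qed

lemma fin_dim_span: "finite B \<Longrightarrow> fin_dim (span B)"
  by (auto simp: fin_dim_def)

lemma fin_dim_subset: "fin_dim T \<Longrightarrow> subspace S \<Longrightarrow> S \<subseteq> T \<Longrightarrow> fin_dim S"
  by (auto simp: fin_dim_def)

lemma fin_dim_Int: "fin_dim S \<Longrightarrow> subspace T \<Longrightarrow> fin_dim (S \<inter> T)"
  by (rule fin_dim_subset) (auto intro: subspace_inter fin_dim_subspace)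

lemma subspace_set_plus: "subspace S \<Longrightarrow> subspace T \<Longrightarrow> subspace (S + T)"
  using subspace_sums[of S T] by (simp add: set_plus_def) (smt (verit) Collect_cong)

lemma span_Un_set_plus: "span (S \<union> T) = span S + span T"
  unfolding span_Un set_plus_def by blast

lemma fin_dim_set_plus:
  assumes "fin_dim S" "fin_dim T"
  shows "fin_dim (S + T)"
proof -
  obtain B where B: "finite B" "span B = S" using fin_dim_basis[OF assms(1)] by metis
  obtain C where C: "finite C" "span C = T" using fin_dim_basis[OF assms(2)] by metis
  have "S + T = span (B \<union> C)" using B C by (simp add: span_Un_set_plus)
  then show ?thesis using B C by (simp add: fin_dim_span)
qed

lemma fin_dim_dim_mono:
  assumes "fin_dim T" "S \<subseteq> T"
  shows "dim S \<le> dim T"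
proof -
  obtain B where "finite B" "span B = T" "card B = dim T"
    using fin_dim_basis[OF assms(1)] by metis
  then show ?thesis
    using dim_le_card[of S B] assms(2) by auto
qed

lemma fin_dim_subset_eqI:
  assumes "fin_dim T" "subspace S" "S \<subseteq> T" "dim T \<le> dim S"
  shows "S = T"
proof (rule ccontr)
  assume "S \<noteq> T"
  then obtain x where x: "x \<in> T" "x \<notin> S" using assms(3) by blast
  obtain B where B: "finite B" "B \<subseteq> S" "independent B" "span B = S" "card B = dim S"
    using fin_dim_basis[OF fin_dim_subset[OF assms(1-3)]] by metis
  obtain C where C: "finite C" "span C = T" "card C = dim T"
    using fin_dim_basis[OF assms(1)] by metis
  have "independent (insert x B)"
    using x B by (simp add: independent_insertI)
  moreover have "insert x B \<subseteq> span C" using x B C assms(3) by auto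
  ultimately have "card (insert x B) \<le> card C"
    using independent_span_bound[OF C(1)] by blast
  moreover have "x \<notin> B" using x B by auto
  ultimately show False using B C assms(4) by simp
qed

lemma fin_dim_complement:
  assumes "fin_dim T" "subspace S" "S \<subseteq> T"
  obtains C where "subspace C" "C \<subseteq> T" "S \<inter> C = {0}" "S + C = T" "dim S + dim C = dim T"
proof -
  obtain B where B: "finite B" "B \<subseteq> S" "independent B" "span B = S" "card B = dim S"
    using fin_dim_basis[OF fin_dim_subset[OF assms]] by metis
  obtain A where A: "B \<subseteq> A" "A \<subseteq> T" "independent A" "T \<subseteq> span A"
    using maximal_independent_subset_extend[of B T] B assms(3) by (metis order.trans)
  have sT: "subspace T" using assms(1) by (rule fin_dim_subspace)
  have spA: "span A = T" using A sT by (simp add: span_subspace)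
  have dA: "card A = dim T" using A by (simp add: basis_card_eq_dim)
  obtain X where "finite X" "span X = T" using fin_dim_basis[OF assms(1)] by metis
  then have fA: "finite A" using independent_span_bound[of X A] A by auto
  have iC: "independent (A - B)" using A(3) independent_mono by blast
  have "span B \<inter> span (A - B) = {0}"
  proof -
    have "x = 0" if x: "x \<in> span B" "x \<in> span (A - B)" for x
    proof -
      have "representation A x = representation B x"
        using representation_extend[OF A(3) x(1) A(1)] .
      moreover have "representation A x = representation (A - B) x"
        using representation_extend[OF A(3) x(2)] by blast
      moreover have "representation B x b = 0" if "b \<notin> B" for b
        using representation_ne_zero that by metis
      moreover have "representation (A - B) x b = 0" if "b \<in> B" for b
        using representation_ne_zero that by blast
      ultimately have "representation A x b = 0" for b
        by metis
      then show "x = 0"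
        using sum_nonzero_representation_eq[OF A(3), of x] spA x(1) B(4) assms(3)
        by (auto simp: subset_iff)
    qed
    then show ?thesis by (auto simp: span_zero)
  qed
  moreover have "S + span (A - B) = T"
    using span_Un_set_plus[of B "A - B"] A(1) B(4) spA by (simp add: Un_absorb1)
  moreover have "dim S + dim (span (A - B)) = dim T"
    using iC dA B(1,5) card_mono[OF fA A(1)] A(1)
    by (simp add: dim_eq_card_independent card_Diff_subset)
  moreover have "span (A - B) \<subseteq> T" using spA span_mono[of "A - B" A] by blast
  ultimately show ?thesis
    using that[of "span (A - B)"] B(4) by blast
qed

lemma dim_direct_sum:
  assumes "fin_dim S" "fin_dim T" "S \<inter> T = {0}"
  shows "dim (S + T) = dim S + dim T"
proof -
  obtain B where B: "finite B" "B \<subseteq> S" "independent B" "span B = S" "card B = dim S"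
    using fin_dim_basis[OF assms(1)] by metis
  obtain C where C: "finite C" "C \<subseteq> T" "independent C" "span C = T" "card C = dim T"
    using fin_dim_basis[OF assms(2)] by metis
  have "0 \<notin> B" using B(3) dependent_zero by blast
  moreover have "B \<inter> C \<subseteq> {0}" using Int_mono[OF B(2) C(2)] assms(3) by simp
  ultimately have disj: "B \<inter> C = {}" by auto
  have "independent (B \<union> C)"
  proof (rule independent_if_scalars_zero)
    fix f x assume s: "(\<Sum>x\<in>B \<union> C. scale (f x) x) = 0" and x: "x \<in> B \<union> C"
    let ?b = "\<Sum>x\<in>B. scale (f x) x" and ?c = "\<Sum>x\<in>C. scale (f x) x"
    have bc: "?b + ?c = 0" using s by (simp add: sum.union_disjoint B C disj)
    have b: "?b \<in> S" and c: "?c \<in> T"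
      unfolding B(4)[symmetric] C(4)[symmetric] by (auto intro: span_sum span_scale span_base)
    have "?b = - ?c" using bc by (simp add: eq_neg_iff_add_eq_0)
    then have "?b \<in> T" using c assms(2) by (simp add: fin_dim_subspace subspace_neg)
    with b have "?b \<in> S \<inter> T" by (rule IntI)
    then have "?b = 0" using assms(3) by simp
    moreover from this have "?c = 0" using bc by simp
    ultimately show "f x = 0"
      using independentD[OF B(3) B(1) order.refl] independentD[OF C(3) C(1) order.refl] x by blast
  qed (simp add: B C)
  moreover have "S + T = span (B \<union> C)" using B C by (simp add: span_Un_set_plus)
  ultimately show ?thesis
    using B C disj by (simp add: dim_eq_card_independent card_Un_disjoint)
qed

lemma dim_set_plus_Int:
  assumes "fin_dim S" "fin_dim T"
  shows "dim (S + T) + dim (S \<inter> T) = dim S + dim T"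
proof -
  have sub: "subspace S" "subspace T" using assms by (auto intro: fin_dim_subspace)
  obtain C where C: "subspace C" "C \<subseteq> T" "(S \<inter> T) \<inter> C = {0}" "(S \<inter> T) + C = T"
      "dim (S \<inter> T) + dim C = dim T"
    using fin_dim_complement[OF assms(2) subspace_inter[OF sub]] by blast
  have "S + T \<subseteq> S + C"
  proof
    fix x assume "x \<in> S + T"
    then obtain s t where st: "x = s + t" "s \<in> S" "t \<in> T" by (auto elim: set_plus_elim)
    then obtain a c where "t = a + c" "a \<in> S" "c \<in> C"
      using C(4) by (metis IntD1 set_plus_elim)
    then show "x \<in> S + C"
      using st sub(1) by (metis add.assoc set_plus_intro subspace_add)
  qed
  then have "S + T = S + C" using C(2) by (simp add: set_plus_mono2 subset_antisym)
  moreover have "S \<inter> C = {0}" using C(2,3) by (simp add: Int_assoc inf_absorb2)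
  ultimately show ?thesis
    using dim_direct_sum[OF assms(1) fin_dim_subset[OF assms(2) C(1,2)]] C(5) by simp
qed

text \<open>Independence of a family rather than of a set: a repeated vector is a dependence, and
  coefficients can be indexed by pairs.\<close>

definition indep_fam :: "'i set \<Rightarrow> ('i \<Rightarrow> 'b) \<Rightarrow> bool" where
  "indep_fam I b \<longleftrightarrow> (\<forall>c. (\<Sum>i\<in>I. scale (c i) (b i)) = 0 \<longrightarrow> (\<forall>i\<in>I. c i = 0))"

lemma indep_famD: "indep_fam I b \<Longrightarrow> (\<Sum>i\<in>I. scale (c i) (b i)) = 0 \<Longrightarrow> i \<in> I \<Longrightarrow> c i = 0"
  by (auto simp: indep_fam_def)

lemma span_image_explicit:
  assumes "finite I"
  shows "span (b ` I) = range (\<lambda>c. \<Sum>i\<in>I. scale (c i) (b i))"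
proof
  show "span (b ` I) \<subseteq> range (\<lambda>c. \<Sum>i\<in>I. scale (c i) (b i))"
  proof (rule span_minimal)
    show "b ` I \<subseteq> range (\<lambda>c. \<Sum>i\<in>I. scale (c i) (b i))"
    proof
      fix x assume "x \<in> b ` I"
      then obtain j where j: "j \<in> I" "x = b j" by blast
      have "(\<Sum>i\<in>I. scale (if i = j then 1 else 0) (b i)) = (\<Sum>i\<in>I. if i = j then b i else 0)"
        by (rule sum.cong) auto
      then show "x \<in> range (\<lambda>c. \<Sum>i\<in>I. scale (c i) (b i))"
        using j assms by (intro range_eqI[of _ _ "\<lambda>i. if i = j then 1 else 0"]) simp
    qed
    show "subspace (range (\<lambda>c. \<Sum>i\<in>I. scale (c i) (b i)))"
    proof (rule subspaceI)
      show "0 \<in> range (\<lambda>c. \<Sum>i\<in>I. scale (c i) (b i))"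
        by (intro range_eqI[of _ _ "\<lambda>_. 0"]) simp
    next
      fix x y
      assume "x \<in> range (\<lambda>c. \<Sum>i\<in>I. scale (c i) (b i))" "y \<in> range (\<lambda>c. \<Sum>i\<in>I. scale (c i) (b i))"
      then obtain c d where "x = (\<Sum>i\<in>I. scale (c i) (b i))" "y = (\<Sum>i\<in>I. scale (d i) (b i))" by blast
      then show "x + y \<in> range (\<lambda>c. \<Sum>i\<in>I. scale (c i) (b i))"
        by (intro range_eqI[of _ _ "\<lambda>i. c i + d i"]) (simp add: scale_left_distrib sum.distrib)
    next
      fix x and a
      assume "x \<in> range (\<lambda>c. \<Sum>i\<in>I. scale (c i) (b i))"
      then obtain c where "x = (\<Sum>i\<in>I. scale (c i) (b i))" by blast
      then show "scale a x \<in> range (\<lambda>c. \<Sum>i\<in>I. scale (c i) (b i))"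
        by (intro range_eqI[of _ _ "\<lambda>i. a * c i"]) (simp add: scale_sum_right)
    qed
  qed
qed (auto intro: span_sum span_scale span_base)

lemma indep_fam_inj_on:
  assumes "finite I" "indep_fam I b"
  shows "inj_on b I"
proof (rule inj_onI, rule ccontr)
  fix i j assume ij: "i \<in> I" "j \<in> I" "b i = b j" "i \<noteq> j"
  have "(\<Sum>k\<in>I. scale (if k = i then 1 else if k = j then - 1 else 0) (b k))
      = (\<Sum>k\<in>I. (if k = i then b k else 0) + (if k = j then - b k else 0))"
    using ij by (intro sum.cong) auto
  also have "\<dots> = 0" using ij assms(1) by (simp add: sum.distrib)
  finally show False
    using indep_famD[OF assms(2), of "\<lambda>k. if k = i then 1 else if k = j then - 1 else 0" i] ij by simp
qed

lemma indep_fam_independent: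
  assumes "finite I" "indep_fam I b"
  shows "independent (b ` I)"
proof (rule independent_if_scalars_zero)
  have inj: "inj_on b I" using indep_fam_inj_on assms .
  fix f x assume "(\<Sum>x\<in>b ` I. scale (f x) x) = 0" and x: "x \<in> b ` I"
  then have "(\<Sum>i\<in>I. scale (f (b i)) (b i)) = 0" by (simp add: sum.reindex[OF inj])
  then show "f x = 0" using indep_famD[OF assms(2), of "\<lambda>i. f (b i)"] x by blast
qed (simp add: assms)

lemma indep_fam_dim:
  assumes "finite I" "indep_fam I b"
  shows "dim (span (b ` I)) = card I"
  using indep_fam_independent[OF assms] indep_fam_inj_on[OF assms]
  by (simp add: dim_eq_card_independent card_image)

lemma indep_fam_if_dim:
  assumes "finite I" "dim (span (b ` I)) = card I"
  shows "indep_fam I b"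
proof -
  obtain B where B: "B \<subseteq> b ` I" "independent B" "b ` I \<subseteq> span B" "card B = dim (b ` I)"
    using basis_exists by blast
  have "card (b ` I) \<le> card I" using assms(1) card_image_le by blast
  then have "B = b ` I"
    using card_seteq[of "b ` I" B] B assms by simp
  then have ind: "independent (b ` I)" and inj: "inj_on b I"
    using B assms by (auto intro: eq_card_imp_inj_on)
  show ?thesis unfolding indep_fam_def
  proof (intro allI impI ballI)
    fix c i assume s: "(\<Sum>i\<in>I. scale (c i) (b i)) = 0" and i: "i \<in> I"
    have "(\<Sum>x\<in>b ` I. scale (c (the_inv_into I b x)) x) = 0"
      using s by (simp add: sum.reindex[OF inj] the_inv_into_f_f[OF inj])
    then have "c (the_inv_into I b (b i)) = 0"
      using independentD[OF ind _ order.refl, of "\<lambda>x. c (the_inv_into I b x)" "b i"] i assms(1) by auto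
    then show "c i = 0" using the_inv_into_f_f[OF inj i] by simp
  qed
qed

lemma indep_fam_basis:
  assumes "independent B" "finite B"
  shows "indep_fam B (\<lambda>x. x)"
  unfolding indep_fam_def using independentD[OF assms(1,2) order.refl] by blast

lemma indep_fam_maximal:
  assumes "finite I"
  obtains J where "J \<subseteq> I" "indep_fam J b" "span (b ` J) = span (b ` I)"
proof -
  obtain B where B: "B \<subseteq> b ` I" "independent B" "b ` I \<subseteq> span B" "card B = dim (b ` I)"
    using basis_exists by blast
  obtain J where J: "J \<subseteq> I" "inj_on b J" "b ` J = B"
    using B(1) unfolding subset_image_inj by blast
  have "finite J" using J assms finite_subset by blast
  have "span (b ` J) = span (b ` I)"
    unfolding span_eq J(3) using B(1,3) span_superset by blast
  moreover have "indep_fam J b"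
    using B(2) J \<open>finite J\<close> by (intro indep_fam_if_dim) (auto simp: dim_eq_card_independent card_image)
  ultimately show ?thesis using that J by blast
qed

end

locale vspace_pair = vs1: vspace s1 + vs2: vspace s2
  for s1 :: "'a::field \<Rightarrow> 'b::ab_group_add \<Rightarrow> 'b" and s2 :: "'a::field \<Rightarrow> 'c::ab_group_add \<Rightarrow> 'c"
begin

sublocale vector_space_pair s1 s2 ..

lemma fin_dim_image:
  assumes "Vector_Spaces.linear s1 s2 f" "vs1.fin_dim S"
  shows "vs2.fin_dim (f ` S)"
proof -
  obtain B where "finite B" "vs1.span B = S" using vs1.fin_dim_basis[OF assms(2)] by metis
  moreover have "vs2.span (f ` B) = f ` vs1.span B" using assms(1) by (rule linear_span_image)
  ultimately show ?thesis using vs2.fin_dim_span[of "f ` B"] by simp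
qed

lemma dim_image_inj_on:
  assumes "Vector_Spaces.linear s1 s2 f" "vs1.fin_dim S" "inj_on f S"
  shows "vs2.dim (f ` S) = vs1.dim S"
proof -
  obtain B where B: "finite B" "B \<subseteq> S" "vs1.independent B" "vs1.span B = S" "card B = vs1.dim S"
    using vs1.fin_dim_basis[OF assms(2)] by metis
  have "vs2.independent (f ` B)"
    using linear_independent_injective_image[OF assms(1) B(3)] assms(3) B(4) by simp
  moreover have "vs2.span (f ` B) = f ` S"
    using linear_span_image[OF assms(1), of B] B(4) by simp
  ultimately show ?thesis
    using B assms(3) by (metis card_image inj_on_subset vs2.dim_span_eq_card_independent)
qed

lemma rank_nullity:
  assumes "Vector_Spaces.linear s1 s2 f" "vs1.fin_dim S"
  shows "vs1.dim {x\<in>S. f x = 0} + vs2.dim (f ` S) = vs1.dim S"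
proof -
  have S: "vs1.subspace S" using assms(2) by (rule vs1.fin_dim_subspace)
  let ?N = "{x\<in>S. f x = 0}"
  have "?N = S \<inter> {x. f x = 0}" by blast
  then have N: "vs1.subspace ?N"
    using vs1.subspace_inter[OF S linear_subspace_kernel[OF assms(1)]] by simp
  obtain C where C: "vs1.subspace C" "C \<subseteq> S" "?N \<inter> C = {0}" "?N + C = S"
      "vs1.dim ?N + vs1.dim C = vs1.dim S"
    using vs1.fin_dim_complement[OF assms(2) N] by blast
  have "inj_on f C"
  proof (rule inj_onI)
    fix x y assume xy: "x \<in> C" "y \<in> C" "f x = f y"
    then have "x - y \<in> C" using C(1) vs1.subspace_diff by blast
    moreover have "f (x - y) = 0" using xy assms(1) by (simp add: linear_diff)
    ultimately have "x - y \<in> ?N \<inter> C" using C(2) by blast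
    then show "x = y" unfolding C(3) by simp
  qed
  moreover have "f ` C = f ` S"
  proof
    show "f ` S \<subseteq> f ` C"
    proof
      fix y assume "y \<in> f ` S"
      then obtain x where x: "x \<in> S" "y = f x" by blast
      then have "x \<in> ?N + C" unfolding C(4) by blast
      then obtain a c where ac: "x = a + c" "a \<in> ?N" "c \<in> C" by (rule set_plus_elim)
      then have "f x = f c" using assms(1) by (simp add: linear_add)
      then show "y \<in> f ` C" using ac x by blast
    qed
  qed (use C(2) in blast)
  ultimately show ?thesis
    using dim_image_inj_on[OF assms(1) vs1.fin_dim_subset[OF assms(2) C(1,2)]] C(5) by simp
qed

end

section \<open>Fields of characteristic two as vector spaces over their squares\<close>

locale char2_field =
  fixes F :: "'a::field itself"
  assumes char2: "CHAR('a) = 2"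
begin

lemma add_self: "(x::'a) + x = 0"
proof -
  have "of_nat 2 = (0::'a)" using of_nat_CHAR[where 'a = 'a] char2 by metis
  then have "(2::'a) = 0" by simp
  then show ?thesis by (metis mult_2 mult_zero_left)
qed

lemma uminus_eq: "- (x::'a) = x"
  using add_self[of x] by (simp add: eq_neg_iff_add_eq_0 neg_eq_iff_add_eq_0)

lemma minus_eq: "(x::'a) - y = x + y"
  using uminus_eq[of y] by (metis diff_conv_add_uminus)

lemma add_eq_0_iff_eq: "(x::'a) + y = 0 \<longleftrightarrow> x = y"
  using minus_eq[of x y] by (metis right_minus_eq)

lemma add_eq_iff: "(x::'a) + y = z \<longleftrightarrow> x = z + y"
  by (metis add.assoc add.right_neutral add_self)

lemma square_add: "((x::'a) + y)^2 = x^2 + y^2"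
proof -
  have "(x + y)^2 = x^2 + y^2 + (x * y + x * y)" by (simp add: power2_eq_square algebra_simps)
  then show ?thesis by (simp add: add_self)
qed

lemma square_sum: "(\<Sum>i\<in>I. f i :: 'a)^2 = (\<Sum>i\<in>I. (f i)^2)"
  by (induction I rule: infinite_finite_induct) (auto simp: square_add)

lemma square_eq_iff: "(x::'a)^2 = y^2 \<longleftrightarrow> x = y"
proof
  assume "x^2 = y^2"
  then have "(x + y)^2 = 0" by (simp add: square_add add_self)
  then show "x = y" by (simp add: add_eq_0_iff_eq)
qed simp

text \<open>Frobenius is additive here, so F acts on itself through its squares. All of
  \<open>span\<close>, \<open>dim\<close> and \<open>independent\<close> below are over F^2, and a
  coefficient \<open>c\<close> stands for the scalar \<open>c^2\<close>.\<close>

sublocale vspace "\<lambda>c x::'a. c^2 * x"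
  by unfold_locales (simp_all add: square_add algebra_simps power_mult_distrib)

lemma vspace_pair_self: "vspace_pair (\<lambda>c x::'a. c^2 * x) (\<lambda>c x::'a. c^2 * x)"
  by unfold_locales

lemma linear_mult: "Vector_Spaces.linear (\<lambda>c x::'a. c^2 * x) (\<lambda>c x::'a. c^2 * x) ((*) x)"
  by unfold_locales (simp_all add: algebra_simps)

lemma elt_set_times_image: "x *o S = (*) x ` (S :: 'a set)"
  by (auto simp: elt_set_times_def)

lemma subspace_times: "subspace S \<Longrightarrow> subspace (x *o S)"
  unfolding elt_set_times_image
  by (rule module_hom.subspace_image[OF Vector_Spaces.linear.axioms(3)[OF linear_mult]])

lemma fin_dim_times: "fin_dim S \<Longrightarrow> fin_dim (x *o S)"
  unfolding elt_set_times_image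
  by (rule vspace_pair.fin_dim_image[OF vspace_pair_self linear_mult])

lemma dim_times: "fin_dim S \<Longrightarrow> x \<noteq> 0 \<Longrightarrow> dim (x *o S) = dim S"
  unfolding elt_set_times_image
  by (rule vspace_pair.dim_image_inj_on[OF vspace_pair_self linear_mult]) (auto intro: inj_onI)

lemma span_times: "span (x *o S) = x *o span S"
  unfolding elt_set_times_image
  by (rule module_hom.span_image[OF Vector_Spaces.linear.axioms(3)[OF linear_mult]])

section \<open>Fields between F^2 and F, and their modules\<close>

text \<open>Closure under inverses is automatic, as \<open>x\<inverse> = (x\<inverse>)\<^sup>2 x\<close>.\<close>

definition sqfield :: "'a set \<Rightarrow> bool" where
  "sqfield D \<longleftrightarrow> subspace D \<and> 1 \<in> D \<and> (\<forall>x\<in>D. \<forall>y\<in>D. x * y \<in> D)"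

definition sqmodule :: "'a set \<Rightarrow> 'a set \<Rightarrow> bool" where
  "sqmodule D V \<longleftrightarrow> subspace V \<and> (\<forall>d\<in>D. \<forall>x\<in>V. d * x \<in> V)"

lemma subspace_square_times: "subspace S \<Longrightarrow> x \<in> S \<Longrightarrow> c^2 * x \<in> S"
  by (rule subspace_scale)

text \<open>Division and multiplication by \<open>x\<close> differ by a scalar:
  \<open>y / x = (inverse x)^2 * (y * x)\<close>. For \<open>x = 0\<close> the quotient is 0 by
  convention.\<close>

lemma subspace_divide: "subspace S \<Longrightarrow> y * x \<in> S \<Longrightarrow> y / x \<in> S"
  using subspace_square_times[of S "y * x" "inverse x"]
  by (cases "x = 0") (auto simp: subspace_0 power2_eq_square field_simps)

lemma sqfieldD:
  assumes "sqfield D"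
  shows "subspace D" "1 \<in> D" "0 \<in> D" "x \<in> D \<Longrightarrow> y \<in> D \<Longrightarrow> x * y \<in> D" "x \<in> D \<Longrightarrow> y \<in> D \<Longrightarrow> x + y \<in> D"
  using assms by (auto simp: sqfield_def subspace_0 subspace_add)

lemma sqfield_square: "sqfield D \<Longrightarrow> c^2 \<in> D"
  using subspace_square_times[of D 1 c] by (simp add: sqfield_def)

lemma sqfield_divide: "sqfield D \<Longrightarrow> x \<in> D \<Longrightarrow> y \<in> D \<Longrightarrow> x / y \<in> D"
  by (intro subspace_divide) (auto simp: sqfield_def)

lemma sqfield_inverse: "sqfield D \<Longrightarrow> y \<in> D \<Longrightarrow> inverse y \<in> D"
  using sqfield_divide[of D 1 y] by (simp add: sqfield_def inverse_eq_divide)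

lemma sqmoduleD:
  assumes "sqmodule D V"
  shows "subspace V" "0 \<in> V" "d \<in> D \<Longrightarrow> x \<in> V \<Longrightarrow> d * x \<in> V" "x \<in> V \<Longrightarrow> y \<in> V \<Longrightarrow> x + y \<in> V"
  using assms by (auto simp: sqmodule_def subspace_0 subspace_add)

lemma sqmodule_self: "sqfield D \<Longrightarrow> D \<subseteq> M \<Longrightarrow> sqfield M \<Longrightarrow> sqmodule D M"
  by (auto simp: sqfield_def sqmodule_def)

lemma sqmodule_times: "sqmodule D V \<Longrightarrow> sqmodule D (x *o V)"
  unfolding sqmodule_def elt_set_times_image
  using subspace_times[of V x, unfolded elt_set_times_image] by (auto simp: mult.left_commute)

lemma sqmodule_plus:
  assumes "sqmodule D V" "sqmodule D W"
  shows "sqmodule D (V + W)"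
  unfolding sqmodule_def
proof (intro conjI ballI)
  show "subspace (V + W)" using assms by (simp add: sqmodule_def subspace_set_plus)
  fix d x assume "d \<in> D" "x \<in> V + W"
  then obtain v w where "x = v + w" "v \<in> V" "w \<in> W" by (auto elim: set_plus_elim)
  then show "d * x \<in> V + W"
    using assms \<open>d \<in> D\<close> by (auto simp: sqmodule_def distrib_left)
qed

text \<open>A nonzero common element \<open>x * d\<close> could be divided by \<open>d\<close>,
  which is invertible in \<open>D\<close>, and would put \<open>x\<close> itself into
  \<open>V\<close>.\<close>

lemma sqmodule_Int_times:
  assumes "sqfield D" "sqmodule D V" "x \<notin> V"
  shows "V \<inter> x *o D = {0}"
proof -
  have "y = 0" if y: "y \<in> V" "y \<in> x *o D" for y
  proof (rule ccontr)
    assume "y \<noteq> 0"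
    obtain d where d: "d \<in> D" "y = x * d" using y by (auto simp: elt_set_times_def)
    then have "inverse d * y = x" using \<open>y \<noteq> 0\<close> by simp
    moreover have "inverse d * y \<in> V"
      using sqmoduleD(3)[OF assms(2) sqfield_inverse[OF assms(1) d(1)] y(1)] .
    ultimately show False using assms(3) by simp
  qed
  moreover have "0 \<in> V \<inter> x *o D"
    using assms sqfieldD(3) by (auto simp: sqmodule_def subspace_0 elt_set_times_def)
  ultimately show ?thesis by blast
qed

lemma sqmodule_dim_plus_times:
  assumes "sqfield D" "fin_dim D" "sqmodule D V" "fin_dim V" "x \<notin> V"
  shows "dim (V + x *o D) = dim V + dim D"
proof -
  have "x \<noteq> 0" using assms(3,5) sqmoduleD(2) by blast
  then show ?thesis
    using dim_direct_sum[OF assms(4) fin_dim_times[OF assms(2)] sqmodule_Int_times[OF assms(1,3,5)]]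
      dim_times[OF assms(2)] by simp
qed

text \<open>The square \<open>x^2\<close> already lies in \<open>M\<close>, so \<open>1\<close> and
  \<open>x\<close> generate the extension of \<open>M\<close> by \<open>x\<close>.\<close>

lemma sqfield_adjoin:
  assumes "sqfield M"
  shows "sqfield (M + x *o M)"
  unfolding sqfield_def
proof (intro conjI ballI)
  have M: "subspace M" using assms sqfieldD(1) by blast
  then show "subspace (M + x *o M)" by (intro subspace_set_plus subspace_times)
  have "1 + x * 0 \<in> M + x *o M"
    using sqfieldD(2,3)[OF assms] by blast
  then show "1 \<in> M + x *o M" by simp
  fix y z assume "y \<in> M + x *o M" "z \<in> M + x *o M"
  then obtain a b c d where *: "y = a + x * b" "z = c + x * d" "a \<in> M" "b \<in> M" "c \<in> M" "d \<in> M"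
    by (auto elim!: set_plus_elim simp: elt_set_times_def)
  have "y * z = (a * c + x^2 * (b * d)) + x * (a * d + b * c)"
    using * by (simp add: algebra_simps power2_eq_square)
  moreover have "a * c + x^2 * (b * d) \<in> M" "a * d + b * c \<in> M"
    using * by (auto intro!: sqfieldD[OF assms] sqfield_square[OF assms])
  ultimately show "y * z \<in> M + x *o M" by (metis set_plus_intro set_times_intro2)
qed

lemma sqfield_adjoin_dim:
  assumes "sqfield M" "fin_dim M" "x \<notin> M"
  shows "dim (M + x *o M) = 2 * dim M"
  using sqmodule_dim_plus_times[OF assms(1,2) sqmodule_self[OF assms(1) _ assms(1)] assms(2,3)] by simp

lemma subset_adjoin: "subspace M \<Longrightarrow> M \<subseteq> M + x *o M"
  using set_zero_plus2[of "x *o M" M] subspace_0[OF subspace_times, of M x] by (simp add: add.commute)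

lemma adjoin_mem: "sqfield M \<Longrightarrow> x \<in> M + x *o M"
proof -
  assume "sqfield M"
  then have "0 + x * 1 \<in> M + x *o M" by (metis set_plus_intro set_times_intro2 sqfieldD(2,3))
  then show ?thesis by simp
qed

lemma adjoin_subset: "sqfield D \<Longrightarrow> M \<subseteq> D \<Longrightarrow> x \<in> D \<Longrightarrow> M + x *o M \<subseteq> D"
  by (auto elim!: set_plus_elim simp: elt_set_times_def sqfieldD subset_iff)

text \<open>The field generated over F^2 by the first \<open>m\<close> of the \<open>b i\<close>,
  that is, the value set of the corresponding quasi-Pfister form. Its degree is less than
  \<open>2 ^ m\<close> when that form is isotropic.\<close>

definition pfister :: "(nat \<Rightarrow> 'a) \<Rightarrow> nat \<Rightarrow> 'a set" where
  "pfister b m = span (prod b ` Pow {..<m})"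

lemma fin_dim_pfister: "fin_dim (pfister b m)"
  by (simp add: pfister_def fin_dim_span)

lemma pfister_0: "pfister b 0 = span {1}"
  by (simp add: pfister_def)

lemma pfister_Suc: "pfister b (Suc m) = pfister b m + b m *o pfister b m"
proof -
  have "prod b ` insert m ` Pow {..<m} = b m *o (prod b ` Pow {..<m})"
    unfolding elt_set_times_image image_image
    by (rule image_cong) (auto simp: finite_subset intro!: prod.insert)
  then show ?thesis
    by (simp add: pfister_def lessThan_Suc Pow_insert image_Un span_Un_set_plus span_times)
qed

lemma sqfield_squares: "sqfield (span {1})"
proof -
  have "1 \<in> span {1}" by (simp add: span_base)
  moreover have "x * y \<in> span {1}" if "x \<in> span {1}" "y \<in> span {1}" for x y
    using that unfolding span_singleton by (auto simp: power_mult_distrib[symmetric])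
  ultimately show ?thesis unfolding sqfield_def by auto
qed

lemma dim_squares: "dim (span {1}) = 1"
  using dim_eq_card_independent[of "{1}"] by simp

lemma sqfield_pfister: "sqfield (pfister b m)"
  by (induction m) (simp_all add: pfister_0 sqfield_squares pfister_Suc sqfield_adjoin)

lemma sqfield_contains_squares: "sqfield D \<Longrightarrow> span {1} \<subseteq> D"
  by (simp add: sqfieldD(1,2) span_minimal)

lemma pfister_cong: "(\<And>i. i < m \<Longrightarrow> b i = c i) \<Longrightarrow> pfister b m = pfister c m"
  unfolding pfister_def by (intro arg_cong[of _ _ span] image_cong) (auto intro!: prod.cong)

text \<open>Each element adjoined from \<open>D\<close> doubles the degree, and the process stops
  because \<open>m < 2 ^ m \<le> dim D\<close>. This supplies both the powers of two used for all
  degree estimates and the quasi-Pfister form used for divisibility.\<close>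

lemma sqfield_eq_pfister:
  assumes "sqfield D" "fin_dim D"
  obtains b m where "D = pfister b m" "dim D = 2 ^ m"
proof -
  let ?P = "\<lambda>m. \<exists>b. pfister b m \<subseteq> D \<and> dim (pfister b m) = 2 ^ m"
  have "?P 0" using sqfield_contains_squares[OF assms(1)] dim_squares by (simp add: pfister_0)
  moreover have "m \<le> dim D" if "?P m" for m
  proof -
    have "2 ^ m \<le> dim D" using that fin_dim_dim_mono[OF assms(2)] by metis
    then show ?thesis by (meson less_exp less_imp_le order.trans)
  qed
  ultimately have "\<exists>m. ?P m \<and> (\<forall>k. ?P k \<longrightarrow> k \<le> m)"
    by (intro Nat.ex_has_greatest_nat[of ?P] allI impI)
  then obtain m where m': "?P m \<and> (\<forall>k. ?P k \<longrightarrow> k \<le> m)" ..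
  note m = conjunct1[OF m'] conjunct2[OF m', rule_format]
  from m(1) obtain b where b: "pfister b m \<subseteq> D" "dim (pfister b m) = 2 ^ m" by blast
  have "pfister b m = D"
  proof (rule ccontr)
    assume "pfister b m \<noteq> D"
    then obtain x where x: "x \<in> D" "x \<notin> pfister b m" using b(1) by blast
    have eq: "pfister (b(m := x)) m = pfister b m" by (rule pfister_cong) simp
    have "pfister (b(m := x)) (Suc m) = pfister b m + x *o pfister b m"
      by (simp only: pfister_Suc eq) simp
    then have "?P (Suc m)"
      using x b adjoin_subset[OF assms(1) b(1) x(1)]
        sqfield_adjoin_dim[OF sqfield_pfister fin_dim_pfister x(2)] by (intro exI[of _ "b(m := x)"]) simp
    then show False using m(2)[of "Suc m"] by simp
  qed
  then show ?thesis using that b by blast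
qed

text \<open>A maximal \<open>D\<close>-independent family \<open>c\<close> in \<open>V\<close>,
  multiplied by an F^2-basis \<open>d\<close> of \<open>D\<close>, is an F^2-basis of
  \<open>V\<close>. Indexing it by pairs gives exactly the diagonal of a tensor product of
  forms.\<close>

lemma sqmodule_basis:
  assumes "sqfield D" "fin_dim V" "sqmodule D V" "finite I" "indep_fam I d" "span (d ` I) = D"
  obtains k c where "indep_fam (I \<times> {..<k}) (\<lambda>(i, j). d i * c j)"
    "span ((\<lambda>(i, j). d i * c j) ` (I \<times> {..<k})) = V" "dim V = dim D * k"
proof -
  let ?f = "\<lambda>c (i, j::nat). d i * c j"
  let ?P = "\<lambda>k::nat. \<exists>c. indep_fam (I \<times> {..<k}) (?f c) \<and> ?f c ` (I \<times> {..<k}) \<subseteq> V"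
  have cI: "card I = dim D" using indep_fam_dim[OF assms(4,5)] assms(6) by simp
  have "I \<noteq> {}"
  proof
    assume "I = {}"
    then have "D = {0}" using assms(6) by simp
    then show False using sqfieldD(2)[OF assms(1)] by simp
  qed
  then have cI1: "card I \<ge> 1" using assms(4) by (simp add: Suc_le_eq card_gt_0_iff)
  have "?P 0" by (simp add: indep_fam_def)
  moreover have "k \<le> dim V" if Pk: "?P k" for k
  proof -
    obtain c where c: "indep_fam (I \<times> {..<k}) (?f c)" "?f c ` (I \<times> {..<k}) \<subseteq> V" using Pk by blast
    have "card I * k = dim (?f c ` (I \<times> {..<k}))"
      using indep_fam_dim[OF _ c(1)] assms(4) by (simp add: card_cartesian_product)
    also have "\<dots> \<le> dim V" using fin_dim_dim_mono[OF assms(2) c(2)] .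
    finally have "card I * k \<le> dim V" .
    moreover have "1 * k \<le> card I * k" using cI1 by (rule mult_le_mono1)
    ultimately show ?thesis by linarith
  qed
  ultimately have "\<exists>k. ?P k \<and> (\<forall>l. ?P l \<longrightarrow> l \<le> k)"
    by (intro Nat.ex_has_greatest_nat[of ?P] allI impI)
  then obtain k where k': "?P k \<and> (\<forall>l. ?P l \<longrightarrow> l \<le> k)" ..
  note k = conjunct1[OF k'] conjunct2[OF k', rule_format]
  from k(1) obtain c where c: "indep_fam (I \<times> {..<k}) (?f c)" "?f c ` (I \<times> {..<k}) \<subseteq> V" by blast
  let ?W = "span (?f c ` (I \<times> {..<k}))"
  have V: "subspace V" using assms(3) sqmoduleD by blast
  have dD: "d i \<in> D" if "i \<in> I" for i using assms(6) that span_base[of "d i" "d ` I"] by blast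
  \<comment> \<open>For fixed \<open>j\<close> the vectors \<open>d i * c j\<close> span
    \<open>c j *o D\<close>, so \<open>?W\<close> is a sum of copies of \<open>D\<close>.\<close>
  have modW: "sqmodule D ?W"
    unfolding sqmodule_def
  proof (intro conjI ballI subspace_span)
    fix e x assume e: "e \<in> D" and "x \<in> ?W"
    from this(2) show "e * x \<in> ?W"
    proof (induction x rule: span_induct_alt)
      case base then show ?case by (simp add: span_zero)
    next
      case (step a y z)
      then obtain i j where ij: "i \<in> I" "j < k" "y = d i * c j" by auto
      have "e * d i \<in> span (d ` I)" using sqfieldD(4)[OF assms(1) e dD[OF ij(1)]] assms(6) by simp
      then have "c j * (e * d i) \<in> c j *o span (d ` I)" by blast
      also have "\<dots> = span (c j *o (d ` I))" by (simp add: span_times)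
      also have "\<dots> \<subseteq> ?W"
        using ij by (intro span_mono) (force simp: elt_set_times_image mult.commute)
      finally have "a^2 * (c j * (e * d i)) \<in> ?W" by (rule span_scale)
      moreover have "e * (a^2 * y + z) = a^2 * (c j * (e * d i)) + e * z"
        using ij by (simp add: algebra_simps)
      ultimately show ?case using step span_add by metis
    qed
  qed
  have "?W = V"
  proof (rule ccontr)
    assume "?W \<noteq> V"
    moreover have "?W \<subseteq> V" using c(2) V by (simp add: span_minimal)
    ultimately obtain x where x: "x \<in> V" "x \<notin> ?W" by blast
    let ?c = "c(k := x)"
    have split: "I \<times> {..<Suc k} = I \<times> {..<k} \<union> (\<lambda>i. (i, k)) ` I" by (auto simp: less_Suc_eq)
    have "indep_fam (I \<times> {..<Suc k}) (?f ?c)"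
      unfolding indep_fam_def
    proof (intro allI impI ballI)
      fix e p assume s: "(\<Sum>p\<in>I \<times> {..<Suc k}. (e p)^2 * ?f ?c p) = 0" and p: "p \<in> I \<times> {..<Suc k}"
      have 1: "(\<Sum>p\<in>I \<times> {..<k}. (e p)^2 * ?f ?c p) = (\<Sum>p\<in>I \<times> {..<k}. (e p)^2 * ?f c p)"
        by (rule sum.cong) auto
      let ?d = "\<Sum>i\<in>I. (e (i, k))^2 * d i"
      have 2: "(\<Sum>p\<in>(\<lambda>i. (i, k)) ` I. (e p)^2 * ?f ?c p) = x * ?d"
        by (subst sum.reindex) (auto simp: inj_on_def sum_distrib_left algebra_simps)
      \<comment> \<open>The coefficients of the new vector \<open>x\<close> collect to an element
        \<open>?d\<close> of \<open>D\<close> with \<open>x * ?d\<close> in \<open>?W\<close>. As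
        \<open>x\<close> is not in \<open>?W\<close>, this forces \<open>?d = 0\<close>, and the old
        and new coefficients vanish separately.\<close>
      have eq: "(\<Sum>p\<in>I \<times> {..<k}. (e p)^2 * ?f c p) + x * ?d = 0"
        using s unfolding split by (subst (asm) sum.union_disjoint) (use assms(4) 1 2 in auto)
      have dD': "?d \<in> D" unfolding assms(6)[symmetric] by (intro span_sum span_scale span_base) auto
      have "(\<Sum>p\<in>I \<times> {..<k}. (e p)^2 * ?f c p) \<in> ?W" by (intro span_sum span_scale span_base) auto
      then have "x * ?d \<in> ?W \<inter> x *o D"
        using eq dD' by (auto simp: add_eq_0_iff_eq)
      then have "x * ?d = 0" using sqmodule_Int_times[OF assms(1) modW x(2)] by blast
      moreover have "x \<noteq> 0" using x(2) span_zero by metis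
      ultimately have d0: "?d = 0" by simp
      then have "(\<Sum>p\<in>I \<times> {..<k}. (e p)^2 * ?f c p) = 0" using eq by simp
      then have "\<forall>p\<in>I \<times> {..<k}. e p = 0" using indep_famD[OF c(1)] by blast
      moreover have "\<forall>i\<in>I. e (i, k) = 0" using indep_famD[OF assms(5) d0] by blast
      ultimately show "e p = 0" using p split by auto
    qed
    moreover have "?f ?c ` (I \<times> {..<Suc k}) \<subseteq> V"
      unfolding split image_Un using c(2) x(1) dD sqmoduleD(3)[OF assms(3)] by (fastforce simp: image_iff)
    ultimately show False using k(2)[of "Suc k"] by (metis Suc_n_not_le_n)
  qed
  moreover have "dim V = dim D * k"
    using indep_fam_dim[OF _ c(1)] assms(4) \<open>?W = V\<close> cI by (simp add: card_cartesian_product)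
  ultimately show ?thesis using that c(1) by blast
qed

lemma sqmodule_dim_dvd:
  assumes "sqfield D" "fin_dim D" "fin_dim V" "sqmodule D V"
  shows "dim D dvd dim V"
proof -
  obtain B where B: "finite B" "B \<subseteq> D" "independent B" "span B = D"
    using fin_dim_basis[OF assms(2)] by metis
  show ?thesis
    by (rule sqmodule_basis[OF assms(1,3,4) B(1) indep_fam_basis[OF B(3,1)]]) (use B(4) in auto)
qed

end

section \<open>Independence at a generic point\<close>

text \<open>Fraction-free Gaussian elimination over a ring \<open>R\<close> of functions.  For \<open>Z = {0}\<close> the
  hypothesis says that the vectors have no relation over \<open>R\<close>; for \<open>Z = {f. f x\<^sub>0 = 0}\<close> it says
  that they are independent at the point \<open>x\<^sub>0\<close>.\<close>

lemma generic_independence: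
  fixes R Z :: "('x \<Rightarrow> 'a::field) set" and v :: "'i \<Rightarrow> 'k \<Rightarrow> 'x \<Rightarrow> 'a"
  assumes "finite I"
    and one: "(\<lambda>_. 1) \<in> R" and diff: "\<And>f g. f \<in> R \<Longrightarrow> g \<in> R \<Longrightarrow> (\<lambda>x. f x - g x) \<in> R"
    and mult: "\<And>f g. f \<in> R \<Longrightarrow> g \<in> R \<Longrightarrow> (\<lambda>x. f x * g x) \<in> R"
    and one_Z: "(\<lambda>_. 1) \<notin> Z"
    and prime_Z: "\<And>f g. f \<in> R \<Longrightarrow> g \<in> R \<Longrightarrow> (\<lambda>x. f x * g x) \<in> Z \<Longrightarrow> f \<in> Z \<or> g \<in> Z"
    and "\<And>i k. i \<in> I \<Longrightarrow> k \<in> K \<Longrightarrow> v i k \<in> R"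
    and "\<And>c. (\<And>i. i \<in> I \<Longrightarrow> c i \<in> R) \<Longrightarrow> (\<And>k. k \<in> K \<Longrightarrow> (\<lambda>x. \<Sum>i\<in>I. c i x * v i k x) \<in> Z)
           \<Longrightarrow> (\<And>i. i \<in> I \<Longrightarrow> c i \<in> Z)"
  shows "\<exists>f\<in>R. f \<notin> Z \<and> (\<forall>x. f x \<noteq> 0 \<longrightarrow>
           (\<forall>e. (\<forall>k\<in>K. (\<Sum>i\<in>I. e i * v i k x) = 0) \<longrightarrow> (\<forall>i\<in>I. e i = 0)))"
  using assms(1,7,8)
proof (induction I arbitrary: v rule: finite_induct)
  case empty
  show ?case using one one_Z by (intro bexI[of _ "\<lambda>_. 1"]) auto
next
  case (insert m I)
  have zero: "(\<lambda>_. 0) \<in> R" using diff[OF one one] by simp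
  have neg: "(\<lambda>x. - f x) \<in> R" if "f \<in> R" for f using diff[OF zero that] by simp
  have add: "(\<lambda>x. f x + g x) \<in> R" if "f \<in> R" "g \<in> R" for f g using diff[OF that(1) neg[OF that(2)]] by simp
  have sum: "(\<lambda>x. \<Sum>i\<in>J. f i x) \<in> R" if "\<And>i. i \<in> J \<Longrightarrow> f i \<in> R" for J and f :: "'i \<Rightarrow> 'x \<Rightarrow> 'a"
    using that by (induction J rule: infinite_finite_induct) (auto intro: zero add)
  have ne: "i \<noteq> m" if "i \<in> I" for i using that insert.hyps by blast
  \<comment> \<open>A pivot outside \<open>Z\<close> exists: otherwise the coefficients 1 at
    \<open>m\<close> and 0 elsewhere would be a relation modulo \<open>Z\<close> and put 1 into
    \<open>Z\<close>.\<close>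
  obtain k0 where k0: "k0 \<in> K" "v m k0 \<notin> Z"
  proof (rule ccontr)
    assume "\<not> thesis"
    then have all: "v m k \<in> Z" if "k \<in> K" for k using that \<open>\<And>k0. k0 \<in> K \<Longrightarrow> v m k0 \<notin> Z \<Longrightarrow> thesis\<close> by blast
    have "(\<lambda>x. \<Sum>i\<in>insert m I. (if i = m then 1 else 0) * v i k x) = v m k" for k
    proof
      fix x
      have "(\<Sum>i\<in>I. (if i = m then 1 else 0) * v i k x) = 0" by (rule sum.neutral) (auto dest: ne)
      then show "(\<Sum>i\<in>insert m I. (if i = m then 1 else 0) * v i k x) = v m k x"
        using insert.hyps by simp
    qed
    then have "(\<lambda>_. if m = m then 1 else 0) \<in> Z"
      using all by (intro insert.prems(2)[of "\<lambda>i _. if i = m then 1 else 0" m]) (auto simp: one zero)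
    then show False using one_Z by simp
  qed
  define d where "d = v m k0"
  have dR: "d \<in> R" using insert.prems(1) k0 by (simp add: d_def)
  \<comment> \<open>Row \<open>i\<close> after clearing column \<open>k0\<close> by the pivot row,
    multiplied by the pivot instead of divided.\<close>
  define w where "w = (\<lambda>i k x. d x * v i k x - v i k0 x * v m k x)"
  have "\<exists>f\<in>R. f \<notin> Z \<and> (\<forall>x. f x \<noteq> 0 \<longrightarrow>
           (\<forall>e. (\<forall>k\<in>K. (\<Sum>i\<in>I. e i * w i k x) = 0) \<longrightarrow> (\<forall>i\<in>I. e i = 0)))"
  proof (rule insert.IH)
    show "w i k \<in> R" if "i \<in> I" "k \<in> K" for i k
      unfolding w_def using that insert.prems(1) k0(1) dR by (intro diff mult) auto
    fix c j
    assume c: "\<And>i. i \<in> I \<Longrightarrow> c i \<in> R" "\<And>k. k \<in> K \<Longrightarrow> (\<lambda>x. \<Sum>i\<in>I. c i x * w i k x) \<in> Z" and j: "j \<in> I"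
    \<comment> \<open>A relation between the reduced rows is turned back into one between the
      original rows; the coefficient of the pivot row is dictated by column
      \<open>k0\<close>.\<close>
    define c' where "c' i = (if i = m then (\<lambda>x. - (\<Sum>i\<in>I. c i x * v i k0 x)) else (\<lambda>x. d x * c i x))" for i
    have "(\<Sum>i\<in>insert m I. c' i x * v i k x) = (\<Sum>i\<in>I. c i x * w i k x)" for k x
    proof -
      have "(\<Sum>i\<in>insert m I. c' i x * v i k x)
          = - (\<Sum>i\<in>I. c i x * v i k0 x) * v m k x + (\<Sum>i\<in>I. d x * c i x * v i k x)"
        using insert.hyps ne by (simp add: c'_def cong: sum.cong)
      also have "\<dots> = (\<Sum>i\<in>I. c i x * w i k x)"
        by (simp add: w_def algebra_simps sum_subtractf sum_distrib_left sum_distrib_right)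
      finally show ?thesis .
    qed
    then have rel: "(\<lambda>x. \<Sum>i\<in>insert m I. c' i x * v i k x) \<in> Z" if "k \<in> K" for k
      using c(2)[OF that] by simp
    have "(\<lambda>x. \<Sum>i\<in>I. c i x * v i k0 x) \<in> R"
      using insert.prems(1)[OF _ k0(1)] c(1) by (intro sum mult) auto
    then have "c' i \<in> R" if "i \<in> insert m I" for i
      using that mult[OF dR c(1)] by (auto simp: c'_def intro: neg)
    from insert.prems(2)[OF this rel] j have "c' j \<in> Z" by blast
    then show "c j \<in> Z"
      using prime_Z[OF dR c(1)[OF j]] k0(2) ne[OF j] by (auto simp: c'_def d_def)
  qed
  then obtain f where f: "f \<in> R" "f \<notin> Z"
    "\<And>x e. f x \<noteq> 0 \<Longrightarrow> \<forall>k\<in>K. (\<Sum>i\<in>I. e i * w i k x) = 0 \<Longrightarrow> \<forall>i\<in>I. e i = 0" by blast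
  show ?case
  proof (intro bexI conjI allI impI)
    \<comment> \<open>The witness accumulates the product of all pivots.\<close>
    show "(\<lambda>x. f x * d x) \<in> R" using f(1) dR by (rule mult)
    show "(\<lambda>x. f x * d x) \<notin> Z" using prime_Z[OF f(1) dR] f(2) k0(2) d_def by blast
    fix x e assume x: "f x * d x \<noteq> 0" and e: "\<forall>k\<in>K. (\<Sum>i\<in>insert m I. e i * v i k x) = 0"
    have e': "(\<Sum>i\<in>I. e i * v i k x) = - (e m * v m k x)" if "k \<in> K" for k
    proof -
      have "e m * v m k x + (\<Sum>i\<in>I. e i * v i k x) = 0" using bspec[OF e that] insert.hyps by simp
      then show ?thesis by (metis add_eq_0_iff)
    qed
    have "(\<Sum>i\<in>I. e i * w i k x) = 0" if k: "k \<in> K" for k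
    proof -
      have "(\<Sum>i\<in>I. e i * w i k x)
          = d x * (\<Sum>i\<in>I. e i * v i k x) - (\<Sum>i\<in>I. e i * v i k0 x) * v m k x"
        by (simp add: w_def algebra_simps sum_subtractf sum_distrib_left sum_distrib_right)
      then show ?thesis using e'[OF k] e'[OF k0(1)] by (simp add: d_def)
    qed
    then have I0: "\<forall>i\<in>I. e i = 0" using f(3)[of x e] x by auto
    have "e m * v m k0 x = 0" using e'[OF k0(1)] I0 by simp
    then have "e m = 0" using x by (simp add: d_def)
    then show "\<forall>i\<in>insert m I. e i = 0" using I0 by simp
  qed
qed

text \<open>Coordinates of the perturbed family are linear polynomials in \<open>s\<close>. With
  \<open>Z\<close> the functions vanishing at 0, \<open>generic_independence\<close> yields a
  polynomial that is nonzero at 0, and all exceptional \<open>s\<close> are among its roots.\<close>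

lemma (in vspace) finite_dependent_pencil:
  assumes I: "finite I" and b: "indep_fam I b"
  shows "finite {s. \<not> indep_fam I (\<lambda>i. b i + scale s (d i))}"
proof -
  have "fin_dim (span (b ` I \<union> d ` I))" using I by (simp add: fin_dim_span)
  then obtain B where B: "finite B" "independent B" "span B = span (b ` I \<union> d ` I)"
    using fin_dim_basis by metis
  define r where "r = representation B"
  have bB: "b i \<in> span B" "d i \<in> span B" if "i \<in> I" for i
    unfolding B(3) using that by (auto intro: span_base)
  define v where "v i k s = r (b i) k + s * r (d i) k" for i k and s :: 'a
  have comb: "(\<Sum>i\<in>I. scale (e i) (b i + scale s (d i))) = (\<Sum>k\<in>B. scale (\<Sum>i\<in>I. e i * v i k s) k)"
    for e s
  proof -
    have "b i + scale s (d i) = (\<Sum>k\<in>B. scale (v i k s) k)" if "i \<in> I" for i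
    proof -
      have "b i = (\<Sum>k\<in>B. scale (r (b i) k) k)" "d i = (\<Sum>k\<in>B. scale (r (d i) k) k)"
        unfolding r_def using sum_representation_eq[OF B(2) _ B(1) order.refl] bB[OF that] by simp_all
      then have "b i + scale s (d i)
          = (\<Sum>k\<in>B. scale (r (b i) k) k) + scale s (\<Sum>k\<in>B. scale (r (d i) k) k)" by metis
      then show ?thesis
        by (simp add: v_def scale_left_distrib scale_sum_right sum.distrib)
    qed
    then have "(\<Sum>i\<in>I. scale (e i) (b i + scale s (d i))) = (\<Sum>i\<in>I. scale (e i) (\<Sum>k\<in>B. scale (v i k s) k))"
      by simp
    also have "\<dots> = (\<Sum>i\<in>I. \<Sum>k\<in>B. scale (e i * v i k s) k)" by (simp add: scale_sum_right)
    also have "\<dots> = (\<Sum>k\<in>B. \<Sum>i\<in>I. scale (e i * v i k s) k)" by (rule sum.swap)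
    finally show ?thesis by (simp add: scale_sum_left)
  qed
  let ?R = "range (poly :: 'a poly \<Rightarrow> _)" and ?Z = "{f :: 'a \<Rightarrow> 'a. f 0 = 0}"
  have "\<exists>f\<in>?R. f \<notin> ?Z \<and> (\<forall>x. f x \<noteq> 0 \<longrightarrow>
           (\<forall>e. (\<forall>k\<in>B. (\<Sum>i\<in>I. e i * v i k x) = 0) \<longrightarrow> (\<forall>i\<in>I. e i = 0)))"
  proof (rule generic_independence[OF I])
    show "(\<lambda>_. 1) \<in> ?R" by (rule range_eqI[of _ _ 1]) auto
    fix f g assume "f \<in> ?R" "g \<in> ?R"
    then obtain p q where pq: "f = poly p" "g = poly q" by blast
    show "(\<lambda>x. f x - g x) \<in> ?R" by (rule range_eqI[of _ _ "p - q"]) (simp add: pq fun_eq_iff)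
    show "(\<lambda>x. f x * g x) \<in> ?R" by (rule range_eqI[of _ _ "p * q"]) (simp add: pq fun_eq_iff)
  next
    fix i k show "v i k \<in> ?R"
      by (rule range_eqI[of _ _ "[:r (b i) k, r (d i) k:]"]) (simp add: v_def fun_eq_iff)
  next
    fix c i
    assume c: "\<And>k. k \<in> B \<Longrightarrow> (\<lambda>x. \<Sum>i\<in>I. c i x * v i k x) \<in> ?Z" and i: "i \<in> I"
    have "(\<Sum>i\<in>I. scale (c i 0) (b i)) = 0"
      using comb[of "\<lambda>i. c i 0" 0] c by simp
    then show "c i \<in> ?Z" using indep_famD[OF b _ i] by simp
  qed auto
  then obtain p :: "'a poly" where p: "poly p 0 \<noteq> 0" "\<And>s e. poly p s \<noteq> 0 \<Longrightarrow>
      \<forall>k\<in>B. (\<Sum>i\<in>I. e i * v i k s) = 0 \<Longrightarrow> \<forall>i\<in>I. e i = 0" by auto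
  have "indep_fam I (\<lambda>i. b i + scale s (d i))" if s: "poly p s \<noteq> 0" for s
    unfolding indep_fam_def
  proof (intro allI impI)
    fix e assume "(\<Sum>i\<in>I. scale (e i) (b i + scale s (d i))) = 0"
    then have "(\<Sum>k\<in>B. scale (\<Sum>i\<in>I. e i * v i k s) k) = 0" by (simp add: comb)
    then have "\<forall>k\<in>B. (\<Sum>i\<in>I. e i * v i k s) = 0"
      using independentD[OF B(2,1) order.refl, of "\<lambda>k. \<Sum>i\<in>I. e i * v i k s"] by blast
    then show "\<forall>i\<in>I. e i = 0" using p(2)[OF s] by blast
  qed
  then have "{s. \<not> indep_fam I (\<lambda>i. b i + scale s (d i))} \<subseteq> {s. poly p s = 0}" by blast
  moreover have "finite {s. poly p s = 0}" using p(1) by (intro poly_roots_finite) auto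
  ultimately show ?thesis by (rule finite_subset)
qed

section \<open>Dimension of \<open>V + v *o Y\<close> under perturbation of \<open>v\<close>\<close>

context char2_field
begin

text \<open>The basis is selected from \<open>V\<close> and from products \<open>v * y\<close>.
  Vectors of the first kind stay fixed, while \<open>v * y\<close> moves in direction
  \<open>a * y\<close>, so the whole basis deforms inside the perturbed sum.\<close>

lemma pencil_basis:
  assumes "fin_dim V" "fin_dim Y"
  obtains A d where "finite A" "independent A" "span A = V + v *o Y"
    "\<And>s w. w \<in> A \<Longrightarrow> w + s^2 * d w \<in> V + (v + s^2 * a) *o Y"
proof -
  obtain B where B: "finite B" "B \<subseteq> V" "independent B" "span B = V"
    using fin_dim_basis[OF assms(1)] by metis
  obtain C where C: "finite C" "C \<subseteq> Y" "span C = Y"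
    using fin_dim_basis[OF assms(2)] by metis
  have "B \<subseteq> B \<union> v *o C" by blast
  then obtain A where A: "B \<subseteq> A" "A \<subseteq> B \<union> v *o C" "independent A" "B \<union> v *o C \<subseteq> span A"
    using maximal_independent_subset_extend B(3) by metis
  have sub: "subspace V" "subspace Y" using assms by (auto intro: fin_dim_subspace)
  have "span A = span (B \<union> v *o C)" unfolding span_eq using A(2,4) span_superset by blast
  then have sp: "span A = V + v *o Y" by (simp add: span_Un_set_plus span_times B(4) C(3))
  have finA: "finite A"
    by (rule finite_subset[OF A(2)]) (simp add: B(1) C(1) elt_set_times_image)
  have "\<exists>d. \<forall>s. w + s^2 * d \<in> V + (v + s^2 * a) *o Y" if "w \<in> A" for w
  proof (cases "w \<in> B")
    case True
    then have "w + (v + s^2 * a) * 0 \<in> V + (v + s^2 * a) *o Y" for s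
      using B(2) subspace_0[OF sub(2)] by blast
    then show ?thesis by (intro exI[of _ 0]) simp
  next
    case False
    then obtain y where y: "y \<in> Y" "w = v * y" using A(2) C(2) \<open>w \<in> A\<close> by (auto simp: elt_set_times_def)
    have "0 + (v + s^2 * a) * y \<in> V + (v + s^2 * a) *o Y" for s
      using y(1) subspace_0[OF sub(1)] by blast
    then show ?thesis using y(2) by (intro exI[of _ "a * y"]) (simp add: algebra_simps)
  qed
  then obtain d where "\<And>s w. w \<in> A \<Longrightarrow> w + s^2 * d w \<in> V + (v + s^2 * a) *o Y" by metis
  then show ?thesis using that finA A(3) sp by blast
qed

lemma finite_pencil_dim_less:
  assumes "fin_dim V" "fin_dim Y"
  shows "finite {s. dim (V + (v + s^2 * a) *o Y) < dim (V + v *o Y)}"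
proof -
  obtain A d where A: "finite A" "independent A" "span A = V + v *o Y"
    "\<And>s w. w \<in> A \<Longrightarrow> w + s^2 * d w \<in> V + (v + s^2 * a) *o Y"
    using pencil_basis[OF assms] by metis
  have "\<not> indep_fam A (\<lambda>w. w + s^2 * d w)" if "dim (V + (v + s^2 * a) *o Y) < dim (V + v *o Y)" for s
  proof
    assume i: "indep_fam A (\<lambda>w. w + s^2 * d w)"
    have "dim (V + v *o Y) = card A" using A(2,3) dim_span_eq_card_independent by metis
    also have "\<dots> = dim ((\<lambda>w. w + s^2 * d w) ` A)" using indep_fam_dim[OF A(1) i] by simp
    also have "\<dots> \<le> dim (V + (v + s^2 * a) *o Y)"
      using A(4) assms by (intro fin_dim_dim_mono fin_dim_set_plus fin_dim_times) auto
    finally show False using that by simp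
  qed
  then have "{s. dim (V + (v + s^2 * a) *o Y) < dim (V + v *o Y)} \<subseteq> {s. \<not> indep_fam A (\<lambda>w. w + s^2 * d w)}"
    by blast
  then show ?thesis
    by (rule finite_subset) (rule finite_dependent_pencil[OF A(1) indep_fam_basis[OF A(2,1)]])
qed

text \<open>A first-order condition: where the rank of a pencil of maps does not jump, the
  derivative sends the kernel into the image. Here the maps go from \<open>Y\<close> to the quotient
  of F by \<open>V\<close>, the kernel element is \<open>x\<close>, and the derivative is
  multiplication by \<open>a\<close>.\<close>

lemma pencil_mem:
  assumes V: "fin_dim V" and Y: "fin_dim Y" and x: "x \<in> Y" "v * x \<in> V"
    and inf: "infinite {s. dim (V + (v + s^2 * a) *o Y) \<le> dim (V + v *o Y)}"
  shows "a * x \<in> V + v *o Y"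
proof (rule ccontr)
  assume z: "a * x \<notin> V + v *o Y"
  obtain A d where A: "finite A" "independent A" "span A = V + v *o Y"
    "\<And>s w. w \<in> A \<Longrightarrow> w + s^2 * d w \<in> V + (v + s^2 * a) *o Y"
    using pencil_basis[OF V Y] by metis
  let ?z = "a * x"
  have zA: "?z \<notin> A" using z A(3) span_base by metis
  have iz: "independent (insert ?z A)" using A(2,3) z by (simp add: independent_insertI)
  \<comment> \<open>The extra vector \<open>?z\<close> needs no deformation, since it lies in every
    perturbed sum with \<open>s \<noteq> 0\<close>; this is why 0 joins the exceptional set.\<close>
  let ?d = "d(?z := 0)"
  let ?E = "insert 0 {s. \<not> indep_fam (insert ?z A) (\<lambda>w. w + s^2 * ?d w)}"
  have "finite ?E"
    using finite_dependent_pencil[OF _ indep_fam_basis[OF iz], of ?d] A(1) by simp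
  with inf have "\<not> {s. dim (V + (v + s^2 * a) *o Y) \<le> dim (V + v *o Y)} \<subseteq> ?E"
    using finite_subset by blast
  then obtain s where s: "dim (V + (v + s^2 * a) *o Y) \<le> dim (V + v *o Y)" "s \<noteq> 0"
    "indep_fam (insert ?z A) (\<lambda>w. w + s^2 * ?d w)" by blast
  let ?U = "V + (v + s^2 * a) *o Y"
  have U: "fin_dim ?U" by (intro fin_dim_set_plus fin_dim_times V Y)
  have sU: "subspace ?U" using U by (rule fin_dim_subspace)
  have "v * x + (v + s^2 * a) * x \<in> ?U" using x by blast
  then have "s^2 * ?z \<in> ?U" by (simp add: algebra_simps add_self add.assoc[symmetric])
  then have "inverse s ^ 2 * (s^2 * ?z) \<in> ?U" by (rule subspace_square_times[OF sU])
  then have zU: "?z \<in> ?U" using s(2) by (simp add: power2_eq_square field_simps)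
  have "dim (V + v *o Y) + 1 = card (insert ?z A)"
    using A(1-3) zA dim_span_eq_card_independent[OF A(2)] by simp
  also have "\<dots> = dim ((\<lambda>w. w + s^2 * ?d w) ` insert ?z A)" using indep_fam_dim[OF _ s(3)] A(1) by simp
  also have "\<dots> \<le> dim ?U"
    using A(4) zU zA by (intro fin_dim_dim_mono[OF U]) auto
  finally show False using s(1) by simp
qed

end

section \<open>Spaces of extremal multiplication rank\<close>

context char2_field
begin

lemma set_plus_subset: "subspace U \<Longrightarrow> S \<subseteq> U \<Longrightarrow> T \<subseteq> U \<Longrightarrow> S + T \<subseteq> (U :: 'a set)"
  by (auto elim!: set_plus_elim intro!: subspace_add)

lemma subset_plus_left: "subspace T \<Longrightarrow> S \<subseteq> S + (T :: 'a set)"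
  using set_zero_plus2[of T S] by (simp add: add.commute subspace_0)

lemma subset_plus_right: "subspace S \<Longrightarrow> T \<subseteq> S + (T :: 'a set)"
  using set_zero_plus2[of S T] by (simp add: subspace_0)

lemma times_mono: "S \<subseteq> T \<Longrightarrow> x *o S \<subseteq> x *o (T :: 'a set)"
  by (auto simp: elt_set_times_def)

lemma sqfield_times_self: "sqfield D \<Longrightarrow> x \<in> D \<Longrightarrow> x \<noteq> 0 \<Longrightarrow> x *o D = D"
proof
  assume D: "sqfield D" "x \<in> D" "x \<noteq> 0"
  show "x *o D \<subseteq> D" using sqfieldD(4)[OF D(1,2)] by (auto simp: elt_set_times_def)
  show "D \<subseteq> x *o D"
  proof
    fix y assume "y \<in> D"
    then have "x * (y / x) \<in> x *o D" using sqfield_divide[OF D(1) _ D(2)] by blast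
    then show "y \<in> x *o D" using D(3) by simp
  qed
qed

lemma sqfield_Int: "sqfield A \<Longrightarrow> sqfield B \<Longrightarrow> sqfield (A \<inter> B)"
  by (auto simp: sqfield_def intro: subspace_inter)

text \<open>\<open>span (A * B)\<close> is the compositum, because products of the generators
  \<open>a * b\<close> are again of this shape.\<close>

lemma sqfield_span_mult:
  assumes "sqfield A" "sqfield B"
  shows "sqfield (span (A * B))" "A \<subseteq> span (A * B)" "B \<subseteq> span (A * B)"
proof -
  have AB: "a * b \<in> span (A * B)" if "a \<in> A" "b \<in> B" for a b
    using that by (intro span_base) blast
  show A: "A \<subseteq> span (A * B)" using AB[OF _ sqfieldD(2)[OF assms(2)]] by auto
  show "B \<subseteq> span (A * B)" using AB[OF sqfieldD(2)[OF assms(1)]] by auto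
  have prod: "x * y \<in> span (A * B)" if xy: "x \<in> A * B" "y \<in> A * B" for x y
  proof -
    obtain a b c d where *: "x = a * b" "y = c * d" "a \<in> A" "c \<in> A" "b \<in> B" "d \<in> B"
      using xy by (auto elim!: set_times_elim)
    have "(a * c) * (b * d) \<in> span (A * B)"
      using * by (intro AB sqfieldD(4)[OF assms(1)] sqfieldD(4)[OF assms(2)])
    then show ?thesis using * by (simp add: ac_simps)
  qed
  have prod2: "x * y \<in> span (A * B)" if "x \<in> A * B" "y \<in> span (A * B)" for x y
    using that(2)
  proof (induction y rule: span_induct_alt)
    case (step c z w)
    have "c^2 * (x * z) + x * w \<in> span (A * B)"
      using step prod[OF that(1)] by (intro span_add span_scale) auto
    then show ?case by (simp add: algebra_simps)
  qed (simp add: span_zero)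
  have "x * y \<in> span (A * B)" if "x \<in> span (A * B)" "y \<in> span (A * B)" for x y
    using that(1)
  proof (induction x rule: span_induct_alt)
    case (step c z w)
    have "c^2 * (z * y) + w * y \<in> span (A * B)"
      using step prod2[OF _ that(2)] by (intro span_add span_scale) auto
    then show ?case by (simp add: algebra_simps)
  qed (simp add: span_zero)
  moreover have "1 \<in> span (A * B)" using A sqfieldD(2)[OF assms(1)] by blast
  ultimately show "sqfield (span (A * B))" unfolding sqfield_def by auto
qed

lemma sqfield_dim_power2: "sqfield D \<Longrightarrow> fin_dim D \<Longrightarrow> \<exists>k. dim D = 2 ^ k"
  using sqfield_eq_pfister by metis

text \<open>Two distinct parameters \<open>s\<close>, \<open>t\<close> would put
  \<open>(s + t)^2 * a\<close>, hence \<open>a\<close>, hence \<open>v\<close> into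
  \<open>W\<close>; so there is at most one.\<close>

lemma finite_line_in_subspace:
  assumes "subspace W" "v \<notin> W"
  shows "finite {s. v + s^2 * a \<in> W}"
proof -
  have "s = t" if st: "v + s^2 * a \<in> W" "v + t^2 * a \<in> W" for s t
  proof (rule ccontr)
    assume "s \<noteq> t"
    then have ne: "s + t \<noteq> 0" by (simp add: add_eq_0_iff_eq)
    have "(v + s^2 * a) + (v + t^2 * a) \<in> W" using assms(1) st by (rule subspace_add)
    moreover have "(v + s^2 * a) + (v + t^2 * a) = (v + v) + (s + t)^2 * a"
      by (simp add: square_add algebra_simps)
    ultimately have "(s + t)^2 * a \<in> W" by (simp add: add_self)
    then have "(s / (s + t))^2 * ((s + t)^2 * a) \<in> W" by (rule subspace_square_times[OF assms(1)])
    moreover have "(s / (s + t))^2 * ((s + t)^2 * a) = (s / (s + t) * (s + t))^2 * a"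
      by (simp only: power_mult_distrib mult.assoc)
    ultimately have "s^2 * a \<in> W" using ne by simp
    then have "(v + s^2 * a) + s^2 * a \<in> W" using subspace_add[OF assms(1) st(1)] by blast
    then show False using assms(2) by (simp add: add.assoc add_self)
  qed
  then have "{s. v + s^2 * a \<in> W} \<subseteq> {SOME s. v + s^2 * a \<in> W}"
    by (auto intro: someI2)
  then show ?thesis by (rule finite_subset) simp
qed

end

section \<open>From the maximal dimension \<open>6 * 2 ^ m\<close> to the field structure of
  \<open>V\<close>\<close>

locale extremal_space = char2_field F for F :: "'a::field itself" +
  fixes V :: "'a set" and m :: nat
  assumes infinite_UNIV: "infinite (UNIV :: 'a set)"
    and V: "fin_dim V" and one_V: "1 \<in> V" and dim_V: "dim V = 4 * 2 ^ m"
    and dim_le: "\<And>u. u \<in> V \<Longrightarrow> dim (V + u *o V) \<le> 6 * 2 ^ m"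
begin

lemma V_sub: "subspace V" using V by (rule fin_dim_subspace)

definition good :: "'a \<Rightarrow> bool" where
  "good u \<longleftrightarrow> u \<in> V \<and> dim (V + u *o V) = 6 * 2 ^ m"

definition E :: "'a \<Rightarrow> 'a set" where
  "E u = V \<inter> u *o V"

lemma goodD: "good u \<Longrightarrow> u \<in> V" "good u \<Longrightarrow> dim (V + u *o V) = 6 * 2 ^ m"
  by (auto simp: good_def)

lemma good_nonzero: "good u \<Longrightarrow> u \<noteq> 0"
proof
  assume "good u" "u = 0"
  have "V + u *o V \<subseteq> V" using \<open>u = 0\<close> V_sub by (auto elim!: set_plus_elim simp: elt_set_times_def)
  then have "dim (V + u *o V) \<le> dim V" by (rule fin_dim_dim_mono[OF V])
  then show False using goodD(2)[OF \<open>good u\<close>] dim_V by simp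
qed

lemma finite_not_good:
  assumes "good u" "a \<in> V"
  shows "finite {s. \<not> good (u + s^2 * a)}"
proof -
  have "{s. \<not> good (u + s^2 * a)} \<subseteq> {s. dim (V + (u + s^2 * a) *o V) < dim (V + u *o V)}"
  proof safe
    fix s assume "\<not> good (u + s^2 * a)"
    moreover have uV: "u + s^2 * a \<in> V"
      using subspace_add[OF V_sub goodD(1)[OF assms(1)] subspace_square_times[OF V_sub assms(2)]] .
    ultimately show "dim (V + (u + s^2 * a) *o V) < dim (V + u *o V)"
      using dim_le[OF uV] goodD(2)[OF assms(1)] by (simp add: good_def)
  qed
  then show ?thesis by (rule finite_subset) (rule finite_pencil_dim_less[OF V V])
qed

text \<open>As \<open>u^2\<close> is a scalar, \<open>u *o V\<close> equals
  \<open>inverse u *o V\<close>.\<close>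

lemma mem_E: "u \<noteq> 0 \<Longrightarrow> x \<in> E u \<longleftrightarrow> x \<in> V \<and> u * x \<in> V"
proof -
  assume u: "u \<noteq> 0"
  have "x \<in> u *o V \<longleftrightarrow> u * x \<in> V"
  proof
    assume "x \<in> u *o V"
    then obtain y where "y \<in> V" "x = u * y" by (auto simp: elt_set_times_def)
    then show "u * x \<in> V" using subspace_square_times[OF V_sub, of y u] by (simp add: power2_eq_square mult.assoc)
  next
    assume "u * x \<in> V"
    then have "x / u \<in> V" using subspace_divide[OF V_sub, of x u] by (simp add: mult.commute)
    then have "u * (x / u) \<in> u *o V" by blast
    then show "x \<in> u *o V" using u by simp
  qed
  then show ?thesis by (simp add: E_def)
qed

lemma E_subset: "E u \<subseteq> V" by (simp add: E_def)

lemma fin_dim_E: "fin_dim (E u)"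
  unfolding E_def by (intro fin_dim_Int V fin_dim_subspace fin_dim_times)

text \<open>Inclusion-exclusion in units of \<open>2 ^ m\<close>: 4 + 4 - 6 = 2.\<close>

lemma dim_E: "good u \<Longrightarrow> dim (E u) = 2 * 2 ^ m"
  using dim_set_plus_Int[OF V fin_dim_times[OF V, of u]] dim_times[OF V good_nonzero, of u]
    goodD(2)[of u] dim_V by (simp add: E_def)

text \<open>The condition \<open>pencil_mem\<close> with \<open>Y = V\<close>: a good
  \<open>u\<close> attains the bound \<open>dim_le\<close>, so the dimension cannot jump in any
  direction \<open>a\<close> of \<open>V\<close>.\<close>

lemma E_mult:
  assumes "good u" "x \<in> E u" "a \<in> V"
  shows "a * x \<in> V + u *o V"
proof (rule pencil_mem[OF V V])
  show "x \<in> V" "u * x \<in> V" using mem_E[OF good_nonzero[OF assms(1)]] assms(2) by auto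
  have "u + s^2 * a \<in> V" for s
    using subspace_add[OF V_sub goodD(1)[OF assms(1)] subspace_square_times[OF V_sub assms(3)]] .
  then have "{s. dim (V + (u + s^2 * a) *o V) \<le> dim (V + u *o V)} = UNIV"
    using dim_le goodD(2)[OF assms(1)] by simp
  then show "infinite {s. dim (V + (u + s^2 * a) *o V) \<le> dim (V + u *o V)}"
    using infinite_UNIV by metis
qed

text \<open>The stabiliser of \<open>V + uV\<close> is a field containing \<open>E u\<close>; its degree is a power of two dividing
  \<open>6 \<cdot> 2\<^sup>m\<close>, hence not larger than \<open>dim (E u)\<close>.\<close>

lemma sqfield_E:
  assumes "good u"
  shows "sqfield (E u)"
proof -
  define G where "G = V + u *o V"
  have G: "fin_dim G" unfolding G_def by (intro fin_dim_set_plus fin_dim_times V)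
  have G_sub: "subspace G" using G by (rule fin_dim_subspace)
  have VG: "V \<subseteq> G" unfolding G_def by (intro subset_plus_left subspace_times V_sub)
  define S where "S = {x. \<forall>g\<in>G. x * g \<in> G}"
  have S: "sqfield S"
    unfolding sqfield_def
  proof (intro conjI ballI subspaceI)
    show "0 \<in> S" using subspace_0[OF G_sub] by (simp add: S_def)
    show "1 \<in> S" by (simp add: S_def)
    fix x y assume xy: "x \<in> S" "y \<in> S"
    show "x + y \<in> S" using xy subspace_add[OF G_sub] by (simp add: S_def distrib_right)
    show "x * y \<in> S" using xy by (simp add: S_def mult.assoc)
  next
    fix c x assume "x \<in> S"
    then show "c^2 * x \<in> S" using subspace_square_times[OF G_sub] by (simp add: S_def mult.assoc)
  qed
  have SG: "S \<subseteq> G" using one_V VG by (force simp: S_def)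
  have fS: "fin_dim S" using fin_dim_subset[OF G sqfieldD(1)[OF S] SG] .
  have "sqmodule S G" unfolding sqmodule_def using G_sub by (simp add: S_def)
  then have dvd: "dim S dvd 6 * 2 ^ m"
    using sqmodule_dim_dvd[OF S fS G] goodD(2)[OF assms] by (simp add: G_def)
  obtain k where k: "dim S = 2 ^ k" using sqfield_dim_power2[OF S fS] by blast
  have "dim S \<le> 2 * 2 ^ m"
  proof -
    have "(2::nat) ^ k dvd 3 * 2 ^ (m + 1)" using dvd k by simp
    moreover have "coprime ((2::nat) ^ k) 3" by simp
    ultimately have "(2::nat) ^ k dvd 2 ^ (m + 1)" using coprime_dvd_mult_right_iff by blast
    then show ?thesis using k by (simp add: dvd_imp_le)
  qed
  moreover have "E u \<subseteq> S"
  proof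
    fix x assume x: "x \<in> E u"
    have "x * g \<in> G" if "g \<in> G" for g
    proof -
      obtain a b where ab: "g = a + u * b" "a \<in> V" "b \<in> V"
        using \<open>g \<in> G\<close> by (auto simp: G_def elt_set_times_def elim!: set_plus_elim)
      have xa: "a * x \<in> G" using E_mult[OF assms x ab(2)] by (simp add: G_def)
      obtain c d where cd: "b * x = c + u * d" "c \<in> V" "d \<in> V"
        using E_mult[OF assms x ab(3)] by (auto simp: elt_set_times_def elim!: set_plus_elim)
      \<comment> \<open>Multiplication by \<open>u\<close> exchanges the two summands of
        \<open>G\<close> up to the scalar \<open>u^2\<close>.\<close>
      have "u * (b * x) = u^2 * d + u * c" using cd by (simp add: algebra_simps power2_eq_square)
      also have "\<dots> \<in> G"
        unfolding G_def using cd subspace_square_times[OF V_sub] by blast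
      finally have "a * x + u * (b * x) \<in> G" by (rule subspace_add[OF G_sub xa])
      then show ?thesis by (simp add: ab algebra_simps)
    qed
    then show "x \<in> S" by (simp add: S_def)
  qed
  moreover have "subspace (E u)" by (rule fin_dim_subspace[OF fin_dim_E])
  ultimately have "E u = S" using fin_dim_subset_eqI[OF fS] dim_E[OF assms] by simp
  then show ?thesis using S by simp
qed

lemma mem_E_self: "good u \<Longrightarrow> u \<in> E u"
  using mem_E[OF good_nonzero] goodD(1)[of u] subspace_square_times[OF V_sub one_V, of u]
  by (simp add: power2_eq_square)

lemma E_sym: "good u \<Longrightarrow> good v \<Longrightarrow> v \<in> E u \<longleftrightarrow> u \<in> E v"
  by (simp add: mem_E good_nonzero goodD(1) mult.commute)

text \<open>By \<open>E_mult\<close> for \<open>v\<close>, the compositum of \<open>E u\<close> and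
  \<open>E v\<close> lies in \<open>V + v *o V\<close>. Its degree is a power of two at most
  \<open>6 * 2 ^ m\<close>, hence at most \<open>4 * 2 ^ m\<close>, which
  \<open>E u + v *o E u\<close> already has.\<close>

lemma E_composite:
  assumes u: "good u" and v: "good v" and vu: "v \<notin> E u"
  shows "E v \<subseteq> E u + v *o E u" "dim (E u + v *o E u) = 4 * 2 ^ m"
proof -
  let ?M = "E u + v *o E u" and ?C = "span (E u * E v)"
  note Eu = sqfield_E[OF u] and Ev = sqfield_E[OF v]
  note C = sqfield_span_mult[OF Eu Ev]
  show dM: "dim ?M = 4 * 2 ^ m"
    using sqfield_adjoin_dim[OF Eu fin_dim_E vu] dim_E[OF u] by simp
  have G: "fin_dim (V + v *o V)" by (intro fin_dim_set_plus fin_dim_times V)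
  have "?C \<subseteq> V + v *o V"
  proof (rule span_minimal)
    show "E u * E v \<subseteq> V + v *o V"
    proof
      fix y assume "y \<in> E u * E v"
      then obtain a x where "a \<in> E u" "x \<in> E v" "y = a * x" by (auto elim: set_times_elim)
      then show "y \<in> V + v *o V" using E_mult[OF v] E_subset by blast
    qed
  qed (rule fin_dim_subspace[OF G])
  then have fC: "fin_dim ?C" and dC: "dim ?C \<le> 6 * 2 ^ m"
    using fin_dim_subset[OF G subspace_span] fin_dim_dim_mono[OF G, of ?C] goodD(2)[OF v] by auto
  obtain k where k: "dim ?C = 2 ^ k" using sqfield_dim_power2[OF C(1) fC] by blast
  have "6 * 2 ^ m < (2::nat) ^ (m + 3)" by (simp add: power_add)
  then have "(2::nat) ^ k < 2 ^ (m + 3)" using dC k by linarith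
  then have "k < m + 3" by (rule power_less_imp_less_exp[rotated]) simp
  then have "(2::nat) ^ k \<le> 2 ^ (m + 2)" by (intro power_increasing) auto
  then have dC': "dim ?C \<le> dim ?M" using k dM by (simp add: power_add)
  have "?M \<subseteq> ?C" using adjoin_subset[OF C(1,2)] C(3) mem_E_self[OF v] by blast
  then have "?M = ?C"
    by (rule fin_dim_subset_eqI[OF fC sqfieldD(1)[OF sqfield_adjoin[OF Eu]] _ dC'])
  then show "E v \<subseteq> ?M" using C(3) by simp
qed

text \<open>For \<open>X = E u + E v\<close> the intersection of \<open>X\<close> and
  \<open>u *o X\<close> is \<open>E u\<close>, while both lie in a field of degree
  \<open>4 * 2 ^ m\<close>. So \<open>2 * dim X - 2 * 2 ^ m \<le> 4 * 2 ^ m\<close>, which bounds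
  the degree of \<open>E u \<inter> E v\<close> below by \<open>2 ^ m\<close>. Being a proper
  subfield of \<open>E u\<close>, it cannot be larger.\<close>

lemma dim_E_Int:
  assumes u: "good u" and v: "good v" and vu: "v \<notin> E u"
  shows "dim (E u \<inter> E v) = 2 ^ m" "dim (E u + E v) = 3 * 2 ^ m"
proof -
  let ?M = "E u + v *o E u" and ?X = "E u + E v" and ?D = "E u \<inter> E v"
  note Eu = sqfield_E[OF u] and Ev = sqfield_E[OF v]
  note M = sqfield_adjoin[OF Eu, of v]
  have fM: "fin_dim ?M" by (intro fin_dim_set_plus fin_dim_times fin_dim_E)
  have EuM: "E u \<subseteq> ?M" by (rule subset_adjoin[OF sqfieldD(1)[OF Eu]])
  have XM: "?X \<subseteq> ?M" using set_plus_subset[OF sqfieldD(1)[OF M] EuM E_composite(1)[OF u v vu]] .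
  have XV: "?X \<subseteq> V" using set_plus_subset[OF V_sub E_subset E_subset] .
  have fX: "fin_dim ?X" by (intro fin_dim_set_plus fin_dim_E)
  have EuX: "E u \<subseteq> ?X" by (rule subset_plus_left[OF sqfieldD(1)[OF Ev]])
  have "?X \<inter> u *o ?X = E u"
  proof
    show "?X \<inter> u *o ?X \<subseteq> E u" using XV times_mono[OF XV, of u] unfolding E_def by blast
    show "E u \<subseteq> ?X \<inter> u *o ?X"
      using EuX times_mono[OF EuX, of u] sqfield_times_self[OF Eu mem_E_self[OF u] good_nonzero[OF u]] by simp
  qed
  then have 1: "dim (?X + u *o ?X) + 2 * 2 ^ m = 2 * dim ?X"
    using dim_set_plus_Int[OF fX fin_dim_times[OF fX, of u]] dim_times[OF fX good_nonzero[OF u]] dim_E[OF u]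
    by simp
  have "u *o ?X \<subseteq> ?M"
    using XM mem_E_self[OF u] EuM sqfieldD(4)[OF M] by (auto simp: elt_set_times_def)
  then have "?X + u *o ?X \<subseteq> ?M" using set_plus_subset[OF sqfieldD(1)[OF M] XM] by blast
  then have 2: "dim (?X + u *o ?X) \<le> 4 * 2 ^ m"
    using fin_dim_dim_mono[OF fM] E_composite(2)[OF u v vu] by metis
  have 3: "dim ?X + dim ?D = 4 * 2 ^ m"
    using dim_set_plus_Int[OF fin_dim_E fin_dim_E] dim_E[OF u] dim_E[OF v] by simp
  have fD: "fin_dim ?D" by (intro fin_dim_Int fin_dim_E sqfieldD(1)[OF Ev])
  obtain k where k: "dim ?D = 2 ^ k" using sqfield_dim_power2[OF sqfield_Int[OF Eu Ev] fD] by blast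
  have "?D \<noteq> E u" using E_sym[OF u v] vu mem_E_self[OF u] by blast
  then have "\<not> dim (E u) \<le> dim ?D"
    using fin_dim_subset_eqI[OF fin_dim_E fin_dim_subspace[OF fD]] by blast
  then have "(2::nat) ^ k < 2 ^ (m + 1)" using k dim_E[OF u] by simp
  then have "k < m + 1" by (rule power_less_imp_less_exp[rotated]) simp
  then have "(2::nat) ^ k \<le> 2 ^ m" by (intro power_increasing) auto
  with k 1 2 3 show 4: "dim ?D = 2 ^ m" by linarith
  then show "dim ?X = 3 * 2 ^ m" using 3 by linarith
qed

text \<open>For \<open>x\<close> in \<open>E u\<close>, the product \<open>v * x\<close> lies in
  \<open>V\<close> exactly when \<open>x\<close> is in \<open>E v\<close>. In units of
  \<open>2 ^ m\<close> the count is 4 + 2 - 1 = 5.\<close>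

lemma dim_plus_E:
  assumes u: "good u" and v: "good v" and vu: "v \<notin> E u"
  shows "dim (V + v *o E u) = 5 * 2 ^ m"
proof -
  have v0: "v \<noteq> 0" using good_nonzero[OF v] .
  have "V \<inter> v *o E u = v *o (E u \<inter> E v)"
    using mem_E[OF v0] E_subset by (auto simp: elt_set_times_def)
  moreover have "fin_dim (E u \<inter> E v)" by (intro fin_dim_Int fin_dim_E fin_dim_subspace)
  ultimately have "dim (V \<inter> v *o E u) = 2 ^ m"
    using dim_times[OF _ v0] dim_E_Int(1)[OF assms] by simp
  then show ?thesis
    using dim_set_plus_Int[OF V fin_dim_times[OF fin_dim_E, of v u]] dim_times[OF fin_dim_E v0]
      dim_V dim_E[OF u] by simp
qed

text \<open>Again \<open>pencil_mem\<close>, now with \<open>Y = E u\<close>. By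
  \<open>dim_plus_E\<close> the dimension is the same at every good parameter outside
  \<open>E u\<close>, and only finitely many \<open>s\<close> miss this.\<close>

lemma E_Int_mult:
  assumes u: "good u" and v: "good v" and vu: "v \<notin> E u" and x: "x \<in> E u \<inter> E v" and a: "a \<in> V"
  shows "a * x \<in> V + v *o E u"
proof (rule pencil_mem[OF V fin_dim_E])
  show "x \<in> E u" "v * x \<in> V" using x mem_E[OF good_nonzero[OF v]] by auto
  let ?B = "{s. \<not> good (v + s^2 * a)} \<union> {s. v + s^2 * a \<in> E u}"
  have "finite ?B"
    using finite_not_good[OF v a] finite_line_in_subspace[OF fin_dim_subspace[OF fin_dim_E] vu] by simp
  then have "infinite (- ?B)" using infinite_UNIV by (metis finite_Un Compl_partition)
  moreover have "- ?B \<subseteq> {s. dim (V + (v + s^2 * a) *o E u) \<le> dim (V + v *o E u)}"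
    using dim_plus_E[OF u] v vu by auto
  ultimately show "infinite {s. dim (V + (v + s^2 * a) *o E u) \<le> dim (V + v *o E u)}"
    using infinite_super by blast
qed

lemma good_outside:
  assumes u: "good u" and W: "subspace W" "u \<in> W" "a \<in> V" "a \<notin> W"
  obtains z where "good z" "z \<notin> W"
proof -
  \<comment> \<open>Excluding \<open>s = 0\<close> allows \<open>a\<close> to be recovered from
    \<open>u + s^2 * a\<close>.\<close>
  let ?B = "insert 0 {s. \<not> good (u + s^2 * a)}"
  have "finite ?B" using finite_not_good[OF u W(3)] by simp
  then obtain s where s: "s \<notin> ?B" using infinite_UNIV ex_new_if_finite by blast
  have "u + s^2 * a \<notin> W"
  proof
    assume "u + s^2 * a \<in> W"
    then have "u + (u + s^2 * a) \<in> W" using subspace_add[OF W(1,2)] by blast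
    then have "s^2 * a \<in> W" by (simp add: add.assoc[symmetric] add_self)
    then have "inverse s ^ 2 * (s^2 * a) \<in> W" by (rule subspace_square_times[OF W(1)])
    then show False using W(4) s by (simp add: power2_eq_square field_simps)
  qed
  then show ?thesis using that s by blast
qed

theorem extremal_structure:
  assumes ex: "\<exists>u. good u"
  obtains D N where "sqfield D" "fin_dim D" "dim D = 2 ^ m" "sqmodule D V"
    "sqfield N" "fin_dim N" "dim N = 8 * 2 ^ m" "V \<subseteq> N" "\<And>N'. sqfield N' \<Longrightarrow> V \<subseteq> N' \<Longrightarrow> N \<subseteq> N'"
proof -
  obtain u where u: "good u" using ex by blast
  note Eu = sqfield_E[OF u]
  have "E u \<noteq> V" using dim_E[OF u] dim_V by auto
  then obtain a where "a \<in> V" "a \<notin> E u" using E_subset by blast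
  then obtain v where v: "good v" and vu: "v \<notin> E u"
    using good_outside[OF u sqfieldD(1)[OF Eu] mem_E_self[OF u]] by blast
  note Ev = sqfield_E[OF v]
  define M where "M = E u + v *o E u"
  define D where "D = E u \<inter> E v"
  define X where "X = E u + E v"
  have M: "sqfield M" unfolding M_def by (rule sqfield_adjoin[OF Eu])
  have fM: "fin_dim M" unfolding M_def by (intro fin_dim_set_plus fin_dim_times fin_dim_E)
  have dM: "dim M = 4 * 2 ^ m" unfolding M_def by (rule E_composite(2)[OF u v vu])
  have EuM: "E u \<subseteq> M" unfolding M_def by (rule subset_adjoin[OF sqfieldD(1)[OF Eu]])
  have EvM: "E v \<subseteq> M" unfolding M_def by (rule E_composite(1)[OF u v vu])
  have D: "sqfield D" unfolding D_def by (rule sqfield_Int[OF Eu Ev])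
  have fD: "fin_dim D" unfolding D_def by (intro fin_dim_Int fin_dim_E fin_dim_subspace)
  have dD: "dim D = 2 ^ m" unfolding D_def by (rule dim_E_Int(1)[OF u v vu])
  have fX: "fin_dim X" unfolding X_def by (intro fin_dim_set_plus fin_dim_E)
  have dX: "dim X = 3 * 2 ^ m" unfolding X_def by (rule dim_E_Int(2)[OF u v vu])
  have XM: "X \<subseteq> M" unfolding X_def by (rule set_plus_subset[OF sqfieldD(1)[OF M] EuM EvM])
  have XV: "X \<subseteq> V" unfolding X_def by (rule set_plus_subset[OF V_sub E_subset E_subset])
  have DM: "D \<subseteq> M" using EuM by (auto simp: D_def)
  have DV: "D \<subseteq> V" using E_subset by (auto simp: D_def)
  have modM: "sqmodule D M" by (rule sqmodule_self[OF D DM M])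
  have modX: "sqmodule D X"
    unfolding X_def by (intro sqmodule_plus sqmodule_self D Eu Ev) (auto simp: D_def)
  \<comment> \<open>Otherwise \<open>V\<close> would be the field \<open>M\<close> and contain
    \<open>u * v\<close>, which means that \<open>v\<close> is in \<open>E u\<close>.\<close>
  have "\<not> V \<subseteq> M"
  proof
    assume "V \<subseteq> M"
    then have "V = M" using fin_dim_subset_eqI[OF fM V_sub] dM dim_V by simp
    moreover have "u * v \<in> M"
      using sqfieldD(4)[OF M] EuM EvM mem_E_self[OF u] mem_E_self[OF v] by blast
    ultimately show False using vu mem_E[OF good_nonzero[OF u]] goodD(1)[OF v] by blast
  qed
  then obtain a where "a \<in> V" "a \<notin> M" by blast
  then obtain z where z: "good z" and zM: "z \<notin> M"
    using good_outside[OF u sqfieldD(1)[OF M]] EuM mem_E_self[OF u] by blast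
  define G where "G = V + v *o E u"
  have fG: "fin_dim G" unfolding G_def by (intro fin_dim_set_plus fin_dim_times fin_dim_E V)
  have dG: "dim G = 5 * 2 ^ m" unfolding G_def by (rule dim_plus_E[OF u v vu])
  have MG: "M \<subseteq> G" unfolding M_def G_def using E_subset by (intro set_plus_mono2) auto
  have zD: "z *o D \<subseteq> G"
    using E_Int_mult[OF u v vu _ goodD(1)[OF z]] by (auto simp: G_def D_def elt_set_times_def)
  \<comment> \<open>Both sides have dimension \<open>5 * 2 ^ m\<close>. This confines
    \<open>V\<close> to \<open>M + z *o D\<close> before it is known that \<open>z *o D\<close> lies
    in \<open>V\<close>.\<close>
  have "M + z *o D \<subseteq> G" by (rule set_plus_subset[OF fin_dim_subspace[OF fG] MG zD])
  moreover have "dim (M + z *o D) = 5 * 2 ^ m"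
    using sqmodule_dim_plus_times[OF D fD modM fM zM] dM dD by simp
  moreover have "subspace (M + z *o D)"
    by (intro subspace_set_plus subspace_times sqfieldD(1) M D)
  ultimately have G_eq: "G = M + z *o D" using fin_dim_subset_eqI[OF fG, of "M + z *o D"] dG by simp
  have VG: "V \<subseteq> M + z *o D"
    unfolding G_eq[symmetric] G_def by (intro subset_plus_left subspace_times fin_dim_subspace fin_dim_E)
  \<comment> \<open>Comparing the decompositions of \<open>y\<close> and \<open>z * y\<close> gives
    \<open>z * (c + d') = c' + z^2 * d\<close> in \<open>M\<close>. As \<open>z\<close> is not in
    \<open>M\<close>, this forces \<open>c = d'\<close>, so the \<open>M\<close>-component
    \<open>c\<close> of \<open>y\<close> lies in \<open>D\<close>.\<close>
  have "E z \<subseteq> D + z *o D"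
  proof
    fix y assume "y \<in> E z"
    then have y: "y \<in> V" "z * y \<in> V" using mem_E[OF good_nonzero[OF z]] by auto
    obtain c d where cd: "y = c + z * d" "c \<in> M" "d \<in> D"
      using y(1) VG by (fastforce simp: elt_set_times_def elim!: set_plus_elim)
    obtain c' d' where cd': "z * y = c' + z * d'" "c' \<in> M" "d' \<in> D"
      using y(2) VG by (fastforce simp: elt_set_times_def elim!: set_plus_elim)
    have "c = d'"
    proof (rule ccontr)
      assume "c \<noteq> d'"
      then have ne: "c + d' \<noteq> 0" by (simp add: add_eq_0_iff_eq)
      have "z * (c + d') = c' + z^2 * d"
      proof -
        have "z * c + z^2 * d = c' + z * d'" using cd(1) cd'(1) by (simp add: algebra_simps power2_eq_square)
        then have "z * c = c' + z * d' + z^2 * d" by (simp add: add_eq_iff)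
        then have "z * (c + d') = c' + z^2 * d + (z * d' + z * d')" by (simp add: algebra_simps)
        then show ?thesis by (simp add: add_self)
      qed
      moreover have "c' + z^2 * d \<in> M"
        using cd cd' DM by (intro sqfieldD(4,5)[OF M] sqfield_square[OF M]) auto
      moreover have "c + d' \<in> M" using cd cd' DM by (intro sqfieldD(5)[OF M]) auto
      ultimately have "z * (c + d') / (c + d') \<in> M" by (metis sqfield_divide[OF M])
      then show False using ne zM by simp
    qed
    then show "y \<in> D + z *o D" using cd cd'(3) by blast
  qed
  moreover have "dim (D + z *o D) = 2 * 2 ^ m"
    using sqfield_adjoin_dim[OF D fD, of z] zM DM dD by auto
  moreover have "fin_dim (D + z *o D)" by (intro fin_dim_set_plus fin_dim_times fD)
  ultimately have "E z = D + z *o D"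
    using fin_dim_subset_eqI[OF _ fin_dim_subspace[OF fin_dim_E]] dim_E[OF z] by simp
  \<comment> \<open>Equality of dimensions now places \<open>z *o D\<close> inside \<open>V\<close>,
    so that \<open>V\<close> becomes a sum of \<open>D\<close>-modules.\<close>
  then have zDV: "z *o D \<subseteq> V"
    using subset_plus_right[OF sqfieldD(1)[OF D], of "z *o D"] E_subset by blast
  have zX: "z \<notin> X" using zM XM by blast
  have "X + z *o D \<subseteq> V" by (rule set_plus_subset[OF V_sub XV zDV])
  moreover have "dim (X + z *o D) = 4 * 2 ^ m"
    using sqmodule_dim_plus_times[OF D fD modX fX zX] dX dD by simp
  moreover have "subspace (X + z *o D)"
    by (intro subspace_set_plus subspace_times sqfieldD(1)[OF D] fin_dim_subspace[OF fX])
  ultimately have V_eq: "V = X + z *o D" using fin_dim_subset_eqI[OF V, of "X + z *o D"] dim_V by simp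
  have modV: "sqmodule D V"
    unfolding V_eq by (intro sqmodule_plus modX sqmodule_times sqmodule_self[OF D _ D]) simp
  have VN: "V \<subseteq> M + z *o M"
    unfolding V_eq by (intro set_plus_mono2 XM times_mono DM)
  have "M + z *o M \<subseteq> N'" if N': "sqfield N'" "V \<subseteq> N'" for N'
  proof (rule adjoin_subset[OF N'(1)])
    show "M \<subseteq> N'"
      unfolding M_def using E_subset goodD(1)[OF v] N'(2) by (intro adjoin_subset[OF N'(1)]) auto
    show "z \<in> N'" using goodD(1)[OF z] N'(2) by blast
  qed
  moreover have "dim (M + z *o M) = 8 * 2 ^ m" using sqfield_adjoin_dim[OF M fM zM] dM by simp
  moreover have "fin_dim (M + z *o M)" by (intro fin_dim_set_plus fin_dim_times fM)
  ultimately show ?thesis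
    using that[OF D fD dD modV sqfield_adjoin[OF M] _ _ VN] by blast
qed

end

text \<open>Write \<open>V\<close> as \<open>D + uD + bD + cD\<close>. The lower bound on fields
  containing \<open>V\<close> keeps \<open>c\<close> out of \<open>M2\<close>, the field generated
  by \<open>u\<close> and \<open>b\<close> over \<open>D\<close>. Then \<open>V + u *o V\<close> is
  \<open>M2 + c *o M1\<close>, of dimension 4 + 2 in units of \<open>dim D\<close>.\<close>

lemma (in char2_field) dim_plus_times_of_structure:
  assumes D: "sqfield D" "fin_dim D" and V: "fin_dim V" "1 \<in> V" "dim V = 4 * dim D" and mod: "sqmodule D V"
    and N: "\<And>N'. sqfield N' \<Longrightarrow> fin_dim N' \<Longrightarrow> V \<subseteq> N' \<Longrightarrow> 8 * dim D \<le> dim N'"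
    and u: "u \<in> V" "u \<notin> D"
  shows "dim (V + u *o V) = 6 * dim D"
proof -
  have V_sub: "subspace V" using V(1) by (rule fin_dim_subspace)
  have h: "dim D > 0"
    using fin_dim_dim_mono[OF D(2) sqfield_contains_squares[OF D(1)]] dim_squares by linarith
  have DV: "x *o D \<subseteq> V" if "x \<in> V" for x
    using that sqmoduleD(3)[OF mod] by (auto simp: elt_set_times_def mult.commute)
  define M1 where "M1 = D + u *o D"
  have M1: "sqfield M1" unfolding M1_def by (rule sqfield_adjoin[OF D(1)])
  have fM1: "fin_dim M1" unfolding M1_def by (intro fin_dim_set_plus fin_dim_times D)
  have dM1: "dim M1 = 2 * dim D" unfolding M1_def by (rule sqfield_adjoin_dim[OF D u(2)])
  have DM1: "D \<subseteq> M1" unfolding M1_def by (rule subset_adjoin[OF sqfieldD(1)[OF D(1)]])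
  have uM1: "u \<in> M1" unfolding M1_def by (rule adjoin_mem[OF D(1)])
  have M1V: "M1 \<subseteq> V" unfolding M1_def using DV[OF V(2)] DV[OF u(1)]
    by (intro set_plus_subset[OF V_sub]) (simp_all add: elt_set_times_def)
  have modM1: "sqmodule D M1" by (rule sqmodule_self[OF D(1) DM1 M1])
  have "M1 \<noteq> V" using dM1 V(3) h by auto
  then obtain b where b: "b \<in> V" "b \<notin> M1" using M1V by blast
  define V1 where "V1 = M1 + b *o D"
  have fV1: "fin_dim V1" unfolding V1_def by (intro fin_dim_set_plus fin_dim_times D fM1)
  have dV1: "dim V1 = 3 * dim D"
    unfolding V1_def using sqmodule_dim_plus_times[OF D modM1 fM1 b(2)] dM1 by simp
  have V1V: "V1 \<subseteq> V" unfolding V1_def by (rule set_plus_subset[OF V_sub M1V DV[OF b(1)]])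
  have modV1: "sqmodule D V1"
    unfolding V1_def by (intro sqmodule_plus modM1 sqmodule_times sqmodule_self[OF D(1) _ D(1)]) simp
  have "V1 \<noteq> V" using dV1 V(3) h by auto
  then obtain c where c: "c \<in> V" "c \<notin> V1" using V1V by blast
  have "V1 + c *o D \<subseteq> V" by (rule set_plus_subset[OF V_sub V1V DV[OF c(1)]])
  moreover have "dim (V1 + c *o D) = 4 * dim D"
    using sqmodule_dim_plus_times[OF D modV1 fV1 c(2)] dV1 by simp
  moreover have "subspace (V1 + c *o D)"
    by (intro subspace_set_plus subspace_times sqfieldD(1)[OF D(1)] fin_dim_subspace[OF fV1])
  ultimately have V_eq: "V = V1 + c *o D" using fin_dim_subset_eqI[OF V(1), of "V1 + c *o D"] V(3) by simp
  define M2 where "M2 = M1 + b *o M1"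
  have M2: "sqfield M2" unfolding M2_def by (rule sqfield_adjoin[OF M1])
  have fM2: "fin_dim M2" unfolding M2_def by (intro fin_dim_set_plus fin_dim_times fM1)
  have dM2: "dim M2 = 4 * dim D" unfolding M2_def using sqfield_adjoin_dim[OF M1 fM1 b(2)] dM1 by simp
  have M12: "M1 \<subseteq> M2" unfolding M2_def by (rule subset_adjoin[OF sqfieldD(1)[OF M1]])
  have V1M2: "V1 \<subseteq> M2" unfolding V1_def M2_def by (intro set_plus_mono2 times_mono DM1 order.refl)
  have cM2: "c \<notin> M2"
  proof
    assume "c \<in> M2"
    then have "c *o D \<subseteq> M2" using DM1 M12 sqfieldD(4)[OF M2] by (auto simp: elt_set_times_def)
    then have "V \<subseteq> M2" unfolding V_eq by (intro set_plus_subset[OF sqfieldD(1)[OF M2] V1M2])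
    then show False using N[OF M2 fM2] dM2 h by simp
  qed
  have modM2: "sqmodule M1 M2" by (rule sqmodule_self[OF M1 M12 M2])
  have sub2: "subspace (M2 + c *o M1)" by (intro subspace_set_plus subspace_times sqfieldD(1) M1 M2)
  have "V + u *o V = M2 + c *o M1"
  proof
    have VS: "V \<subseteq> M2 + c *o M1" unfolding V_eq by (intro set_plus_mono2 times_mono DM1 V1M2)
    have "sqmodule M1 (M2 + c *o M1)" by (intro sqmodule_plus modM2 sqmodule_times sqmodule_self[OF M1 _ M1]) simp
    then have "u *o V \<subseteq> M2 + c *o M1"
      using VS sqmoduleD(3)[OF _ uM1] by (fastforce simp: elt_set_times_def)
    then show "V + u *o V \<subseteq> M2 + c *o M1" by (intro set_plus_subset[OF sub2 VS])
    have subG: "subspace (V + u *o V)" by (intro subspace_set_plus subspace_times V_sub)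
    have xM1: "x *o M1 \<subseteq> V + u *o V" if x: "x \<in> V" for x
    proof
      fix y assume "y \<in> x *o M1"
      then obtain d e where de: "y = x * (d + u * e)" "d \<in> D" "e \<in> D"
        unfolding M1_def by (auto simp: elt_set_times_def elim!: set_plus_elim)
      then have "y = d * x + u * (e * x)" by (simp add: algebra_simps)
      moreover have "d * x \<in> V" "e * x \<in> V" using sqmoduleD(3)[OF mod] de x by auto
      ultimately show "y \<in> V + u *o V" by blast
    qed
    have "M1 \<subseteq> V + u *o V" using M1V subset_plus_left[OF subspace_times[OF V_sub]] by blast
    then show "M2 + c *o M1 \<subseteq> V + u *o V"
      unfolding M2_def by (intro set_plus_subset[OF subG] xM1 b c)
  qed
  then show ?thesis
    using sqmodule_dim_plus_times[OF M1 fM1 modM2 fM2 cM2] dM1 dM2 by simp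
qed

section \<open>Evaluation of multivariate polynomials\<close>

lemma field_homD:
  assumes "field_hom h"
  shows "h 0 = 0" "h 1 = 1" "h (x + y) = h x + h y" "h (x * y) = h x * h y"
  using assms by (auto simp: field_hom_def)

lemma field_hom_eq_0_iff: "field_hom h \<Longrightarrow> h x = 0 \<longleftrightarrow> x = 0"
proof
  assume h: "field_hom h" and "h x = 0"
  show "x = 0"
  proof (rule ccontr)
    assume "x \<noteq> 0"
    then have "h x * h (inverse x) = 1" using field_homD(2,4)[OF h] by (metis right_inverse)
    then show False using \<open>h x = 0\<close> by simp
  qed
qed (simp add: field_homD)

text \<open>The product runs over all variables instead of the support, which makes it visibly
  multiplicative in the exponent.\<close>

definition monom_eval :: "('n::finite \<Rightarrow> 'b::field) \<Rightarrow> ('n \<Rightarrow>\<^sub>0 nat) \<Rightarrow> 'b" where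
  "monom_eval t mon = (\<Prod>i\<in>UNIV. t i ^ Poly_Mapping.lookup mon i)"

lemma monom_eval_keys: "(\<Prod>i\<in>Poly_Mapping.keys mon. t i ^ Poly_Mapping.lookup mon i) = monom_eval t mon"
  unfolding monom_eval_def by (rule prod.mono_neutral_left) (auto simp: in_keys_iff)

lemma monom_eval_add: "monom_eval t (a + b) = monom_eval t a * monom_eval t b"
  by (simp add: monom_eval_def lookup_add power_add prod.distrib)

lemma monom_eval_0: "monom_eval t 0 = 1"
  by (simp add: monom_eval_def)

lemma monom_eval_single: "monom_eval t (Poly_Mapping.single i k) = t i ^ k"
proof -
  have "monom_eval t (Poly_Mapping.single i k) = (\<Prod>j\<in>UNIV. if j = i then t j ^ k else 1)"
    unfolding monom_eval_def by (rule prod.cong) (auto simp: lookup_single when_def)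
  then show ?thesis by simp
qed

lemma mpeval_superset:
  assumes "field_hom h" "finite A" "Poly_Mapping.keys p \<subseteq> A"
  shows "mpeval h t p = (\<Sum>mon\<in>A. h (Poly_Mapping.lookup p mon) * monom_eval t mon)"
  unfolding mpeval_def monom_eval_keys
  by (rule sum.mono_neutral_left) (use assms in \<open>auto simp: in_keys_iff field_homD\<close>)

lemma mpeval_add:
  fixes h :: "'a::field \<Rightarrow> 'b::field" and t :: "'n::finite \<Rightarrow> 'b"
  assumes "field_hom h"
  shows "mpeval h t (p + r) = mpeval h t p + mpeval h t r"
proof -
  let ?A = "Poly_Mapping.keys p \<union> Poly_Mapping.keys r"
  have "Poly_Mapping.keys (p + r) \<subseteq> ?A" by (rule keys_add)
  then show ?thesis
    using mpeval_superset[OF assms, of ?A]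
    by (simp add: lookup_add field_homD[OF assms] distrib_right sum.distrib)
qed

lemma mpeval_0: "mpeval h t 0 = 0"
  by (simp add: mpeval_def)

lemma mpeval_sum:
  fixes h :: "'a::field \<Rightarrow> 'b::field" and t :: "'n::finite \<Rightarrow> 'b"
  shows "field_hom h \<Longrightarrow> mpeval h t (sum f A) = (\<Sum>i\<in>A. mpeval h t (f i))"
  by (induction A rule: infinite_finite_induct) (simp_all add: mpeval_0 mpeval_add)

lemma mpeval_single:
  fixes h :: "'a::field \<Rightarrow> 'b::field" and t :: "'n::finite \<Rightarrow> 'b"
  assumes "field_hom h"
  shows "mpeval h t (Poly_Mapping.single mon c) = h c * monom_eval t mon"
  using mpeval_superset[OF assms, of "{mon}" "Poly_Mapping.single mon c" t] by simp

lemma mpeval_const: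
  fixes h :: "'a::field \<Rightarrow> 'b::field" and t :: "'n::finite \<Rightarrow> 'b"
  shows "field_hom h \<Longrightarrow> mpeval h t (Poly_Mapping.single 0 c) = h c"
  by (simp add: mpeval_single monom_eval_0)

lemma mpeval_var:
  fixes h :: "'a::field \<Rightarrow> 'b::field" and t :: "'n::finite \<Rightarrow> 'b"
  shows "field_hom h \<Longrightarrow> mpeval h t (Poly_Mapping.single (Poly_Mapping.single i 1) 1) = t i"
  by (simp add: mpeval_single monom_eval_single field_homD)

lemma mpoly_sum_single:
  "p = (\<Sum>mon\<in>Poly_Mapping.keys p. Poly_Mapping.single mon (Poly_Mapping.lookup p mon))"
proof (rule poly_mapping_eqI)
  fix k
  have "Poly_Mapping.lookup (\<Sum>mon\<in>Poly_Mapping.keys p. Poly_Mapping.single mon (Poly_Mapping.lookup p mon)) k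
      = (\<Sum>mon\<in>Poly_Mapping.keys p. if mon = k then Poly_Mapping.lookup p k else 0)"
    unfolding lookup_sum by (rule sum.cong) (auto simp: lookup_single when_def)
  then show "Poly_Mapping.lookup p k
      = Poly_Mapping.lookup (\<Sum>mon\<in>Poly_Mapping.keys p. Poly_Mapping.single mon (Poly_Mapping.lookup p mon)) k"
    by (simp add: in_keys_iff)
qed

lemma mpeval_mult:
  fixes h :: "'a::field \<Rightarrow> 'b::field" and t :: "'n::finite \<Rightarrow> 'b"
  assumes "field_hom h"
  shows "mpeval h t (p * r) = mpeval h t p * mpeval h t r"
proof -
  let ?s = "\<lambda>p mon. Poly_Mapping.single mon (Poly_Mapping.lookup p mon)"
  let ?e = "\<lambda>p mon. h (Poly_Mapping.lookup p mon) * monom_eval t mon"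
  have "p * r = (\<Sum>a\<in>Poly_Mapping.keys p. ?s p a) * (\<Sum>b\<in>Poly_Mapping.keys r. ?s r b)"
    by (rule arg_cong2[of _ _ _ _ "(*)", OF mpoly_sum_single mpoly_sum_single])
  also have "\<dots> = (\<Sum>a\<in>Poly_Mapping.keys p. \<Sum>b\<in>Poly_Mapping.keys r. ?s p a * ?s r b)"
    by (rule sum_product)
  finally have "mpeval h t (p * r) = (\<Sum>a\<in>Poly_Mapping.keys p. \<Sum>b\<in>Poly_Mapping.keys r. ?e p a * ?e r b)"
    by (simp add: mpeval_sum[OF assms] mult_single mpeval_single[OF assms] field_homD[OF assms]
        monom_eval_add ac_simps)
  also have "\<dots> = (\<Sum>a\<in>Poly_Mapping.keys p. ?e p a) * (\<Sum>b\<in>Poly_Mapping.keys r. ?e r b)"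
    by (simp add: sum_product)
  finally show ?thesis by (simp add: mpeval_def monom_eval_keys)
qed

lemma mpoly_induct [case_names const var add mult]:
  fixes p :: "('n::finite \<Rightarrow>\<^sub>0 nat) \<Rightarrow>\<^sub>0 'a::field"
  assumes const: "\<And>c. P (Poly_Mapping.single 0 c)"
    and var: "\<And>i. P (Poly_Mapping.single (Poly_Mapping.single i 1) 1)"
    and add: "\<And>p r. P p \<Longrightarrow> P r \<Longrightarrow> P (p + r)"
    and mult: "\<And>p r. P p \<Longrightarrow> P r \<Longrightarrow> P (p * r)"
  shows "P p"
proof -
  let ?m = "\<lambda>mon :: 'n \<Rightarrow>\<^sub>0 nat. P (Poly_Mapping.single mon 1)"
  have one: "P 1" using const[of 1] by simp
  have plus: "?m (a + b)" if "?m a" "?m b" for a b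
    using mult[OF that] by (simp add: mult_single)
  have single: "?m (Poly_Mapping.single i k)" for i k
  proof (induction k)
    case (Suc k)
    then show ?case using plus[OF var Suc, of i] by (simp add: single_add[symmetric])
  qed (simp add: one)
  have sum: "?m (\<Sum>i\<in>A. Poly_Mapping.single i (k i))" for A and k :: "'n \<Rightarrow> nat"
    by (induction A rule: infinite_finite_induct) (auto simp: one intro: plus single)
  have "?m mon" for mon
    by (subst mpoly_sum_single[of mon]) (rule sum)
  then have "P (Poly_Mapping.single mon c)" for mon c
    using mult[OF const[of c], of "Poly_Mapping.single mon 1"] by (simp add: mult_single)
  then have "P (\<Sum>mon\<in>A. Poly_Mapping.single mon (k mon))" for A and k :: "_ \<Rightarrow> 'a"
    by (induction A rule: infinite_finite_induct) (auto intro: add simp: const[of 0, simplified])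
  then show ?thesis by (subst mpoly_sum_single[of p])
qed

section \<open>Polynomial functions paired with their values at a point\<close>

text \<open>\<open>polyrel h t S f y\<close>: some polynomial in the variables from \<open>S\<close> induces the function \<open>f\<close>
  and takes the value \<open>y\<close> at the point \<open>t\<close>.\<close>

inductive polyrel :: "('a::field \<Rightarrow> 'b::field) \<Rightarrow> ('n \<Rightarrow> 'b) \<Rightarrow> 'n set \<Rightarrow> (('n \<Rightarrow> 'a) \<Rightarrow> 'a) \<Rightarrow> 'b \<Rightarrow> bool"
  for h t S where
  const: "polyrel h t S (\<lambda>_. c) (h c)"
| var: "i \<in> S \<Longrightarrow> polyrel h t S (\<lambda>\<xi>. \<xi> i) (t i)"
| add: "polyrel h t S f y \<Longrightarrow> polyrel h t S g z \<Longrightarrow> polyrel h t S (\<lambda>\<xi>. f \<xi> + g \<xi>) (y + z)"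
| mult: "polyrel h t S f y \<Longrightarrow> polyrel h t S g z \<Longrightarrow> polyrel h t S (\<lambda>\<xi>. f \<xi> * g \<xi>) (y * z)"

lemma polyrel_0: "field_hom h \<Longrightarrow> polyrel h t S (\<lambda>_. 0) 0"
  using polyrel.const[of h t S 0] by (simp add: field_homD)

lemma polyrel_1: "field_hom h \<Longrightarrow> polyrel h t S (\<lambda>_. 1) 1"
  using polyrel.const[of h t S 1] by (simp add: field_homD)

lemma polyrel_sum:
  assumes "field_hom h" "\<And>i. i \<in> A \<Longrightarrow> polyrel h t S (f i) (y i)"
  shows "polyrel h t S (\<lambda>\<xi>. \<Sum>i\<in>A. f i \<xi>) (\<Sum>i\<in>A. y i)"
  using assms(2)
  by (induction A rule: infinite_finite_induct) (auto intro: polyrel.add polyrel_0 assms(1))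

lemma polyrel_power2:
  assumes "polyrel h t S f y"
  shows "polyrel h t S (\<lambda>\<xi>. (f \<xi>)^2) (y^2)"
  using polyrel.mult[OF assms assms] by (simp add: power2_eq_square)

lemma polyrel_upd:
  assumes "polyrel h t S f y" "i \<notin> S"
  shows "f (\<xi>(i := x)) = f \<xi>"
  using assms by (induction rule: polyrel.induct) auto

text \<open>Sorting by powers of the variable \<open>i\<close>. The coefficients are again related
  pairs in the remaining variables, as induction on the number of variables requires.\<close>

lemma polyrel_insert:
  assumes h: "field_hom h" and "polyrel h t (insert i S) f y"
  shows "\<exists>P Y. (\<forall>k. polyrel h t S (\<lambda>\<xi>. coeff (P \<xi>) k) (coeff Y k)) \<and>
           (\<forall>\<xi>. f \<xi> = poly (P \<xi>) (\<xi> i)) \<and> y = poly Y (t i)"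
  using assms(2)
proof (induction rule: polyrel.induct)
  case (const c)
  have "polyrel h t S (\<lambda>\<xi>. coeff [:c:] k) (coeff [:h c:] k)" for k
    by (cases k) (auto intro: polyrel.const polyrel_0[OF h])
  then show ?case by (intro exI[of _ "\<lambda>_. [:c:]"] exI[of _ "[:h c:]"]) simp
next
  case (var j)
  show ?case
  proof (cases "j = i")
    case True
    have "polyrel h t S (\<lambda>\<xi>. coeff [:0, 1:] k) (coeff [:0, 1:] k)" for k
    proof (cases k)
      case (Suc l)
      then show ?thesis by (cases l) (auto intro: polyrel_0[OF h] polyrel_1[OF h])
    qed (simp add: polyrel_0[OF h])
    then show ?thesis using True by (intro exI[of _ "\<lambda>_. [:0, 1:]"] exI[of _ "[:0, 1:]"]) simp
  next
    case False
    then have "polyrel h t S (\<lambda>\<xi>. coeff [:\<xi> j:] k) (coeff [:t j:] k)" for k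
      using var by (cases k) (auto intro: polyrel.var polyrel_0[OF h])
    then show ?thesis by (intro exI[of _ "\<lambda>\<xi>. [:\<xi> j:]"] exI[of _ "[:t j:]"]) simp
  qed
next
  case (add f y g z)
  then obtain P Y Q Z where
    "\<And>k. polyrel h t S (\<lambda>\<xi>. coeff (P \<xi>) k) (coeff Y k)" "\<And>\<xi>. f \<xi> = poly (P \<xi>) (\<xi> i)" "y = poly Y (t i)"
    "\<And>k. polyrel h t S (\<lambda>\<xi>. coeff (Q \<xi>) k) (coeff Z k)" "\<And>\<xi>. g \<xi> = poly (Q \<xi>) (\<xi> i)" "z = poly Z (t i)"
    by blast
  then show ?case
    by (intro exI[of _ "\<lambda>\<xi>. P \<xi> + Q \<xi>"] exI[of _ "Y + Z"]) (auto intro: polyrel.add)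
next
  case (mult f y g z)
  then obtain P Y Q Z where
    "\<And>k. polyrel h t S (\<lambda>\<xi>. coeff (P \<xi>) k) (coeff Y k)" "\<And>\<xi>. f \<xi> = poly (P \<xi>) (\<xi> i)" "y = poly Y (t i)"
    "\<And>k. polyrel h t S (\<lambda>\<xi>. coeff (Q \<xi>) k) (coeff Z k)" "\<And>\<xi>. g \<xi> = poly (Q \<xi>) (\<xi> i)" "z = poly Z (t i)"
    by blast
  then show ?case
    by (intro exI[of _ "\<lambda>\<xi>. P \<xi> * Q \<xi>"] exI[of _ "Y * Z"])
      (auto simp: coeff_mult intro!: polyrel_sum[OF h] polyrel.mult)
qed

text \<open>With the other variables fixed, the polynomial in the last one has infinitely many
  roots; so its coefficient functions vanish and induction applies to them.\<close>

lemma polyrel_vanish: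
  fixes h :: "'a::field \<Rightarrow> 'b::field"
  assumes h: "field_hom h" and inf: "infinite (UNIV :: 'a set)"
    and "finite S" "polyrel h t S f y" "\<And>\<xi>. f \<xi> = 0"
  shows "y = 0"
  using assms(3-)
proof (induction S arbitrary: f y rule: finite_induct)
  case empty
  from empty.prems(1) have "\<exists>c. f = (\<lambda>_. c) \<and> y = h c"
  proof (induction rule: polyrel.induct)
    case (add f y g z)
    then show ?case by (auto simp: field_homD(3)[OF h, symmetric])
  next
    case (mult f y g z)
    then show ?case by (auto simp: field_homD(4)[OF h, symmetric])
  qed auto
  then show ?case using empty.prems(2) by (auto simp: field_homD[OF h])
next
  case (insert i S)
  obtain P Y where PY: "\<And>k. polyrel h t S (\<lambda>\<xi>. coeff (P \<xi>) k) (coeff Y k)"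
    "\<And>\<xi>. f \<xi> = poly (P \<xi>) (\<xi> i)" "y = poly Y (t i)"
    using polyrel_insert[OF h insert.prems(1)] by blast
  have "P \<xi> = 0" for \<xi>
  proof -
    have "poly (P \<xi>) x = 0" for x
    proof -
      have "P (\<xi>(i := x)) = P \<xi>" using polyrel_upd[OF PY(1) insert.hyps(2)] by (simp add: poly_eq_iff)
      then show ?thesis using PY(2)[of "\<xi>(i := x)"] insert.prems(2) by simp
    qed
    then have "{x. poly (P \<xi>) x = 0} = UNIV" by blast
    then show ?thesis using inf poly_roots_finite by metis
  qed
  then have "coeff Y k = 0" for k using insert.IH[OF PY(1)] by simp
  then have "Y = 0" by (simp add: poly_eq_iff)
  then show ?case using PY(3) by simp
qed

section \<open>The Witt index over the function field\<close>

text \<open>The coordinate \<open>i\<^sub>0\<close> is the one to be eliminated. The second index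
  \<open>i\<^sub>1\<close> records dimension at least 2 and is used to produce nonsquare values of
  \<open>g\<close>.\<close>

locale form_function_field = char2_field F for F :: "'a::field itself" +
  fixes q :: "'a ^ 'n \<Rightarrow> 'a" and emb :: "'a \<Rightarrow> 'b::field" and t :: "'n \<Rightarrow> 'b" and i\<^sub>0 i\<^sub>1 :: 'n
  assumes quasilinear: "quasilinear_form q" and anisotropic: "anisotropic q"
    and function_field: "is_function_field q emb t" and i\<^sub>1: "i\<^sub>1 \<noteq> i\<^sub>0"
begin

lemma emb: "field_hom emb"
  using function_field by (simp add: is_function_field_def)

lemma L_add_self: "(x::'b) + x = 0"
proof -
  have "emb 1 + emb 1 = 0" using field_homD(1,3)[OF emb] add_self by metis
  then have "(1::'b) + 1 = 0" by (simp add: field_homD[OF emb])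
  then have "x * (1 + 1) = 0" by simp
  then show ?thesis by (simp only: distrib_left mult_1_right)
qed

sublocale L: char2_field "TYPE('b)"
proof
  have "of_nat 2 = (0::'b)" using L_add_self[of 1] by simp
  then have "CHAR('b) dvd 2" by (simp only: of_nat_eq_0_iff_char_dvd)
  moreover from this have "CHAR('b) \<le> 2" by (rule dvd_imp_le) simp
  moreover have "CHAR('b) \<noteq> 1" by simp
  moreover have "CHAR('b) \<noteq> 0" using \<open>CHAR('b) dvd 2\<close> by (metis dvd_0_left_iff zero_neq_numeral)
  ultimately show "CHAR('b) = 2" by linarith
qed

abbreviation ev :: "(('n \<Rightarrow>\<^sub>0 nat) \<Rightarrow>\<^sub>0 'a) \<Rightarrow> 'b" where "ev \<equiv> mpeval emb t"

lemma ev_0_iff: "ev p = 0 \<longleftrightarrow> qpoly q dvd p"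
  using function_field by (simp add: is_function_field_def)

lemma q_sum: "q (sum f A) = (\<Sum>i\<in>A. q (f i))"
proof -
  have "q 0 = q 0 + q 0" using quasilinear by (metis add_0 quasilinear_form_def)
  then have "q 0 = 0" by (metis add_self)
  then show ?thesis
    using quasilinear by (induction A rule: infinite_finite_induct) (auto simp: quasilinear_form_def)
qed

lemma q_expand: "q v = (\<Sum>i\<in>UNIV. (v $ i)^2 * qcoef q i)"
proof -
  have "v = (\<Sum>i\<in>UNIV. (v $ i) *s axis i 1)" by (simp add: basis_expansion)
  then have "q v = (\<Sum>i\<in>UNIV. q ((v $ i) *s axis i 1))" using q_sum by metis
  then show ?thesis using quasilinear by (simp add: quasilinear_form_def qcoef_def)
qed

lemma qcoef_indep: "indep_fam UNIV (qcoef q)"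
  unfolding indep_fam_def
proof (intro allI impI ballI)
  fix c :: "'n \<Rightarrow> 'a" and i :: 'n
  assume "(\<Sum>i\<in>UNIV. (c i)^2 * qcoef q i) = 0"
  then have "q (\<chi> i. c i) = 0" by (simp add: q_expand)
  then have "(\<chi> i. c i) = 0" using anisotropic by (simp add: anisotropic_def)
  then show "c i = 0" by (metis vec_lambda_beta zero_index)
qed

lemma qcoef_nonzero: "qcoef q i \<noteq> 0"
proof
  assume "qcoef q i = 0"
  then have "q (axis i 1) = 0" by (simp add: qcoef_def)
  then show False using anisotropic by (auto simp: anisotropic_def axis_eq_0_iff)
qed

definition w :: "'n \<Rightarrow> 'a" where "w i = qcoef q i / qcoef q i\<^sub>0"

lemma w_o: "w i\<^sub>0 = 1" by (simp add: w_def qcoef_nonzero)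

lemma qcoef_eq: "qcoef q i = qcoef q i\<^sub>0 * w i" by (simp add: w_def qcoef_nonzero)

lemma w_indep: "indep_fam UNIV w"
  unfolding indep_fam_def
proof (intro allI impI ballI)
  fix c :: "'n \<Rightarrow> 'a" and i :: 'n
  assume "(\<Sum>i\<in>UNIV. (c i)^2 * w i) = 0"
  then have "qcoef q i\<^sub>0 * (\<Sum>i\<in>UNIV. (c i)^2 * w i) = 0" by simp
  then have "(\<Sum>i\<in>UNIV. (c i)^2 * qcoef q i) = 0"
    by (subst (asm) sum_distrib_left) (simp add: w_def qcoef_nonzero)
  then show "c i = 0" using indep_famD[OF qcoef_indep] by blast
qed

text \<open>After division by the coefficient at \<open>i\<^sub>0\<close>, the equation of the
  hypersurface says that the square of that coordinate is \<open>g\<close> of the others; the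
  function field is a quadratic extension by a root of \<open>g\<close>.\<close>

definition g :: "('n \<Rightarrow> 'a) \<Rightarrow> 'a" where
  "g \<xi> = (\<Sum>i\<in>- {i\<^sub>0}. w i * (\<xi> i)^2)"

lemma sum_split_o: "(\<Sum>i\<in>UNIV. f i) = f i\<^sub>0 + (\<Sum>i\<in>- {i\<^sub>0}. f i)" for f :: "'n \<Rightarrow> 'c::comm_monoid_add"
  by (simp add: sum.remove[of UNIV i\<^sub>0] Compl_eq_Diff_UNIV)

text \<open>An equation \<open>g \<xi> = d^2\<close> is an F^2-relation between the
  \<open>w i\<close>, with \<open>d\<close> as coefficient at \<open>i\<^sub>0\<close>;
  \<open>\<xi> i\<^sub>1 \<noteq> 0\<close> makes it nontrivial.\<close>

lemma g_not_square:
  assumes "\<xi> i\<^sub>1 \<noteq> 0"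
  shows "g \<xi> \<noteq> d^2"
proof
  assume "g \<xi> = d^2"
  moreover have "(\<Sum>i\<in>- {i\<^sub>0}. ((\<xi>(i\<^sub>0 := d)) i)^2 * w i) = g \<xi>"
    unfolding g_def by (rule sum.cong) auto
  ultimately have "(\<Sum>i\<in>UNIV. ((\<xi>(i\<^sub>0 := d)) i)^2 * w i) = 0"
    unfolding sum_split_o by (simp add: w_o add_self)
  then have "(\<xi>(i\<^sub>0 := d)) i\<^sub>1 = 0" using indep_famD[OF w_indep, of "\<xi>(i\<^sub>0 := d)" i\<^sub>1] by simp
  then show False using assms i\<^sub>1 by simp
qed

lemma square_field_hom: "field_hom (\<lambda>c::'a. c^2)"
  by (simp add: field_hom_def square_add power_mult_distrib)

text \<open>The square of the evaluation at the point of the hypersurface whose coordinates are \<open>\<xi>\<close>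
  off \<open>i\<^sub>0\<close> and a square root of \<open>g \<xi>\<close> at \<open>i\<^sub>0\<close>; squaring keeps all values inside the base field.\<close>

definition E :: "('n \<Rightarrow> 'a) \<Rightarrow> (('n \<Rightarrow>\<^sub>0 nat) \<Rightarrow>\<^sub>0 'a) \<Rightarrow> 'a" where
  "E \<xi> = mpeval (\<lambda>c. c^2) (\<lambda>i. if i = i\<^sub>0 then g \<xi> else (\<xi> i)^2)"

lemma E_simps:
  "E \<xi> (p + r) = E \<xi> p + E \<xi> r" "E \<xi> (p * r) = E \<xi> p * E \<xi> r" "E \<xi> (sum f A) = (\<Sum>i\<in>A. E \<xi> (f i))"
  "E \<xi> (Poly_Mapping.single 0 c) = c^2"
  "E \<xi> (Poly_Mapping.single (Poly_Mapping.single i 1) 1) = (if i = i\<^sub>0 then g \<xi> else (\<xi> i)^2)"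
  unfolding E_def
  by (simp_all only: mpeval_add mpeval_mult mpeval_sum mpeval_const mpeval_var square_field_hom)

lemma ev_simps:
  "ev (p + r) = ev p + ev r" "ev (p * r) = ev p * ev r" "ev (sum f A) = (\<Sum>i\<in>A. ev (f i))"
  "ev (Poly_Mapping.single 0 c) = emb c" "ev (Poly_Mapping.single (Poly_Mapping.single i 1) 1) = t i"
  by (simp_all only: mpeval_add mpeval_mult mpeval_sum mpeval_const mpeval_var emb)

text \<open>The chosen point lies on the hypersurface, so \<open>E \<xi>\<close> kills the generator
  of the kernel of \<open>ev\<close> and depends only on the value in the function field.\<close>

lemma E_qpoly: "E \<xi> (qpoly q) = 0"
proof -
  have "E \<xi> (qpoly q) = (\<Sum>i\<in>UNIV. (qcoef q i)^2 * (if i = i\<^sub>0 then g \<xi> else (\<xi> i)^2)^2)"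
    unfolding qpoly_def E_def
    by (simp only: mpeval_sum[OF square_field_hom] mpeval_single[OF square_field_hom] monom_eval_single)
  also have "\<dots> = (\<Sum>i\<in>UNIV. qcoef q i * (if i = i\<^sub>0 then g \<xi> else (\<xi> i)^2))^2"
    by (simp add: square_sum power_mult_distrib)
  also have "(\<Sum>i\<in>UNIV. qcoef q i * (if i = i\<^sub>0 then g \<xi> else (\<xi> i)^2))
      = qcoef q i\<^sub>0 * g \<xi> + (\<Sum>i\<in>- {i\<^sub>0}. qcoef q i * (\<xi> i)^2)"
    by (simp add: sum_split_o)
  also have "(\<Sum>i\<in>- {i\<^sub>0}. qcoef q i * (\<xi> i)^2) = qcoef q i\<^sub>0 * g \<xi>"
    unfolding g_def sum_distrib_left by (simp add: w_def qcoef_nonzero)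
  finally show ?thesis by (simp add: add_self)
qed

lemma E_eq_0: "ev p = 0 \<Longrightarrow> E \<xi> p = 0"
  unfolding ev_0_iff by (auto simp: dvd_def E_simps E_qpoly)

lemma t_o_square: "(t i\<^sub>0)^2 = (\<Sum>i\<in>- {i\<^sub>0}. emb (w i) * (t i)^2)"
proof -
  have "ev (qpoly q) = 0" by (simp add: ev_0_iff)
  moreover have "ev (qpoly q) = (\<Sum>i\<in>UNIV. emb (qcoef q i) * (t i)^2)"
    unfolding qpoly_def by (simp only: mpeval_sum[OF emb] mpeval_single[OF emb] monom_eval_single)
  moreover have "\<dots> = emb (qcoef q i\<^sub>0) * ((t i\<^sub>0)^2 + (\<Sum>i\<in>- {i\<^sub>0}. emb (w i) * (t i)^2))"
  proof -
    have "(\<Sum>i\<in>UNIV. emb (qcoef q i) * (t i)^2) = emb (qcoef q i\<^sub>0) * (\<Sum>i\<in>UNIV. emb (w i) * (t i)^2)"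
      unfolding sum_distrib_left by (subst qcoef_eq) (simp add: field_homD(4)[OF emb] mult.assoc)
    then show ?thesis by (simp add: sum_split_o w_o field_homD(2)[OF emb])
  qed
  ultimately have "(t i\<^sub>0)^2 + (\<Sum>i\<in>- {i\<^sub>0}. emb (w i) * (t i)^2) = 0"
    using field_hom_eq_0_iff[OF emb] qcoef_nonzero by simp
  then show ?thesis by (simp add: L.add_eq_0_iff_eq)
qed

abbreviation R :: "(('n \<Rightarrow> 'a) \<Rightarrow> 'a) \<Rightarrow> 'b \<Rightarrow> bool" where "R \<equiv> polyrel emb t (- {i\<^sub>0})"

lemma R_g: "R g ((t i\<^sub>0)^2)"
proof -
  have "R (\<lambda>\<xi>. \<Sum>i\<in>- {i\<^sub>0}. w i * (\<xi> i)^2) (\<Sum>i\<in>- {i\<^sub>0}. emb (w i) * (t i)^2)"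
    by (intro polyrel_sum[OF emb] polyrel.mult polyrel.const polyrel_power2 polyrel.var)
  then show ?thesis unfolding t_o_square g_def[abs_def] .
qed

lemma R_lift: "R f y \<Longrightarrow> \<exists>p. ev p = y \<and> (\<forall>\<xi>. E \<xi> p = (f \<xi>)^2)"
proof (induction rule: polyrel.induct)
  case (const c)
  show ?case by (intro exI[of _ "Poly_Mapping.single 0 c"]) (simp add: E_simps ev_simps)
next
  case (var i)
  then show ?case
    by (intro exI[of _ "Poly_Mapping.single (Poly_Mapping.single i 1) 1"]) (simp only: E_simps ev_simps; simp)
next
  case (add f y h z)
  then obtain p r where "ev p = y" "\<forall>\<xi>. E \<xi> p = (f \<xi>)^2" "ev r = z" "\<forall>\<xi>. E \<xi> r = (h \<xi>)^2" by blast
  then show ?case by (intro exI[of _ "p + r"]) (simp add: E_simps ev_simps square_add)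
next
  case (mult f y h z)
  then obtain p r where "ev p = y" "\<forall>\<xi>. E \<xi> p = (f \<xi>)^2" "ev r = z" "\<forall>\<xi>. E \<xi> r = (h \<xi>)^2" by blast
  then show ?case by (intro exI[of _ "p * r"]) (simp add: E_simps ev_simps power_mult_distrib)
qed

text \<open>Reduction modulo the equation of the hypersurface leaves a linear polynomial in the
  coordinate \<open>i\<^sub>0\<close>. Under \<open>E\<close> its coefficients are squared and that
  coordinate becomes \<open>g\<close>.\<close>

lemma mpoly_decompose:
  "\<exists>A y B z. R A y \<and> R B z \<and> ev p = y + t i\<^sub>0 * z \<and> (\<forall>\<xi>. E \<xi> p = (A \<xi>)^2 + g \<xi> * (B \<xi>)^2)"
proof (induction p rule: mpoly_induct)
  case (const c)
  show ?case
    by (intro exI[of _ "\<lambda>_. c"] exI[of _ "emb c"] exI[of _ "\<lambda>_. 0"] exI[of _ 0])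
      (simp add: polyrel.const polyrel_0[OF emb] E_simps ev_simps)
next
  case (var i)
  show ?case
  proof (cases "i = i\<^sub>0")
    case True
    show ?thesis unfolding ev_simps E_simps
      by (intro exI[of _ "\<lambda>_. 0"] exI[of _ 0] exI[of _ "\<lambda>_. 1"] exI[of _ 1])
        (simp add: polyrel_1[OF emb] polyrel_0[OF emb] True)
  next
    case False
    then show ?thesis unfolding ev_simps E_simps
      by (intro exI[of _ "\<lambda>\<xi>. \<xi> i"] exI[of _ "t i"] exI[of _ "\<lambda>_. 0"] exI[of _ 0])
        (simp add: polyrel.var polyrel_0[OF emb])
  qed
next
  case (add p r)
  then obtain A y B z A' y' B' z' where *: "R A y" "R B z" "ev p = y + t i\<^sub>0 * z"
    "\<forall>\<xi>. E \<xi> p = (A \<xi>)^2 + g \<xi> * (B \<xi>)^2" "R A' y'" "R B' z'" "ev r = y' + t i\<^sub>0 * z'"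
    "\<forall>\<xi>. E \<xi> r = (A' \<xi>)^2 + g \<xi> * (B' \<xi>)^2" by blast
  show ?case
  proof (intro exI conjI allI)
    show "R (\<lambda>\<xi>. A \<xi> + A' \<xi>) (y + y')" "R (\<lambda>\<xi>. B \<xi> + B' \<xi>) (z + z')" using * by (auto intro: polyrel.add)
    show "ev (p + r) = y + y' + t i\<^sub>0 * (z + z')" using * by (simp add: ev_simps algebra_simps)
    show "E \<xi> (p + r) = (A \<xi> + A' \<xi>)^2 + g \<xi> * (B \<xi> + B' \<xi>)^2" for \<xi>
      using * by (simp add: E_simps square_add algebra_simps)
  qed
next
  case (mult p r)
  then obtain A y B z A' y' B' z' where *: "R A y" "R B z" "ev p = y + t i\<^sub>0 * z"
    "\<forall>\<xi>. E \<xi> p = (A \<xi>)^2 + g \<xi> * (B \<xi>)^2" "R A' y'" "R B' z'" "ev r = y' + t i\<^sub>0 * z'"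
    "\<forall>\<xi>. E \<xi> r = (A' \<xi>)^2 + g \<xi> * (B' \<xi>)^2" by blast
  show ?case
  proof (intro exI conjI allI)
    show "R (\<lambda>\<xi>. A \<xi> * A' \<xi> + g \<xi> * (B \<xi> * B' \<xi>)) (y * y' + (t i\<^sub>0)^2 * (z * z'))"
      "R (\<lambda>\<xi>. A \<xi> * B' \<xi> + B \<xi> * A' \<xi>) (y * z' + z * y')"
      using * R_g by (auto intro!: polyrel.add polyrel.mult)
    show "ev (p * r) = y * y' + (t i\<^sub>0)^2 * (z * z') + t i\<^sub>0 * (y * z' + z * y')"
      using * by (simp add: ev_simps algebra_simps power2_eq_square)
    show "E \<xi> (p * r) = (A \<xi> * A' \<xi> + g \<xi> * (B \<xi> * B' \<xi>))^2 + g \<xi> * (A \<xi> * B' \<xi> + B \<xi> * A' \<xi>)^2" for \<xi>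
    proof -
      have "E \<xi> (p * r) = ((A \<xi>)^2 + g \<xi> * (B \<xi>)^2) * ((A' \<xi>)^2 + g \<xi> * (B' \<xi>)^2)"
        using * by (simp add: E_simps)
      also have "\<dots> = ((A \<xi> * A' \<xi>)^2 + (g \<xi> * (B \<xi> * B' \<xi>))^2)
          + g \<xi> * ((A \<xi> * B' \<xi>)^2 + (B \<xi> * A' \<xi>)^2)"
        by (simp add: algebra_simps power2_eq_square)
      finally show ?thesis by (simp only: square_add)
    qed
  qed
qed

text \<open>Over a finite field every element is a square, but \<open>w i\<^sub>1\<close> is
  F^2-independent of \<open>w i\<^sub>0 = 1\<close>.\<close>

lemma infinite_UNIV: "infinite (UNIV :: 'a set)"
proof
  assume fin: "finite (UNIV :: 'a set)"
  have "inj (\<lambda>x::'a. x^2)" by (auto intro: injI simp: square_eq_iff)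
  then have "surj (\<lambda>x::'a. x^2)" using finite_UNIV_inj_surj[OF fin] by blast
  then obtain d where d: "w i\<^sub>1 = d^2" by (metis surjD)
  have "g (\<lambda>i. if i = i\<^sub>1 then 1 else 0) = (\<Sum>i\<in>- {i\<^sub>0}. if i = i\<^sub>1 then w i else 0)"
    unfolding g_def by (rule sum.cong) auto
  then have "g (\<lambda>i. if i = i\<^sub>1 then 1 else 0) = d^2" using i\<^sub>1 d by simp
  then show False using g_not_square by simp
qed

text \<open>Algebraic independence of the coordinates other than \<open>i\<^sub>0\<close>. One
  direction specialises by \<open>E\<close>; the other uses that F is infinite.\<close>

lemma R_eq_0_iff: "R f y \<Longrightarrow> y = 0 \<longleftrightarrow> (\<forall>\<xi>. f \<xi> = 0)"
proof
  assume R: "R f y"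
  obtain p where p: "ev p = y" "\<forall>\<xi>. E \<xi> p = (f \<xi>)^2" using R_lift[OF R] by blast
  show "\<forall>\<xi>. f \<xi> = 0" if "y = 0" using E_eq_0[of p] p that by simp
  show "y = 0" if "\<forall>\<xi>. f \<xi> = 0"
    using polyrel_vanish[OF emb infinite_UNIV _ R] that by simp
qed

lemma R_no_zero_divisors: "R f y \<Longrightarrow> R h z \<Longrightarrow> (\<And>\<xi>. f \<xi> * h \<xi> = 0) \<Longrightarrow> (\<forall>\<xi>. f \<xi> = 0) \<or> (\<forall>\<xi>. h \<xi> = 0)"
  using R_eq_0_iff[OF polyrel.mult, of f y h z] R_eq_0_iff[of f y] R_eq_0_iff[of h z] by simp

end

section \<open>The rank over the function field as half the maximum of
  \<open>dim (V' + u *o V')\<close>\<close>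

context form_function_field
begin

text \<open>The space \<open>V\<close> of the overview: the values of \<open>q\<close> divided by
  \<open>qcoef q i\<^sub>0\<close>.\<close>

definition V' :: "'a set" where "V' = span (range w)"

text \<open>For \<open>u \<notin> F\<^sup>2\<close>, independence of \<open>wu u\<close> on \<open>J \<times> UNIV\<close> over \<open>F\<^sup>2\<close> is independence of \<open>w\<close> on \<open>J\<close> over
  the quadratic extension \<open>F\<^sup>2(u)\<close>.\<close>

definition wu :: "'a \<Rightarrow> 'n \<times> bool \<Rightarrow> 'a" where
  "wu u p = (if snd p then u else 1) * w (fst p)"

lemma fin_dim_V': "fin_dim V'"
  by (simp add: V'_def fin_dim_span)

lemma w_V': "w i \<in> V'"
  unfolding V'_def by (intro span_base) simp

lemma dim_V': "dim V' = CARD('n)"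
  unfolding V'_def by (rule indep_fam_dim[OF _ w_indep]) simp

lemma common_denominator:
  fixes y :: "'j \<Rightarrow> 'b"
  assumes "finite J"
  shows "\<exists>r p. ev r \<noteq> 0 \<and> (\<forall>j\<in>J. y j * ev r = ev (p j))"
  using assms
proof (induction J rule: finite_induct)
  case empty
  show ?case by (intro exI[of _ "Poly_Mapping.single 0 1"]) (simp only: ev_simps field_homD[OF emb]; simp)
next
  case (insert j J)
  then obtain r p where rp: "ev r \<noteq> 0" "\<And>i. i \<in> J \<Longrightarrow> y i * ev r = ev (p i)" by blast
  obtain a b where ab: "ev b \<noteq> 0" "y j = ev a / ev b"
    using function_field unfolding is_function_field_def by blast
  have "y i * ev (r * b) = ev (if i = j then a * r else p i * b)" if "i \<in> insert j J" for i
    using that rp ab insert.hyps(2) by (auto simp: ev_simps mult.assoc[symmetric])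
  moreover have "ev (r * b) \<noteq> 0" using rp ab by (simp add: ev_simps)
  ultimately show ?case by (intro exI[of _ "r * b"] exI[of _ "\<lambda>i. if i = j then a * r else p i * b"]) blast
qed

text \<open>Over an F^2-basis of the span of all \<open>w i * w j\<close>, each coordinate of
  \<open>g \<xi> * w j\<close> is the square of a linear form in \<open>\<xi>\<close>. Taking square
  roots turns an F^2-relation into linear equations in \<open>e\<close> with coefficients polynomial
  in \<open>\<xi>\<close>.\<close>

lemma coordinates:
  obtains B :: "'a set" and v where "finite B" "\<And>p k. \<exists>y. R (v p k) y"
    "\<And>\<xi> e J. (\<Sum>p\<in>J. (e p)^2 * wu (g \<xi>) p) = 0 \<longleftrightarrow> (\<forall>k\<in>B. (\<Sum>p\<in>J. e p * v p k \<xi>) = 0)"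
proof -
  let ?W = "span ((\<lambda>(i, j). w i * w j) ` UNIV)"
  have "fin_dim ?W" by (intro fin_dim_span) simp
  then obtain B where B: "finite B" "independent B" "span B = ?W" using fin_dim_basis by metis
  have ww: "w i * w j \<in> span B" for i j unfolding B(3) by (intro span_base) auto
  define \<rho> where "\<rho> = representation B"
  have \<rho>: "(\<Sum>k\<in>B. (\<rho> x k)^2 * k) = x" if "x \<in> span B" for x
    unfolding \<rho>_def using sum_representation_eq[OF B(2) that B(1) order.refl] .
  define v where "v p k \<xi> = (if snd p then \<Sum>i\<in>- {i\<^sub>0}. \<rho> (w i * w (fst p)) k * \<xi> i
      else \<rho> (w i\<^sub>0 * w (fst p)) k)" for p :: "'n \<times> bool" and k :: 'a and \<xi> :: "'n \<Rightarrow> 'a"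
  have "\<exists>y. R (v p k) y" for p k
  proof (cases "snd p")
    case True
    have "R (\<lambda>\<xi>. \<Sum>i\<in>- {i\<^sub>0}. \<rho> (w i * w (fst p)) k * \<xi> i) (\<Sum>i\<in>- {i\<^sub>0}. emb (\<rho> (w i * w (fst p)) k) * t i)"
      by (intro polyrel_sum[OF emb] polyrel.mult polyrel.const polyrel.var)
    then show ?thesis using True by (auto simp: v_def[abs_def])
  next
    case False
    then show ?thesis by (auto simp: v_def[abs_def] intro: polyrel.const)
  qed
  moreover have "(\<Sum>p\<in>J. (e p)^2 * wu (g \<xi>) p) = 0 \<longleftrightarrow> (\<forall>k\<in>B. (\<Sum>p\<in>J. e p * v p k \<xi>) = 0)" for \<xi> e J
  proof -
    have wu: "wu (g \<xi>) p = (\<Sum>k\<in>B. (v p k \<xi>)^2 * k)" for p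
    proof (cases "snd p")
      case True
      have "wu (g \<xi>) p = (\<Sum>i\<in>- {i\<^sub>0}. (\<xi> i)^2 * (w i * w (fst p)))"
        using True by (simp add: wu_def g_def sum_distrib_left sum_distrib_right ac_simps)
      also have "\<dots> = (\<Sum>i\<in>- {i\<^sub>0}. (\<xi> i)^2 * (\<Sum>k\<in>B. (\<rho> (w i * w (fst p)) k)^2 * k))"
        using \<rho>[OF ww] by simp
      also have "\<dots> = (\<Sum>i\<in>- {i\<^sub>0}. \<Sum>k\<in>B. (\<rho> (w i * w (fst p)) k * \<xi> i)^2 * k)"
        by (simp add: sum_distrib_left power_mult_distrib ac_simps)
      also have "\<dots> = (\<Sum>k\<in>B. \<Sum>i\<in>- {i\<^sub>0}. (\<rho> (w i * w (fst p)) k * \<xi> i)^2 * k)" by (rule sum.swap)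
      also have "\<dots> = (\<Sum>k\<in>B. (v p k \<xi>)^2 * k)"
        using True by (simp add: v_def square_sum sum_distrib_right)
      finally show ?thesis .
    next
      case False
      then show ?thesis using \<rho>[OF ww, of i\<^sub>0 "fst p"] by (simp add: wu_def v_def w_o)
    qed
    have "(\<Sum>p\<in>J. (e p)^2 * wu (g \<xi>) p) = (\<Sum>p\<in>J. \<Sum>k\<in>B. (e p * v p k \<xi>)^2 * k)"
      unfolding wu sum_distrib_left by (simp add: power_mult_distrib ac_simps)
    also have "\<dots> = (\<Sum>k\<in>B. \<Sum>p\<in>J. (e p * v p k \<xi>)^2 * k)" by (rule sum.swap)
    also have "\<dots> = (\<Sum>k\<in>B. (\<Sum>p\<in>J. e p * v p k \<xi>)^2 * k)"
      by (simp add: square_sum sum_distrib_right)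
    finally have eq: "(\<Sum>p\<in>J. (e p)^2 * wu (g \<xi>) p) = (\<Sum>k\<in>B. (\<Sum>p\<in>J. e p * v p k \<xi>)^2 * k)" .
    show ?thesis
    proof
      assume "(\<Sum>p\<in>J. (e p)^2 * wu (g \<xi>) p) = 0"
      then have "(\<Sum>k\<in>B. (\<Sum>p\<in>J. e p * v p k \<xi>)^2 * k) = 0" using eq by simp
      then show "\<forall>k\<in>B. (\<Sum>p\<in>J. e p * v p k \<xi>) = 0"
        using independentD[OF B(2,1) order.refl, of "\<lambda>k. \<Sum>p\<in>J. e p * v p k \<xi>"] by blast
    next
      assume "\<forall>k\<in>B. (\<Sum>p\<in>J. e p * v p k \<xi>) = 0"
      then show "(\<Sum>p\<in>J. (e p)^2 * wu (g \<xi>) p) = 0" unfolding eq by simp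
    qed
  qed
  ultimately show ?thesis using that[OF B(1)] by blast
qed

text \<open>Assumption \<open>Z0\<close> speaks of common zeros of \<open>Z\<close>, so that one
  statement serves both specialisation at a given point and the ideal of the zero function.\<close>

lemma generic_indep_fam_wu:
  assumes Z1: "(\<lambda>_. 1) \<notin> Z"
    and Zprime: "\<And>f y h z. R f y \<Longrightarrow> R h z \<Longrightarrow> (\<lambda>\<xi>. f \<xi> * h \<xi>) \<in> Z \<Longrightarrow> f \<in> Z \<or> h \<in> Z"
    and Z0: "\<And>c. (\<And>p. p \<in> J \<Longrightarrow> \<exists>y. R (c p) y) \<Longrightarrow>
      (\<And>\<xi>. (\<forall>f\<in>Z. f \<xi> = 0) \<Longrightarrow> (\<Sum>p\<in>J. (c p \<xi>)^2 * wu (g \<xi>) p) = 0) \<Longrightarrow> (\<And>p. p \<in> J \<Longrightarrow> c p \<in> Z)"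
  obtains f y where "R f y" "f \<notin> Z" "\<And>\<xi>. f \<xi> \<noteq> 0 \<Longrightarrow> indep_fam J (wu (g \<xi>))"
proof -
  obtain B :: "'a set" and v where Bv: "finite B" "\<And>p k. \<exists>y. R (v p k) y"
    "\<And>\<xi> e J. (\<Sum>p\<in>J. (e p)^2 * wu (g \<xi>) p) = 0 \<longleftrightarrow> (\<forall>k\<in>B. (\<Sum>p\<in>J. e p * v p k \<xi>) = 0)"
    by (rule coordinates) (rule that; assumption)
  let ?R = "{f. \<exists>y. R f y}"
  have "\<exists>f\<in>?R. f \<notin> Z \<and> (\<forall>\<xi>. f \<xi> \<noteq> 0 \<longrightarrow>
           (\<forall>e. (\<forall>k\<in>B. (\<Sum>p\<in>J. e p * v p k \<xi>) = 0) \<longrightarrow> (\<forall>p\<in>J. e p = 0)))"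
  proof (rule generic_independence)
    show "(\<lambda>_. 1) \<in> ?R" using polyrel_1[OF emb] by blast
    show "(\<lambda>\<xi>. f \<xi> - h \<xi>) \<in> ?R" if "f \<in> ?R" "h \<in> ?R" for f h
      using that unfolding minus_eq by (blast intro: polyrel.add)
    show "(\<lambda>\<xi>. f \<xi> * h \<xi>) \<in> ?R" if "f \<in> ?R" "h \<in> ?R" for f h
      using that by (blast intro: polyrel.mult)
    show "(\<lambda>_. 1) \<notin> Z" by (rule Z1)
    show "f \<in> Z \<or> h \<in> Z" if "f \<in> ?R" "h \<in> ?R" "(\<lambda>\<xi>. f \<xi> * h \<xi>) \<in> Z" for f h
      using that Zprime by blast
    show "v p k \<in> ?R" for p k using Bv(2) by blast
    fix c p
    assume c: "\<And>p. p \<in> J \<Longrightarrow> c p \<in> ?R" "\<And>k. k \<in> B \<Longrightarrow> (\<lambda>\<xi>. \<Sum>p\<in>J. c p \<xi> * v p k \<xi>) \<in> Z" and p: "p \<in> J"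
    show "c p \<in> Z"
    proof (rule Z0[OF _ _ p])
      show "\<exists>y. R (c p) y" if "p \<in> J" for p using c(1)[OF that] by blast
      show "(\<Sum>p\<in>J. (c p \<xi>)^2 * wu (g \<xi>) p) = 0" if Z: "\<forall>f\<in>Z. f \<xi> = 0" for \<xi>
        unfolding Bv(3) by (intro ballI bspec[OF Z c(2)])
    qed
  qed simp
  then obtain f y where f: "R f y" "f \<notin> Z"
    "\<And>\<xi> e. f \<xi> \<noteq> 0 \<Longrightarrow> \<forall>k\<in>B. (\<Sum>p\<in>J. e p * v p k \<xi>) = 0 \<Longrightarrow> \<forall>p\<in>J. e p = 0" by blast
  have "indep_fam J (wu (g \<xi>))" if "f \<xi> \<noteq> 0" for \<xi>
    unfolding indep_fam_def Bv(3) using f(3)[OF that] by simp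
  then show ?thesis using that f by blast
qed

lemma sum_bool_pairs: "(\<Sum>p\<in>J \<times> UNIV. h p) = (\<Sum>j\<in>J. h (j, False) + h (j, True))"
  for h :: "'j \<times> bool \<Rightarrow> 'c::comm_monoid_add"
proof -
  have "(\<Sum>p\<in>J \<times> UNIV. h p) = (\<Sum>j\<in>J. \<Sum>b\<in>UNIV. h (j, b))" by (simp add: sum.cartesian_product)
  then show ?thesis by (simp add: UNIV_bool)
qed

lemma sum_wu:
  "(\<Sum>p\<in>J \<times> UNIV. (e p)^2 * wu u p) = (\<Sum>j\<in>J. w j * ((e (j, False))^2 + u * (e (j, True))^2))"
  unfolding sum_bool_pairs by (rule sum.cong) (simp_all add: wu_def algebra_simps)

text \<open>Independence spreads from \<open>\<xi>\<^sub>0\<close> to every \<open>\<xi>\<close>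
  with \<open>f \<xi> \<noteq> 0\<close>. A relation over the function field, cleared of
  denominators and sent through \<open>E\<close>, becomes at each such point a relation between the
  \<open>wu (g \<xi>)\<close>. So its coefficient functions vanish wherever \<open>f\<close> does
  not, hence everywhere.\<close>

lemma function_field_indep_if_indep_at:
  assumes "indep_fam (J \<times> UNIV) (wu (g \<xi>\<^sub>0))"
  shows "L.indep_fam J (\<lambda>j. emb (w j))"
proof -
  obtain f y\<^sub>f where f: "R f y\<^sub>f" "f \<notin> {f. f \<xi>\<^sub>0 = 0}" "\<And>\<xi>. f \<xi> \<noteq> 0 \<Longrightarrow> indep_fam (J \<times> UNIV) (wu (g \<xi>))"
  proof (rule generic_indep_fam_wu[of "{f. f \<xi>\<^sub>0 = 0}" "J \<times> UNIV"])
    fix c p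
    assume "\<And>\<xi>. \<forall>f\<in>{f. f \<xi>\<^sub>0 = 0}. f \<xi> = 0 \<Longrightarrow> (\<Sum>p\<in>J \<times> UNIV. (c p \<xi>)^2 * wu (g \<xi>) p) = 0"
      and p: "p \<in> J \<times> (UNIV :: bool set)"
    from this(1)[of \<xi>\<^sub>0] have "(\<Sum>p\<in>J \<times> UNIV. (c p \<xi>\<^sub>0)^2 * wu (g \<xi>\<^sub>0) p) = 0" by simp
    then show "c p \<in> {f. f \<xi>\<^sub>0 = 0}" using indep_famD[OF assms _ p] by simp
  qed auto
  show ?thesis
    unfolding L.indep_fam_def
  proof (intro allI impI ballI)
    fix y :: "'n \<Rightarrow> 'b" and j\<^sub>0
    assume y: "(\<Sum>j\<in>J. (y j)^2 * emb (w j)) = 0" and j\<^sub>0: "j\<^sub>0 \<in> J"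
    obtain r p where rp: "ev r \<noteq> 0" "\<And>j. j \<in> J \<Longrightarrow> y j * ev r = ev (p j)"
      using common_denominator[of J y] by auto
    have "ev (\<Sum>j\<in>J. Poly_Mapping.single 0 (w j) * (p j * p j)) = (\<Sum>j\<in>J. emb (w j) * (y j * ev r)^2)"
      using rp(2) by (simp add: ev_simps power2_eq_square)
    also have "\<dots> = (ev r)^2 * (\<Sum>j\<in>J. (y j)^2 * emb (w j))"
      by (simp add: sum_distrib_left power_mult_distrib ac_simps)
    finally have "ev (\<Sum>j\<in>J. Poly_Mapping.single 0 (w j) * (p j * p j)) = 0" using y by simp
    then have "E \<xi> (\<Sum>j\<in>J. Poly_Mapping.single 0 (w j) * (p j * p j)) = 0" for \<xi> by (rule E_eq_0)
    \<comment> \<open>Since \<open>E\<close> squares constants, the image of the relation is a full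
      square, and its root is linear in the \<open>E \<xi> (p j)\<close>.\<close>
    then have "(\<Sum>j\<in>J. (w j * E \<xi> (p j))^2) = 0" for \<xi>
      by (simp add: E_simps power2_eq_square ac_simps)
    then have rel: "(\<Sum>j\<in>J. w j * E \<xi> (p j)) = 0" for \<xi> unfolding square_sum[symmetric] by simp
    have "\<forall>j. \<exists>A y B z. R A y \<and> R B z \<and> ev (p j) = y + t i\<^sub>0 * z \<and> (\<forall>\<xi>. E \<xi> (p j) = (A \<xi>)^2 + g \<xi> * (B \<xi>)^2)"
      using mpoly_decompose by blast
    then obtain A yA B yB where AB: "\<And>j. R (A j) (yA j)" "\<And>j. R (B j) (yB j)"
      "\<And>j. ev (p j) = yA j + t i\<^sub>0 * yB j" "\<And>j \<xi>. E \<xi> (p j) = (A j \<xi>)^2 + g \<xi> * (B j \<xi>)^2"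
      by metis
    have zero: "A j\<^sub>0 \<xi> = 0 \<and> B j\<^sub>0 \<xi> = 0" if "f \<xi> \<noteq> 0" for \<xi>
    proof -
      let ?e = "\<lambda>p. if snd p then B (fst p) \<xi> else A (fst p) \<xi>"
      have "(\<Sum>p\<in>J \<times> UNIV. (?e p)^2 * wu (g \<xi>) p) = 0"
        unfolding sum_wu using rel[of \<xi>] by (simp add: AB(4))
      then have "?e p = 0" if "p \<in> J \<times> UNIV" for p by (rule indep_famD[OF f(3)[OF \<open>f \<xi> \<noteq> 0\<close>] _ that])
      from this[of "(j\<^sub>0, False)"] this[of "(j\<^sub>0, True)"] show ?thesis using j\<^sub>0 by simp
    qed
    have "f \<xi> * A j\<^sub>0 \<xi> = 0" "f \<xi> * B j\<^sub>0 \<xi> = 0" for \<xi> using zero[of \<xi>] by auto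
    moreover have "\<not> (\<forall>\<xi>. f \<xi> = 0)" using f(2) by auto
    ultimately have "\<forall>\<xi>. A j\<^sub>0 \<xi> = 0" "\<forall>\<xi>. B j\<^sub>0 \<xi> = 0"
      using R_no_zero_divisors[OF f(1) AB(1)] R_no_zero_divisors[OF f(1) AB(2)] by blast+
    then have "yA j\<^sub>0 = 0" "yB j\<^sub>0 = 0"
      using R_eq_0_iff[OF AB(1)[of j\<^sub>0]] R_eq_0_iff[OF AB(2)[of j\<^sub>0]] by blast+
    then have "ev (p j\<^sub>0) = 0" by (simp add: AB(3))
    then show "y j\<^sub>0 = 0" using rp j\<^sub>0 by (metis mult_eq_0_iff)
  qed
qed

text \<open>Were the family dependent for all \<open>\<xi>\<close>, a polynomial relation would give
  one over the function field, whose coefficients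
  \<open>y (j, False) + t i\<^sub>0 * y (j, True)\<close> must vanish. Specialised, this reads as a
  square plus \<open>g \<xi>\<close> times a square; where
  \<open>\<xi> i\<^sub>1 \<noteq> 0\<close>, the value \<open>g \<xi>\<close> is no square and both
  vanish. The point found is kept in the same region.\<close>

lemma indep_at_if_function_field_indep:
  assumes J: "L.indep_fam J (\<lambda>j. emb (w j))"
  obtains \<xi> where "\<And>d. g \<xi> \<noteq> d^2" "indep_fam (J \<times> UNIV) (wu (g \<xi>))"
proof -
  let ?x = "\<lambda>\<xi>::'n \<Rightarrow> 'a. \<xi> i\<^sub>1"
  have x: "R ?x (t i\<^sub>1)" using i\<^sub>1 by (intro polyrel.var) simp
  have x0: "\<not> (\<forall>\<xi>. ?x \<xi> = 0)" by (auto intro: exI[of _ "\<lambda>_. 1"])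
  let ?Z = "{f :: ('n \<Rightarrow> 'a) \<Rightarrow> 'a. \<forall>\<xi>. f \<xi> = 0}"
  obtain f y\<^sub>f where f: "R f y\<^sub>f" "f \<notin> ?Z" "\<And>\<xi>. f \<xi> \<noteq> 0 \<Longrightarrow> indep_fam (J \<times> UNIV) (wu (g \<xi>))"
  proof (rule generic_indep_fam_wu[of ?Z "J \<times> UNIV"])
    show "f \<in> ?Z \<or> h \<in> ?Z" if "R f y" "R h z" "(\<lambda>\<xi>. f \<xi> * h \<xi>) \<in> ?Z" for f y h z
      using R_no_zero_divisors[OF that(1,2)] that(3) by simp
    fix c p
    assume "\<And>p. p \<in> J \<times> UNIV \<Longrightarrow> \<exists>y. R (c p) y" and p: "p \<in> J \<times> (UNIV :: bool set)"
      and rel: "\<And>\<xi>. \<forall>f\<in>?Z. f \<xi> = 0 \<Longrightarrow> (\<Sum>p\<in>J \<times> UNIV. (c p \<xi>)^2 * wu (g \<xi>) p) = 0"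
    then obtain y where y: "\<And>p. p \<in> J \<times> UNIV \<Longrightarrow> R (c p) (y p)" by metis
    have "R (\<lambda>\<xi>. \<Sum>j\<in>J. w j * ((c (j, False) \<xi>)^2 + g \<xi> * (c (j, True) \<xi>)^2))
        (\<Sum>j\<in>J. emb (w j) * ((y (j, False))^2 + (t i\<^sub>0)^2 * (y (j, True))^2))"
      using y by (intro polyrel_sum[OF emb] polyrel.mult polyrel.const polyrel.add polyrel_power2 R_g) auto
    moreover have "(\<Sum>j\<in>J. w j * ((c (j, False) \<xi>)^2 + g \<xi> * (c (j, True) \<xi>)^2)) = 0" for \<xi>
      using rel[of \<xi>] by (simp add: sum_wu)
    ultimately have "(\<Sum>j\<in>J. emb (w j) * ((y (j, False))^2 + (t i\<^sub>0)^2 * (y (j, True))^2)) = 0"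
      using R_eq_0_iff by blast
    then have "(\<Sum>j\<in>J. (y (j, False) + t i\<^sub>0 * y (j, True))^2 * emb (w j)) = 0"
      by (simp add: L.square_add power_mult_distrib mult.commute)
    then have y0: "y (j, False) + t i\<^sub>0 * y (j, True) = 0" if "j \<in> J" for j
      using L.indep_famD[OF J, of "\<lambda>j. y (j, False) + t i\<^sub>0 * y (j, True)"] that by blast
    have c0: "c (j, False) \<xi> = 0 \<and> c (j, True) \<xi> = 0" if j: "j \<in> J" and \<xi>: "\<xi> i\<^sub>1 \<noteq> 0" for j \<xi>
    proof -
      obtain a where a: "ev a = y (j, False)" "\<forall>\<xi>. E \<xi> a = (c (j, False) \<xi>)^2"
        using R_lift[OF y, of "(j, False)"] j by auto
      obtain b where b: "ev b = y (j, True)" "\<forall>\<xi>. E \<xi> b = (c (j, True) \<xi>)^2"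
        using R_lift[OF y, of "(j, True)"] j by auto
      let ?X = "Poly_Mapping.single (Poly_Mapping.single i\<^sub>0 1) 1"
      have "ev (a + ?X * b) = 0" using y0[OF j] by (simp only: ev_simps a b)
      then have "E \<xi> (a + ?X * b) = 0" by (rule E_eq_0)
      then have "(c (j, False) \<xi>)^2 + g \<xi> * (c (j, True) \<xi>)^2 = 0"
        using a(2) b(2) by (simp only: E_simps) simp
      then have eq: "g \<xi> * (c (j, True) \<xi>)^2 = (c (j, False) \<xi>)^2" by (simp add: add_eq_0_iff_eq)
      have "c (j, True) \<xi> = 0"
      proof (rule ccontr)
        assume "c (j, True) \<xi> \<noteq> 0"
        then have "g \<xi> = (c (j, False) \<xi> / c (j, True) \<xi>)^2" using eq by (simp add: power_divide eq_divide_eq)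
        then show False using g_not_square[of \<xi>] \<xi> by blast
      qed
      then show ?thesis using eq by simp
    qed
    obtain j b where p_eq: "p = (j, b)" "j \<in> J" using p by auto
    have "?x \<xi> * c p \<xi> = 0" for \<xi> using c0[of j \<xi>] p_eq by (cases b) auto
    then have "\<forall>\<xi>. c p \<xi> = 0" using R_no_zero_divisors[OF x y[OF p]] x0 by blast
    then show "c p \<in> ?Z" by simp
  qed auto
  have "\<not> (\<forall>\<xi>. f \<xi> * ?x \<xi> = 0)" using R_no_zero_divisors[OF f(1) x] f(2) x0 by blast
  then obtain \<xi> where "f \<xi> \<noteq> 0" "\<xi> i\<^sub>1 \<noteq> 0" by auto
  then show ?thesis using that[of \<xi>] f(3) g_not_square by blast
qed

text \<open>Let \<open>?k\<close> be the quadratic extension of F^2 by \<open>u\<close>. Then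
  \<open>V' + u *o V'\<close> is the \<open>?k\<close>-span of the \<open>w i\<close>, and a maximal
  \<open>J\<close> indexes a \<open>?k\<close>-basis.\<close>

lemma indep_fam_wu_maximal:
  assumes u: "u \<notin> span {1}"
  obtains J where "indep_fam (J \<times> UNIV) (wu u)" "dim (V' + u *o V') = 2 * card J"
proof -
  let ?P = "\<lambda>k. \<exists>J. indep_fam (J \<times> UNIV) (wu u) \<and> card J = k"
  have "\<exists>k. ?P k \<and> (\<forall>l. ?P l \<longrightarrow> l \<le> k)"
  proof (rule Nat.ex_has_greatest_nat)
    show "?P 0" by (intro exI[of _ "{}"]) (simp add: indep_fam_def)
    show "\<forall>l. ?P l \<longrightarrow> l \<le> CARD('n)" by (auto intro: card_mono)
  qed
  then obtain J where J: "indep_fam (J \<times> UNIV) (wu u)"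
    and max: "\<And>J'. indep_fam (J' \<times> UNIV) (wu u) \<Longrightarrow> card J' \<le> card J" by blast
  let ?S = "span (wu u ` (J \<times> UNIV))"
  have finS: "fin_dim ?S" by (intro fin_dim_span) simp
  have dS: "dim ?S = 2 * card J" using indep_fam_dim[OF _ J] by (simp add: card_cartesian_product)
  let ?k = "span {1} + u *o span {1}"
  have k: "sqfield ?k" by (rule sqfield_adjoin[OF sqfield_squares])
  have fk: "fin_dim ?k" by (intro fin_dim_set_plus fin_dim_times fin_dim_span) auto
  have dk: "dim ?k = 2" using sqfield_adjoin_dim[OF sqfield_squares fin_dim_span u] dim_squares by simp
  \<comment> \<open>Multiplication by \<open>u\<close> swaps the two copies of each
    \<open>w j\<close>, up to the scalar \<open>u^2\<close>.\<close>
  have uS: "u * x \<in> ?S" if "x \<in> ?S" for x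
    using that
  proof (induction x rule: span_induct_alt)
    case (step c y z)
    then obtain j b where j: "j \<in> J" "y = wu u (j, b)" by auto
    have "wu u (j, \<not> b) \<in> ?S" using j by (intro span_base) auto
    then have "(if b then u else 1)^2 * wu u (j, \<not> b) \<in> ?S" by (rule span_scale)
    moreover have "(if b then u else 1)^2 * wu u (j, \<not> b) = u * y"
      using j by (auto simp: wu_def power2_eq_square)
    ultimately have "c^2 * (u * y) + u * z \<in> ?S" using step by (intro span_add span_scale) auto
    then show ?case by (simp add: algebra_simps)
  qed (simp add: span_zero)
  have mod: "sqmodule ?k ?S"
    unfolding sqmodule_def
  proof (intro conjI ballI subspace_span)
    fix d x assume "d \<in> ?k" and x: "x \<in> ?S"
    then obtain a b where "d = a^2 + u * b^2"
      by (auto simp: span_singleton elt_set_times_def elim!: set_plus_elim)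
    then have "d * x = a^2 * x + b^2 * (u * x)" by (simp add: algebra_simps)
    then show "d * x \<in> ?S" using x uS[OF x] by (metis span_add span_scale)
  qed
  have wS: "w i \<in> ?S" for i
  proof (rule ccontr)
    assume i: "w i \<notin> ?S"
    have iJ: "i \<notin> J"
    proof
      assume "i \<in> J"
      then have "wu u (i, False) \<in> ?S" by (intro span_base) auto
      then show False using i by (simp add: wu_def)
    qed
    have "wu u ` (insert i J \<times> UNIV) = wu u ` (J \<times> UNIV) \<union> w i *o ({1} \<union> u *o {1})"
      by (force simp: wu_def elt_set_times_def image_iff UNIV_bool mult.commute)
    then have "span (wu u ` (insert i J \<times> UNIV)) = ?S + w i *o ?k"
      by (simp only: span_Un_set_plus span_times)
    moreover have "dim (?S + w i *o ?k) = 2 * card J + 2"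
      using sqmodule_dim_plus_times[OF k fk mod finS i] dS dk by simp
    ultimately have "indep_fam (insert i J \<times> UNIV) (wu u)"
      using iJ by (intro indep_fam_if_dim) (simp_all add: card_cartesian_product)
    then show False using max[of "insert i J"] iJ by simp
  qed
  have VS: "V' \<subseteq> ?S" unfolding V'_def by (rule span_minimal) (use wS in auto)
  have "V' + u *o V' = ?S"
  proof
    show "V' + u *o V' \<subseteq> ?S"
      using VS uS by (intro set_plus_subset subspace_span) (auto simp: elt_set_times_def)
    show "?S \<subseteq> V' + u *o V'"
    proof (rule span_minimal)
      show "subspace (V' + u *o V')" by (intro subspace_set_plus subspace_times fin_dim_subspace fin_dim_V')
      have 0: "0 \<in> V'" using fin_dim_V' by (intro subspace_0 fin_dim_subspace)
      have "w j + u * 0 \<in> V' + u *o V'" "0 + u * w j \<in> V' + u *o V'" for j using 0 w_V' by blast+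
      then show "wu u ` (J \<times> UNIV) \<subseteq> V' + u *o V'" by (auto simp: wu_def)
    qed
  qed
  then show ?thesis using that[OF J] dS by simp
qed

text \<open>The dimension of the anisotropic part of the form over the function field.\<close>

definition r :: nat where "r = L.dim (L.span (range (\<lambda>i. emb (w i))))"

lemma add_square_times:
  assumes "subspace V"
  shows "V + (x + d^2) *o V = V + x *o V"
proof -
  have "V + (x + d^2) *o V \<subseteq> V + x *o V" for x d
  proof
    fix y assume "y \<in> V + (x + d^2) *o V"
    then obtain a b where ab: "a \<in> V" "b \<in> V" "y = a + (x + d^2) * b"
      by (auto simp: elt_set_times_def elim!: set_plus_elim)
    then have "y = (a + d^2 * b) + x * b" by (simp add: algebra_simps)
    moreover have "a + d^2 * b \<in> V" using ab assms by (intro subspace_add subspace_square_times)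
    ultimately show "y \<in> V + x *o V" using ab by blast
  qed
  from this[of x d] this[of "x + d^2" d] show ?thesis by (simp add: add.assoc add_self)
qed

text \<open>Every \<open>u\<close> in \<open>V'\<close> is \<open>g \<xi>\<close> plus the square of
  the coordinate at \<open>i\<^sub>0\<close>, which leaves \<open>V' + u *o V'\<close> unchanged. So
  \<open>u\<close> is a specialisation of the generic value, where the rank can only drop.\<close>

lemma dim_le_rank:
  assumes "u \<in> V'" "u \<notin> span {1}"
  shows "dim (V' + u *o V') \<le> 2 * r"
proof -
  obtain \<xi> where "u = (\<Sum>i\<in>UNIV. (\<xi> i)^2 * w i)"
    using assms(1) unfolding V'_def by (auto simp: span_image_explicit)
  then have u: "u = g \<xi> + (\<xi> i\<^sub>0)^2" by (simp add: sum_split_o w_o g_def ac_simps)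
  have "g \<xi> \<notin> span {1}"
  proof
    assume "g \<xi> \<in> span {1}"
    moreover have "(\<xi> i\<^sub>0)^2 \<in> span {1}" by (rule sqfield_square[OF sqfield_squares])
    ultimately show False using assms(2) u span_add by blast
  qed
  then obtain J where J: "indep_fam (J \<times> UNIV) (wu (g \<xi>))" "dim (V' + g \<xi> *o V') = 2 * card J"
    using indep_fam_wu_maximal by blast
  have LJ: "L.indep_fam J (\<lambda>j. emb (w j))" by (rule function_field_indep_if_indep_at[OF J(1)])
  have "card J = L.dim (L.span ((\<lambda>j. emb (w j)) ` J))" using L.indep_fam_dim[OF _ LJ] by simp
  also have "\<dots> \<le> r" unfolding r_def by (intro L.fin_dim_dim_mono L.fin_dim_span L.span_mono) auto
  finally show ?thesis
    using J(2) add_square_times[OF fin_dim_subspace[OF fin_dim_V']] u by simp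
qed

text \<open>A basis over the function field stays independent at a suitable point
  \<open>\<xi>\<close>, and \<open>u = g \<xi>\<close> attains the bound.\<close>

lemma dim_eq_rank:
  obtains u where "u \<in> V'" "u \<notin> span {1}" "dim (V' + u *o V') = 2 * r"
proof -
  obtain J where J: "L.indep_fam J (\<lambda>j. emb (w j))" "L.span ((\<lambda>j. emb (w j)) ` J) = L.span (range (\<lambda>j. emb (w j)))"
    using L.indep_fam_maximal[of UNIV "\<lambda>j. emb (w j)"] by auto
  have cJ: "card J = r" using L.indep_fam_dim[OF _ J(1)] J(2) by (simp add: r_def)
  obtain \<xi> where \<xi>: "\<And>d. g \<xi> \<noteq> d^2" "indep_fam (J \<times> UNIV) (wu (g \<xi>))"
    using indep_at_if_function_field_indep[OF J(1)] by blast
  have gV: "g \<xi> \<in> V'" unfolding g_def V'_def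
    by (intro span_sum) (subst mult.commute, intro span_scale span_base, simp)
  have gK: "g \<xi> \<notin> span {1}" using \<xi>(1) by (auto simp: span_singleton)
  have V0: "subspace V'" by (rule fin_dim_subspace[OF fin_dim_V'])
  have "w j \<in> V' + g \<xi> *o V'" "g \<xi> * w j \<in> V' + g \<xi> *o V'" for j
    by (intro subsetD[OF subset_plus_left[OF subspace_times[OF V0]]] subsetD[OF subset_plus_right[OF V0]]
        w_V' set_times_intro2)+
  then have "wu (g \<xi>) ` (J \<times> UNIV) \<subseteq> V' + g \<xi> *o V'" by (auto simp: wu_def)
  then have "dim (wu (g \<xi>) ` (J \<times> UNIV)) \<le> dim (V' + g \<xi> *o V')"
    by (intro fin_dim_dim_mono fin_dim_set_plus fin_dim_times fin_dim_V')
  moreover have "dim (wu (g \<xi>) ` (J \<times> UNIV)) = 2 * r"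
    using indep_fam_dim[OF _ \<xi>(2)] cJ by (simp add: card_cartesian_product)
  ultimately have "dim (V' + g \<xi> *o V') = 2 * r" using dim_le_rank[OF gV gK] by simp
  then show ?thesis using that gV gK by blast
qed

text \<open>The extended form is linear into the function field with the squared scaling, so
  isotropic vectors form its kernel and rank-nullity applies. Anisotropy gives
  \<open>i0 q = 0\<close>, so the truncated subtraction in \<open>i1\<close> loses nothing.\<close>

lemma i1_plus_rank: "i1 q emb + r = CARD('n)"
proof -
  interpret vecL: vspace "(*s) :: 'b \<Rightarrow> 'b ^ 'n \<Rightarrow> 'b ^ 'n" ..
  interpret p: vspace_pair "(*s) :: 'b \<Rightarrow> 'b ^ 'n \<Rightarrow> 'b ^ 'n" "\<lambda>c x::'b. c^2 * x" ..
  let ?f = "qext emb q :: 'b ^ 'n \<Rightarrow> 'b"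
  have lin: "Vector_Spaces.linear (*s) (\<lambda>c x. c^2 * x) ?f"
    by unfold_locales
      (simp_all add: qext_def L.square_add power_mult_distrib distrib_left sum.distrib sum_distrib_left ac_simps)
  have fin: "vecL.fin_dim (UNIV :: ('b ^ 'n) set)"
    unfolding vecL.fin_dim_def using vec.span_Basis vec.finite_Basis by (metis subset_UNIV vec.subspace_UNIV)
  have "q v = 0 \<longleftrightarrow> v = 0" for v
    using anisotropic q_expand[of 0] by (auto simp: anisotropic_def)
  then have "{v. q v = 0} = {0}" by auto
  then have "i0 q = 0" by (simp add: i0_def)
  moreover have "range ?f = emb (qcoef q i\<^sub>0) *o L.span (range (\<lambda>i. emb (w i)))"
  proof -
    have "?f v = emb (qcoef q i\<^sub>0) * (\<Sum>i\<in>UNIV. (v $ i)^2 * emb (w i))" for v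
      unfolding qext_def sum_distrib_left
    proof (rule sum.cong)
      fix i
      have "emb (qcoef q i) = emb (qcoef q i\<^sub>0) * emb (w i)" by (metis qcoef_eq field_homD(4)[OF emb])
      then show "emb (qcoef q i) * (v $ i)^2 = emb (qcoef q i\<^sub>0) * ((v $ i)^2 * emb (w i))" by simp
    qed simp
    then have "range ?f = (*) (emb (qcoef q i\<^sub>0)) ` range (\<lambda>v::'b ^ 'n. \<Sum>i\<in>UNIV. (v $ i)^2 * emb (w i))"
      by (simp add: image_image)
    also have "range (\<lambda>v::'b ^ 'n. \<Sum>i\<in>UNIV. (v $ i)^2 * emb (w i)) = range (\<lambda>c. \<Sum>i\<in>UNIV. (c i)^2 * emb (w i))"
    proof
      show "range (\<lambda>c. \<Sum>i\<in>UNIV. (c i)^2 * emb (w i)) \<subseteq> range (\<lambda>v::'b ^ 'n. \<Sum>i\<in>UNIV. (v $ i)^2 * emb (w i))"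
      proof
        fix y assume "y \<in> range (\<lambda>c. \<Sum>i\<in>UNIV. (c i)^2 * emb (w i))"
        then obtain c where "y = (\<Sum>i\<in>UNIV. (c i)^2 * emb (w i))" by blast
        then show "y \<in> range (\<lambda>v::'b ^ 'n. \<Sum>i\<in>UNIV. (v $ i)^2 * emb (w i))"
          by (intro range_eqI[of _ _ "\<chi> i. c i"]) simp
      qed
    qed auto
    finally show ?thesis
      unfolding L.elt_set_times_image L.span_image_explicit[OF finite] .
  qed
  then have "L.dim (range ?f) = r"
    using L.dim_times[OF L.fin_dim_span, of "range (\<lambda>i. emb (w i))" "emb (qcoef q i\<^sub>0)"]
      field_hom_eq_0_iff[OF emb] qcoef_nonzero by (simp add: r_def)
  moreover have "vec.dim (UNIV :: ('b ^ 'n) set) = CARD('n)" by (rule vec_dim_card)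
  moreover have "i0 ?f + L.dim (range ?f) = vec.dim (UNIV :: ('b ^ 'n) set)"
    using p.rank_nullity[OF lin fin] by (simp add: i0_def)
  ultimately show ?thesis by (simp add: i1_def)
qed

end

section \<open>Norm field and divisibility\<close>

context form_function_field
begin

lemma range_q: "range q = qcoef q i\<^sub>0 *o V'"
proof -
  have "q v = qcoef q i\<^sub>0 * (\<Sum>i\<in>UNIV. (v $ i)^2 * w i)" for v
  proof -
    have eq: "(v $ i)^2 * qcoef q i = qcoef q i\<^sub>0 * ((v $ i)^2 * w i)" for i
      by (subst qcoef_eq) (rule mult.left_commute)
    show ?thesis unfolding q_expand[of v] sum_distrib_left by (simp only: eq)
  qed
  then have "range q = (*) (qcoef q i\<^sub>0) ` range (\<lambda>v::'a ^ 'n. \<Sum>i\<in>UNIV. (v $ i)^2 * w i)"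
    by (simp add: image_image)
  also have "range (\<lambda>v::'a ^ 'n. \<Sum>i\<in>UNIV. (v $ i)^2 * w i) = range (\<lambda>c. \<Sum>i\<in>UNIV. (c i)^2 * w i)"
  proof
    show "range (\<lambda>c. \<Sum>i\<in>UNIV. (c i)^2 * w i) \<subseteq> range (\<lambda>v::'a ^ 'n. \<Sum>i\<in>UNIV. (v $ i)^2 * w i)"
    proof
      fix y assume "y \<in> range (\<lambda>c. \<Sum>i\<in>UNIV. (c i)^2 * w i)"
      then obtain c where "y = (\<Sum>i\<in>UNIV. (c i)^2 * w i)" by blast
      then show "y \<in> range (\<lambda>v::'a ^ 'n. \<Sum>i\<in>UNIV. (v $ i)^2 * w i)"
        by (intro range_eqI[of _ _ "\<chi> i. c i"]) simp
    qed
  qed auto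
  finally show ?thesis
    unfolding elt_set_times_image V'_def span_image_explicit[OF finite] .
qed

lemma q_comb: "q (\<Sum>p\<in>A. x p *s e p) = (\<Sum>p\<in>A. (x p)^2 * q (e p))"
  using quasilinear by (simp add: q_sum quasilinear_form_def)

lemma one_V': "1 \<in> V'"
  using w_V'[of i\<^sub>0] by (simp add: w_o)

text \<open>Scaling a form by \<open>c\<close> multiplies products of two values by the square
  \<open>c^2\<close>, so the norm field is the smallest field containing the normalised values
  \<open>V'\<close>.\<close>

lemma norm_field:
  shows "sqfield (norm_field q)" "V' \<subseteq> norm_field q" "\<And>N. sqfield N \<Longrightarrow> V' \<subseteq> N \<Longrightarrow> norm_field q \<subseteq> N"
proof -
  let ?S = "range (\<lambda>x. x^2) \<union> {x * y | x y. x \<in> value_set q \<and> y \<in> value_set q}"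
  have sub: "is_subfield (norm_field q)" and S: "?S \<subseteq> norm_field q"
    unfolding norm_field_def subfield_generated_def is_subfield_def by blast+
  have sq: "c^2 \<in> norm_field q" for c using S by blast
  show "sqfield (norm_field q)"
    unfolding sqfield_def
  proof (intro conjI subspaceI ballI)
    show "0 \<in> norm_field q" "1 \<in> norm_field q" using sub by (auto simp: is_subfield_def)
    show "x + y \<in> norm_field q" if "x \<in> norm_field q" "y \<in> norm_field q" for x y
      using sub that by (simp add: is_subfield_def)
    show mult: "x * y \<in> norm_field q" if "x \<in> norm_field q" "y \<in> norm_field q" for x y
      using sub that by (simp add: is_subfield_def)
    show "c^2 * x \<in> norm_field q" if "x \<in> norm_field q" for c x
      by (rule mult[OF sq that])
  qed
  then have N: "subspace (norm_field q)" by (rule sqfieldD)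
  show "V' \<subseteq> norm_field q"
    unfolding V'_def
  proof (rule span_minimal[OF _ N], safe)
    fix i
    have "qcoef q i * qcoef q i\<^sub>0 \<in> ?S" unfolding value_set_def qcoef_def by blast
    then have "qcoef q i * qcoef q i\<^sub>0 \<in> norm_field q" using S by blast
    then show "w i \<in> norm_field q" unfolding w_def by (rule subspace_divide[OF N])
  qed
  fix N assume N: "sqfield N" "V' \<subseteq> N"
  have "is_subfield N"
    unfolding is_subfield_def using sqfieldD[OF N(1)] sqfield_inverse[OF N(1)] by (simp add: uminus_eq)
  moreover have "?S \<subseteq> N"
  proof -
    have "x * y \<in> N" if xy: "x \<in> range q" "y \<in> range q" for x y
    proof -
      obtain a b where ab: "x = qcoef q i\<^sub>0 * a" "y = qcoef q i\<^sub>0 * b" "a \<in> V'" "b \<in> V'"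
        using xy unfolding range_q by (auto simp: elt_set_times_def)
      have "(qcoef q i\<^sub>0)^2 * (a * b) \<in> N"
        using ab N(2) by (intro sqfieldD(4)[OF N(1)] sqfield_square[OF N(1)]) auto
      then show ?thesis using ab by (simp add: power2_eq_square ac_simps)
    qed
    then show ?thesis using sqfield_square[OF N(1)] by (auto simp: value_set_def)
  qed
  ultimately show "norm_field q \<subseteq> N"
    unfolding norm_field_def subfield_generated_def by blast
qed

text \<open>A basis of \<open>V'\<close> in tensor product shape is pulled back along
  \<open>q\<close>. The preimages are independent because \<open>q\<close> sends a relation between
  them to an F^2-relation between their values.\<close>

lemma divisible_if_sqmodule:
  assumes D: "sqfield D" "fin_dim D" "dim D = 2 ^ m" and mod: "sqmodule D V'"
  shows "divisible_by_quasi_pfister m q"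
proof -
  interpret vecF: vspace "(*s) :: 'a \<Rightarrow> 'a ^ 'n \<Rightarrow> 'a ^ 'n" ..
  obtain b m' where b: "D = pfister b m'" "dim D = 2 ^ m'" using sqfield_eq_pfister[OF D(1,2)] .
  then have [simp]: "m' = m" using D(3) by simp
  have spD: "span (prod b ` Pow {..<m}) = D" using b(1) by (simp add: pfister_def)
  have indD: "indep_fam (Pow {..<m}) (prod b)"
    by (rule indep_fam_if_dim) (simp_all add: spD D(3) card_Pow del: dim_span)
  obtain k c where c: "indep_fam (Pow {..<m} \<times> {..<k}) (\<lambda>(S, j). prod b S * c j)"
    "span ((\<lambda>(S, j). prod b S * c j) ` (Pow {..<m} \<times> {..<k})) = V'" "dim V' = dim D * k"
    using sqmodule_basis[OF D(1) fin_dim_V' mod _ indD spD] by auto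
  let ?I = "Pow {..<m} \<times> {..<k}" and ?c = "\<lambda>j. qcoef q i\<^sub>0 * c j"
  have finI: "finite ?I" by simp
  have "\<exists>v. q v = prod b S * ?c j" if Sj: "(S, j) \<in> ?I" for S j
  proof -
    have "prod b S * c j \<in> span ((\<lambda>(S, j). prod b S * c j) ` ?I)"
      using imageI[OF Sj, of "\<lambda>(S, j). prod b S * c j"] by (intro span_base) simp
    then have "prod b S * c j \<in> V'" unfolding c(2) .
    then have "qcoef q i\<^sub>0 * (prod b S * c j) \<in> range q" unfolding range_q by blast
    then show ?thesis by (auto simp: ac_simps)
  qed
  note ex = this
  define e where "e p = (SOME v. q v = prod b (fst p) * ?c (snd p))" for p
  have e: "q (e (S, j)) = prod b S * ?c j" if "(S, j) \<in> ?I" for S j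
    unfolding e_def using someI_ex[OF ex[OF that]] by simp
  have qe: "q (\<Sum>p\<in>?I. x p *s e p) = (\<Sum>(S, j)\<in>?I. prod b S * ?c j * (x (S, j))^2)" for x
    unfolding q_comb by (rule sum.cong) (auto simp: e)
  have "vecF.indep_fam ?I e"
    unfolding vecF.indep_fam_def
  proof (intro allI impI ballI)
    fix x p assume s: "(\<Sum>p\<in>?I. x p *s e p) = 0" and p: "p \<in> ?I"
    have "q 0 = 0" using q_expand[of 0] by simp
    then have "(\<Sum>(S, j)\<in>?I. prod b S * ?c j * (x (S, j))^2) = 0" using qe[of x] s by simp
    moreover have "(\<Sum>(S, j)\<in>?I. prod b S * ?c j * (x (S, j))^2)
        = qcoef q i\<^sub>0 * (\<Sum>p\<in>?I. (x p)^2 * (\<lambda>(S, j). prod b S * c j) p)"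
      unfolding sum_distrib_left by (rule sum.cong) auto
    ultimately have "(\<Sum>p\<in>?I. (x p)^2 * (\<lambda>(S, j). prod b S * c j) p) = 0" using qcoef_nonzero by simp
    then show "x p = 0" by (rule indep_famD[OF c(1) _ p])
  qed
  note ind = vecF.indep_fam_inj_on[OF finI this] vecF.indep_fam_independent[OF finI this]
    vecF.indep_fam_dim[OF finI this]
  have "card ?I = CARD('n)"
    using indep_fam_dim[OF finI c(1)] c(2) dim_V' by simp
  then have "vec.dim (vec.span (e ` ?I)) = vec.dim (UNIV :: ('a ^ 'n) set)" using ind(3) by (simp add: vec_dim_card del: vec.dim_UNIV)
  then have "vec.span (e ` ?I) = UNIV"
    by (intro vec.subspace_dim_equal) simp_all
  then show ?thesis
    unfolding divisible_by_quasi_pfister_def Let_def using ind(1,2) qe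
    by (intro exI[of _ b] exI[of _ k] exI[of _ ?c] exI[of _ e]) simp
qed

text \<open>The tensor shape exhibits the values as a span on which the field
  \<open>pfister b m\<close> acts. Anisotropy gives it full degree \<open>2 ^ m\<close>.\<close>

lemma sqmodule_if_divisible:
  assumes "divisible_by_quasi_pfister m q" and card: "CARD('n) = 4 * 2 ^ m"
  obtains D where "sqfield D" "fin_dim D" "dim D = 2 ^ m" "sqmodule D V'"
proof -
  interpret vecF: vspace "(*s) :: 'a \<Rightarrow> 'a ^ 'n \<Rightarrow> 'a ^ 'n" ..
  obtain b c :: "nat \<Rightarrow> 'a" and k :: nat and e where inj: "inj_on e (Pow {..<m} \<times> {..<k})"
    and ind: "vec.independent (e ` (Pow {..<m} \<times> {..<k}))"
    and sp: "vec.span (e ` (Pow {..<m} \<times> {..<k})) = UNIV"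
    and qe: "\<And>x. q (\<Sum>p\<in>Pow {..<m} \<times> {..<k}. x p *s e p)
      = (\<Sum>(S, j)\<in>Pow {..<m} \<times> {..<k}. prod b S * c j * (x (S, j))^2)"
    using assms(1) unfolding divisible_by_quasi_pfister_def Let_def by blast
  let ?I = "Pow {..<m} \<times> {..<k}" and ?f = "\<lambda>(S, j). prod b S * c j"
  have finI: "finite ?I" by simp
  have dimI: "vec.dim (vec.span (e ` ?I)) = card ?I"
    using ind inj by (simp add: vec.dim_eq_card_independent card_image)
  then have "card ?I = CARD('n)" unfolding sp vec_dim_card by simp
  then have k: "k = 4" using card by (simp add: card_cartesian_product card_Pow)
  have vind: "vecF.indep_fam ?I e" by (rule vecF.indep_fam_if_dim[OF finI dimI])
  have qe': "q (\<Sum>p\<in>?I. x p *s e p) = (\<Sum>p\<in>?I. (x p)^2 * ?f p)" for x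
    unfolding qe by (rule sum.cong) auto
  have "range q = span (?f ` ?I)"
  proof -
    have "range q = range (\<lambda>x. q (\<Sum>p\<in>?I. x p *s e p))"
    proof
      show "range q \<subseteq> range (\<lambda>x. q (\<Sum>p\<in>?I. x p *s e p))"
      proof safe
        fix v
        have "v \<in> vec.span (e ` ?I)" unfolding sp by simp
        then obtain x where "v = (\<Sum>p\<in>?I. x p *s e p)"
          unfolding vecF.span_image_explicit[OF finI] by blast
        then show "q v \<in> range (\<lambda>x. q (\<Sum>p\<in>?I. x p *s e p))" by blast
      qed
    qed auto
    then show ?thesis unfolding span_image_explicit[OF finI] qe' .
  qed
  then have "inverse (qcoef q i\<^sub>0) *o span (?f ` ?I) = inverse (qcoef q i\<^sub>0) *o (qcoef q i\<^sub>0 *o V')"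
    by (simp only: range_q)
  then have V'_eq: "V' = inverse (qcoef q i\<^sub>0) *o span (?f ` ?I)"
    by (simp add: set_times_rearrange2 qcoef_nonzero)
  have D: "sqfield (pfister b m)" by (rule sqfield_pfister)
  have indD: "indep_fam (Pow {..<m}) (prod b)"
    unfolding indep_fam_def
  proof (intro allI impI ballI)
    fix y S assume y: "(\<Sum>S\<in>Pow {..<m}. (y S)^2 * prod b S) = 0" and S: "S \<in> Pow {..<m}"
    \<comment> \<open>A relation between the products of the \<open>b i\<close> is placed in column
      0, which exists since \<open>k = 4\<close>; it gives an isotropic vector.\<close>
    let ?x = "\<lambda>p. if snd p = 0 then y (fst p) else 0"
    have "(\<Sum>p\<in>?I. (?x p)^2 * ?f p) = (\<Sum>S\<in>Pow {..<m}. \<Sum>j<k. (?x (S, j))^2 * ?f (S, j))"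
      unfolding sum.cartesian_product by (rule sum.cong) auto
    also have "\<dots> = (\<Sum>S\<in>Pow {..<m}. (y S)^2 * prod b S * c 0)"
    proof (rule sum.cong)
      fix S
      have "(\<Sum>j<k. (?x (S, j))^2 * ?f (S, j)) = (\<Sum>j<k. if j = 0 then (y S)^2 * prod b S * c j else 0)"
        by (rule sum.cong) auto
      then show "(\<Sum>j<k. (?x (S, j))^2 * ?f (S, j)) = (y S)^2 * prod b S * c 0"
        using k by simp
    qed simp
    also have "\<dots> = 0" using y by (simp flip: sum_distrib_right)
    finally have "q (\<Sum>p\<in>?I. ?x p *s e p) = 0" unfolding qe' .
    then have "(\<Sum>p\<in>?I. ?x p *s e p) = 0" using anisotropic by (simp add: anisotropic_def)
    from vecF.indep_famD[OF vind this, of "(S, 0)"] show "y S = 0" using S k by simp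
  qed
  have dD: "dim (pfister b m) = 2 ^ m"
    unfolding pfister_def using indep_fam_dim[OF _ indD] by (simp add: card_Pow)
  have "sqmodule (pfister b m) (span (?f ` ?I))"
    unfolding sqmodule_def
  proof (intro conjI ballI subspace_span)
    fix d x assume d: "d \<in> pfister b m" and "x \<in> span (?f ` ?I)"
    from this(2) show "d * x \<in> span (?f ` ?I)"
    proof (induction x rule: span_induct_alt)
      case (step a y z)
      then obtain S j where Sj: "S \<in> Pow {..<m}" "j < k" "y = prod b S * c j" by auto
      have "prod b S \<in> pfister b m" unfolding pfister_def using Sj by (intro span_base) auto
      then have "d * prod b S \<in> pfister b m" by (rule sqfieldD(4)[OF D d])
      then have "c j * (d * prod b S) \<in> c j *o span (prod b ` Pow {..<m})" unfolding pfister_def by blast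
      also have "\<dots> = span (c j *o (prod b ` Pow {..<m}))" by (simp add: span_times)
      also have "\<dots> \<subseteq> span (?f ` ?I)"
        using Sj by (intro span_mono) (force simp: elt_set_times_image mult.commute)
      finally have "a^2 * (c j * (d * prod b S)) \<in> span (?f ` ?I)" by (rule span_scale)
      moreover have "d * (a^2 * y + z) = a^2 * (c j * (d * prod b S)) + d * z"
        using Sj by (simp add: algebra_simps)
      ultimately show ?case using step span_add by metis
    qed (simp add: span_zero)
  qed
  then have "sqmodule (pfister b m) V'" unfolding V'_eq by (rule sqmodule_times)
  then show ?thesis using that[OF D fin_dim_pfister dD] by blast
qed

lemma dim_plus_times_self:
  assumes "sqfield D" "sqmodule D V'" "u \<in> D"
  shows "dim (V' + u *o V') \<le> dim V'"
proof (rule fin_dim_dim_mono[OF fin_dim_V'])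
  have "u *o V' \<subseteq> V'" using sqmoduleD(3)[OF assms(2,3)] by (auto simp: elt_set_times_def)
  then show "V' + u *o V' \<subseteq> V'"
    using set_plus_subset[OF fin_dim_subspace[OF fin_dim_V'], of V' "u *o V'"] by blast
qed

lemma sqmodule_squares: "subspace V \<Longrightarrow> sqmodule (span {1}) V"
  unfolding sqmodule_def by (auto simp: span_singleton intro: subspace_square_times)

text \<open>The condition on \<open>i1\<close> says \<open>r = 3 * 2 ^ m\<close>, so the maximum of
  \<open>dim (V' + u *o V')\<close> is \<open>6 * 2 ^ m\<close>; the two structure results on such
  spaces then apply.\<close>

lemma i1_iff:
  assumes card: "CARD('n) = 4 * 2 ^ m"
  shows "i1 q emb = 2 ^ m \<longleftrightarrow> norm_degree q = 8 * 2 ^ m \<and> divisible_by_quasi_pfister m q"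
proof
  have V0: "subspace V'" by (rule fin_dim_subspace[OF fin_dim_V'])
  assume "i1 q emb = 2 ^ m"
  then have r: "r = 3 * 2 ^ m" using i1_plus_rank card by simp
  interpret X: extremal_space F V' m
  proof
    show "infinite (UNIV :: 'a set)" by (rule infinite_UNIV)
    show "fin_dim V'" by (rule fin_dim_V')
    show "1 \<in> V'" by (rule one_V')
    show "dim V' = 4 * 2 ^ m" using dim_V' card by simp
    show "dim (V' + u *o V') \<le> 6 * 2 ^ m" if "u \<in> V'" for u
    proof (cases "u \<in> span {1}")
      case True
      then show ?thesis
        using dim_plus_times_self[OF sqfield_squares sqmodule_squares[OF V0]] dim_V' card by fastforce
    next
      case False
      then show ?thesis using dim_le_rank[OF that] r by simp
    qed
  qed
  obtain u where u: "u \<in> V'" "dim (V' + u *o V') = 2 * r" using dim_eq_rank by blast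
  have "\<exists>u. X.good u" unfolding X.good_def using u r by auto
  then obtain D N where DN: "sqfield D" "fin_dim D" "dim D = 2 ^ m" "sqmodule D V'"
    "sqfield N" "fin_dim N" "dim N = 8 * 2 ^ m" "V' \<subseteq> N" "\<And>N'. sqfield N' \<Longrightarrow> V' \<subseteq> N' \<Longrightarrow> N \<subseteq> N'"
    by (rule X.extremal_structure) (rule that; assumption)
  have "norm_field q = N" using norm_field DN(5,8,9) by blast
  then have "norm_degree q = 8 * 2 ^ m" using DN(7) by (simp add: norm_degree_def)
  then show "norm_degree q = 8 * 2 ^ m \<and> divisible_by_quasi_pfister m q"
    using divisible_if_sqmodule[OF DN(1-4)] by blast
next
  assume *: "norm_degree q = 8 * 2 ^ m \<and> divisible_by_quasi_pfister m q"
  obtain D where D: "sqfield D" "fin_dim D" "dim D = 2 ^ m" "sqmodule D V'"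
    using sqmodule_if_divisible[OF _ card] * by blast
  have dV: "dim V' = 4 * dim D" using dim_V' card D(3) by simp
  have N: "8 * dim D \<le> dim N'" if "sqfield N'" "fin_dim N'" "V' \<subseteq> N'" for N'
    using fin_dim_dim_mono[OF that(2) norm_field(3)[OF that(1,3)]] * D(3) by (simp add: norm_degree_def)
  have six: "dim (V' + u *o V') = 6 * 2 ^ m" if "u \<in> V'" "u \<notin> D" for u
    using dim_plus_times_of_structure[OF D(1,2) fin_dim_V' one_V' dV D(4) N that] D(3) by simp
  have "\<not> V' \<subseteq> D"
  proof
    assume "V' \<subseteq> D"
    then have "dim V' \<le> dim D" by (rule fin_dim_dim_mono[OF D(2)])
    then show False using dV D(3) by simp
  qed
  then obtain u where u: "u \<in> V'" "u \<notin> D" by blast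
  then have "u \<notin> span {1}" using sqfield_contains_squares[OF D(1)] by blast
  then have ge: "6 * 2 ^ m \<le> 2 * r" using dim_le_rank[OF u(1)] six[OF u] by simp
  obtain v where v: "v \<in> V'" "dim (V' + v *o V') = 2 * r" using dim_eq_rank by blast
  \<comment> \<open>For \<open>v\<close> in \<open>D\<close> the space \<open>V'\<close> is stable
    under \<open>v\<close>, which gives only \<open>4 * 2 ^ m\<close>, less than the
    \<open>6 * 2 ^ m\<close> attained outside \<open>D\<close>.\<close>
  have "v \<notin> D"
  proof
    assume "v \<in> D"
    then have "2 * r \<le> 4 * 2 ^ m" using dim_plus_times_self[OF D(1,4)] v(2) dV D(3) by metis
    then have "6 * 2 ^ m \<le> (4 * 2 ^ m :: nat)" using ge by (rule order.trans[rotated])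
    then show False by simp
  qed
  then have "r = 3 * 2 ^ m" using six[OF v(1)] v(2) by simp
  then show "i1 q emb = 2 ^ m" using i1_plus_rank card by simp
qed

end

theorem theorem5p4:
  fixes q :: "'a::field ^ 'n \<Rightarrow> 'a"
    and emb :: "'a \<Rightarrow> 'b::field" and t :: "'n \<Rightarrow> 'b"
    and n :: nat
  assumes "CHAR('a) = 2"
    and "n \<ge> 2"
    and "quasilinear_form q"
    and "anisotropic q"
    and "CARD('n) = 2 ^ n"
    and "is_function_field q emb t"
  shows "i1 q emb = 2 ^ (n - 2) \<longleftrightarrow>
           lndeg q = real n + 1 \<and> divisible_by_quasi_pfister (n - 2) q"
proof -
  define m where "m = n - 2"
  have n: "n = m + 2" using assms(2) by (simp add: m_def)
  have card: "CARD('n) = 4 * 2 ^ m" using assms(5) by (simp add: n power_add)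
  moreover have "(1::nat) \<le> 2 ^ m" by simp
  ultimately have "\<not> CARD('n) \<le> Suc 0" by linarith
  then obtain i\<^sub>0 i\<^sub>1 :: 'n where i: "i\<^sub>1 \<noteq> i\<^sub>0" using card_le_Suc0_iff_eq[of "UNIV :: 'n set"] by auto
  interpret form_function_field "TYPE('a)" q emb t i\<^sub>0 i\<^sub>1
    using assms i by unfold_locales
  have "lndeg q = real n + 1 \<longleftrightarrow> norm_degree q = 8 * 2 ^ m"
  proof
    assume "norm_degree q = 8 * 2 ^ m"
    then have "real (norm_degree q) = 2 ^ (n + 1)" by (simp add: n power_add)
    then show "lndeg q = real n + 1" unfolding lndeg_def by (simp add: log_nat_power del: power_Suc)
  next
    assume l: "lndeg q = real n + 1"
    \<comment> \<open>Degree 0 would produce the default value \<open>log 2 0 = 0\<close>; excluding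
      it allows the logarithm to be inverted.\<close>
    have "norm_degree q \<noteq> 0"
    proof
      assume "norm_degree q = 0"
      then have "lndeg q = 0" by (simp add: lndeg_def log_def)
      then show False using l by linarith
    qed
    then have "real (norm_degree q) = 2 powr (real n + 1)" using l by (simp add: lndeg_def flip: l)
    also have "\<dots> = 2 ^ (n + 1)" by (simp add: powr_add powr_realpow)
    finally have "real (norm_degree q) = real (2 ^ (n + 1))" by simp
    then have "norm_degree q = 2 ^ (n + 1)" by (simp only: of_nat_eq_iff)
    then show "norm_degree q = 8 * 2 ^ m" by (simp add: n power_add)
  qed
  then show ?thesis using i1_iff[OF card] by (simp add: m_def)
qed

end
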